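(* The following functions, restricted to their corresponding sets $\Lambda$, are generalized Brjuno functions (i.e. each is of the form $\Phi$ for some $\nu>0$ and some pair $(G,u)$ satisfying conditions (G1)–(G7) and (U1)–(U5) of the context): (a) Yoccoz's Brjuno function $\mathcal{B}(x)=\sum_{i=1}^\infty\eta_0(x)\eta_1(x)\cdots\eta_{i-1}(x)\cdot(-\log\eta_i(x))$, where $\eta_0\equiv1$, $\eta_j=A_1^{j-1}$ and $A_1(x)=\{1/x\}$ is the Gauss map. (b) The first Wilton function $\mathcal{W}_1(x)=\sum_{i=1}^\infty\eta_0(x)\eta_1(x)\cdots\eta_{i-1}(x)\cdot\log^2(\eta_i(x))$, with the same $\eta_j$ as in (a). (c) The functions $\mathcal{B}_{\alpha,u,\nu}(x)=\sum_{i=1}^\infty\left(\eta_{\alpha,0}(x)\eta_{\alpha,1}(x)\cdots\eta_{\alpha,i-1}(x)\right)^\nu u(\eta_{\alpha,i}(x))$, where $\alpha\in[1/2,1]$, $\nu\in\mathbb{Z}^+$, $\eta_{\alpha,0}\equiv1$, $\eta_{\alpha,j}=A_\alpha^{j-1}$ for $j\ge1$, and $u:(0,1)\to\mathbb{R}^+$ is a $\mathcal{C}^1$ function with $\lim_{x\to0^+}u(x)=\infty$, under the additional assumption that $u$ satisfies (U2)–(U5) with respect to $G=A_\alpha$. For example, taking $G=A_\alpha$ for $\alpha\in[1/2,1]$ and $u(x)$ to be any of $\log^n(1/x)$ for $n\in\mathbb{Z}^+$, or $x^{-1}$, yields a generalized Brjuno function.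
   Context: **Computability.** $\mathbb{D}=\{p2^q: p,q\in\mathbb{Z}\}$. An oracle for $x\in\mathbb{R}$ is a function $\phi:\mathbb{N}\to\mathbb{D}$ with $|\phi(n)-x|<2^{-n}$ for all $n$. An oracle Turing machine $M^\phi$ may query $\phi(n)$ for any $n$ at any step of its computation. A real-valued function $f$ is computable on a set $A\subset\mathbb{R}$ if there is one oracle Turing machine $M^\phi$ such that for every $x\in A$ and every oracle $\phi$ for $x$, on input $n$ it outputs $d_n\in\mathbb{D}$ with $|f(x)-d_n|<2^{-n}$; $f$ is left-computable on $A$ if there is one oracle Turing machine which, for every $x\in A$ and every oracle for $x$, outputs an increasing sequence converging to $f(x)$. **Conditions on $G$.** Let $S=J_1\sqcup J_2\sqcup J_3\sqcup\cdots\subseteq(0,1)$ be a disjoint union of countably many open intervals $J_i=(\ell_i,r_i)$, $i\in\mathbb{Z}^+$, with $\ell_1>\ell_2>\cdots$, and let $s_0=\inf S$, $s_1=\sup S$. Let $G:S\to(0,1)$ be $\mathcal{C}^1$, $G_i=G|_{J_i}$, $G_i^{-1}:(s_0,s_1)\to J_i$ the branch of $G^{-1}$ mapping into $J_i$, and $G^k$ the $k$-th iterate (where defined). The conditions are: (G1) $G(J_i)=(s_0,s_1)$ for each $i$. (G2) $|G'|>1$, and there exist $\tau>1$, $\sigma>1$ and an integer $\kappa\ge1$ such that, with $\tau_{i,1}=\inf_{x\in J_i}|G'(x)|$ and $\tau_{i,\kappa}=\inf_{x\in J_i}|(G^\kappa)'(x)|$, one has $\tau_{i,1}^{-1}<\ell_i\sigma$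 and $\tau_{i,\kappa}^{-1}<\ell_i\tau^{-1}$ for all $i$. (G3) $G_1$ is decreasing on $J_1$. (G4) Let $\varphi$ be the unique fixed point of $G_1$ and $\delta_G(N)=G_N^{-1}(\varphi)-G_{N+1}^{-1}(\varphi)>0$. There is $D>0$ such that for all $N\in\mathbb{Z}^+$, $\frac{r_{N+1}}{\ell_{N+1}}\cdot\frac{r_N-\ell_{N+1}}{\delta_G(N)}<D$. (G5) $\frac{r_i-\ell_i}{\ell_i^2}<D$ for some constant $D>0$ independent of $i$. (G6) $G$ is computable on its domain. (G7) $g(i):=\frac{r_i}{\ell_{i+1}}-1\to0$ as $i\to\infty$. Let $\Lambda=\bigcap_{j\ge0}G^{-j}((s_0,s_1))$, i.e. the set of points all of whose iterates under $G$ are defined and lie in $S$. Points $x\in\Lambda$ are written symbolically $x=[a_1,a_2,\ldots]$, where $G^{j-1}(x)\in J_{a_j}$. **Conditions on $u$.** $u:(s_0,s_1)\to\mathbb{R}^+$ is $\mathcal{C}^1$ and: (U1) $\lim_{x\to s_0^+}u(x)=\infty$. (U2) If $s_1=1$, then $\liminf_{N\to\infty}\inf_{z,w\in(s_0,s_1)}\frac{u\circ G_1^{-1}\circ G_N^{-1}(z)}{u\circ G_1^{-1}\circ G_N^{-1}(w)}>0$. (U3) There is $C>0$ such that $|u'(x)|<\frac{C}{(x-s_0)^2}$ for all $x\in(s_0,s_1)$. (U4) $u$ is computable on the numbers $[a_1,a_2,\ldots]$ such that $a_l=1$ for all $l>l_0$ for some integer $l_0$. (U5) $u$ is left-computable on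 all of $\Lambda$. **Generalized Brjuno function.** Given such $G$, $u$ and $\nu>0$, it is $\Phi(x)=\sum_{i=1}^{\infty}\left(\eta_0(x)\cdots\eta_{i-1}(x)\right)^\nu u(\eta_i(x))$ for $x\in\Lambda$, where $\eta_0\equiv1$ and $\eta_j=G^{j-1}$ for $j\ge1$. **The $\alpha$-continued fraction maps and their sets $\Lambda$.** For $\alpha\in[1/2,1]$, $A_\alpha:[0,\alpha]\to[0,\alpha]$ is $A_\alpha(0)=0$, $A_\alpha(x)=\left|\frac1x-\left\lfloor\frac1x-\alpha+1\right\rfloor\right|$ for $x\ne0$; $A_1$ is the Gauss map. Put $b_1=1$ and, for $\alpha\in[1/2,1)$, $b_\alpha=1/n_1$ with $n_1=\lceil1/(1-\alpha)\rceil$. In the framework above one takes $G$ to be the restriction of $A_\alpha$ to $S=\{x\in(0,b_\alpha):A_\alpha(x)\in(0,b_\alpha)\}$, with $J_1,J_2,\ldots$ the connected components of $S$ listed from right to left; then $s_0=0$, $s_1=b_\alpha$, and $\Lambda$ is the corresponding invariant set. *)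

theory Defs
  imports "HOL-Analysis.Analysis" "HOL-Library.Float"
begin

section \<open>Oracle Turing machines and computable real functions\<close>

text \<open>
  The type \<^typ>\<open>float\<close> of the library is exactly the set of dyadic numbers
  \<open>p * 2 powr q\<close> with integers \<open>p\<close>, \<open>q\<close>.

  Machines are deterministic multi-tape Turing machines with two-way infinite tapes.
  States and tape symbols are natural numbers below a bound. Tape 0 holds the input \<open>n\<close> (in unary)
  and, at the end, the output; tape 1 is the query and answer tape; any further tapes are
  work tapes.
\<close>

datatype move = Move_Left | Stay | Move_Right

primrec shift :: "move \<Rightarrow> int" where
  "shift Move_Left = -1"
| "shift Stay = 0"
| "shift Move_Right = 1"

record machine =
  num_tapes :: nat
  num_states :: nat
  num_symbols :: nat
  trans :: "nat \<Rightarrow> nat list \<Rightarrow> nat \<times> (nat \<times> move) list"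

record config =
  state :: nat
  tape :: "nat \<Rightarrow> int \<Rightarrow> nat"
  head :: "nat \<Rightarrow> int"

abbreviation (input) start_state :: nat where "start_state \<equiv> 0"
abbreviation (input) halt_state :: nat where "halt_state \<equiv> 1"
abbreviation (input) query_state :: nat where "query_state \<equiv> 2"
abbreviation (input) answer_state :: nat where "answer_state \<equiv> 3"

abbreviation (input) sym_blank :: nat where "sym_blank \<equiv> 0"
abbreviation (input) sym_one :: nat where "sym_one \<equiv> 1"
abbreviation (input) sym_plus :: nat where "sym_plus \<equiv> 2"
abbreviation (input) sym_minus :: nat where "sym_minus \<equiv> 3"

text \<open>
  Only the values of the transition function on the finitely many pairs of a state below
  \<^term>\<open>num_states M\<close> and a list of \<^term>\<open>num_tapes M\<close> symbols below \<^term>\<open>num_symbols M\<close> matter;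
  a well-formed machine stays within these bounds, so it is a finite object.
\<close>

definition oracle_machine :: "machine \<Rightarrow> bool" where
  "oracle_machine M \<longleftrightarrow>
     2 \<le> num_tapes M \<and> 4 \<le> num_states M \<and> 4 \<le> num_symbols M \<and>
     (\<forall>q < num_states M. \<forall>s. length s = num_tapes M \<and> set s \<subseteq> {..<num_symbols M} \<longrightarrow>
        fst (trans M q s) < num_states M \<and>
        length (snd (trans M q s)) = num_tapes M \<and>
        fst ` set (snd (trans M q s)) \<subseteq> {..<num_symbols M})"

definition encode_int :: "int \<Rightarrow> nat list" where
  "encode_int z = (if z < 0 then sym_minus else sym_plus) # replicate (nat \<bar>z\<bar>) sym_one"

definition encode_dyadic :: "int \<Rightarrow> int \<Rightarrow> nat list" where
  "encode_dyadic p q = encode_int p @ encode_int q"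

definition write_word :: "nat list \<Rightarrow> int \<Rightarrow> nat" where
  "write_word w k = (if 0 \<le> k \<and> k < int (length w) then w ! nat k else sym_blank)"

definition holds_word :: "(int \<Rightarrow> nat) \<Rightarrow> nat list \<Rightarrow> bool" where
  "holds_word t w \<longleftrightarrow> (\<forall>k < length w. t (int k) = w ! k) \<and> t (int (length w)) = sym_blank"

definition query_number :: "(int \<Rightarrow> nat) \<Rightarrow> nat" where
  "query_number t = (LEAST n. t (int n) \<noteq> sym_one)"

text \<open>
  A query replaces the contents of tape 1 by the answer, encoded in the unique reduced form
  (odd mantissa, or mantissa and exponent both 0).
\<close>

definition step :: "machine \<Rightarrow> (nat \<Rightarrow> float) \<Rightarrow> config \<Rightarrow> config" where
  "step M \<phi> c =
     (if state c = halt_state then c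
      else if state c = query_state then
        (let d = \<phi> (query_number (tape c 1)) in
           \<lparr> state = answer_state,
             tape = (tape c)(1 := write_word (encode_dyadic (mantissa d) (exponent d))),
             head = (head c)(1 := 0) \<rparr>)
      else
        (let (q, acts) = trans M (state c) (map (\<lambda>i. tape c i (head c i)) [0..<num_tapes M]) in
           \<lparr> state = q,
             tape = (\<lambda>i. if i < num_tapes M then (tape c i)(head c i := fst (acts ! i)) else tape c i),
             head = (\<lambda>i. if i < num_tapes M then head c i + shift (snd (acts ! i)) else head c i) \<rparr>))"

definition initial_config :: "nat \<Rightarrow> config" where
  "initial_config n =
     \<lparr> state = start_state,
       tape = (\<lambda>i. if i = 0 then write_word (replicate n sym_one) else (\<lambda>_. sym_blank)),
       head = (\<lambda>_. 0) \<rparr>"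

text \<open>The output may be any pair \<open>(p, q)\<close> representing the dyadic \<open>d\<close>, not only the reduced one.\<close>

definition outputs :: "machine \<Rightarrow> (nat \<Rightarrow> float) \<Rightarrow> nat \<Rightarrow> float \<Rightarrow> bool" where
  "outputs M \<phi> n d \<longleftrightarrow>
     (\<exists>t p q. let c = (step M \<phi> ^^ t) (initial_config n) in
        state c = halt_state \<and> holds_word (tape c 0) (encode_dyadic p q) \<and> d = Float p q)"

definition oracle_for :: "(nat \<Rightarrow> float) \<Rightarrow> real \<Rightarrow> bool" where
  "oracle_for \<phi> x \<longleftrightarrow> (\<forall>n. \<bar>real_of_float (\<phi> n) - x\<bar> < 1 / 2 ^ n)"

definition computable_on :: "(real \<Rightarrow> real) \<Rightarrow> real set \<Rightarrow> bool" where
  "computable_on f A \<longleftrightarrow>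
     (\<exists>M. oracle_machine M \<and>
        (\<forall>x\<in>A. \<forall>\<phi>. oracle_for \<phi> x \<longrightarrow>
           (\<forall>n. \<exists>d. outputs M \<phi> n d \<and> \<bar>f x - real_of_float d\<bar> < 1 / 2 ^ n)))"

text \<open>The machine outputs a sequence by producing its \<open>n\<close>-th term on input \<open>n\<close>.\<close>

definition left_computable_on :: "(real \<Rightarrow> real) \<Rightarrow> real set \<Rightarrow> bool" where
  "left_computable_on f A \<longleftrightarrow>
     (\<exists>M. oracle_machine M \<and>
        (\<forall>x\<in>A. \<forall>\<phi>. oracle_for \<phi> x \<longrightarrow>
           (\<exists>d. (\<forall>n. outputs M \<phi> n (d n)) \<and> strict_mono (\<lambda>n. real_of_float (d n)) \<and>
                (\<lambda>n. real_of_float (d n)) \<longlonglongrightarrow> f x)))"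


section \<open>The conditions on \<open>G\<close>\<close>

text \<open>
  The intervals are \<open>branch l r i = (l i, r i)\<close> for \<open>i \<ge> 1\<close>; the values \<open>l 0\<close>, \<open>r 0\<close> and the values of
  \<open>G\<close> and \<open>u\<close> outside their domains are irrelevant.
\<close>

definition branch :: "(nat \<Rightarrow> real) \<Rightarrow> (nat \<Rightarrow> real) \<Rightarrow> nat \<Rightarrow> real set" where
  "branch l r i = {l i <..< r i}"

definition branches :: "(nat \<Rightarrow> real) \<Rightarrow> (nat \<Rightarrow> real) \<Rightarrow> real set" where
  "branches l r = (\<Union>i\<in>{1..}. branch l r i)"

definition s0 :: "(nat \<Rightarrow> real) \<Rightarrow> (nat \<Rightarrow> real) \<Rightarrow> real" where
  "s0 l r = Inf (branches l r)"

definition s1 :: "(nat \<Rightarrow> real) \<Rightarrow> (nat \<Rightarrow> real) \<Rightarrow> real" where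
  "s1 l r = Sup (branches l r)"

definition branch_inv :: "(nat \<Rightarrow> real) \<Rightarrow> (nat \<Rightarrow> real) \<Rightarrow> (real \<Rightarrow> real) \<Rightarrow> nat \<Rightarrow> real \<Rightarrow> real" where
  "branch_inv l r G i = the_inv_into (branch l r i) G"

definition iterate_domain :: "real set \<Rightarrow> (real \<Rightarrow> real) \<Rightarrow> nat \<Rightarrow> real set" where
  "iterate_domain X G k = {x. \<forall>j<k. (G ^^ j) x \<in> X}"

definition Lambda :: "real set \<Rightarrow> (real \<Rightarrow> real) \<Rightarrow> real set" where
  "Lambda X G = {x. \<forall>j. (G ^^ j) x \<in> X}"

definition C1_on :: "real set \<Rightarrow> (real \<Rightarrow> real) \<Rightarrow> bool" where
  "C1_on X f \<longleftrightarrow> (\<forall>x\<in>X. f differentiable (at x)) \<and> continuous_on X (deriv f)"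

definition interval_system :: "(nat \<Rightarrow> real) \<Rightarrow> (nat \<Rightarrow> real) \<Rightarrow> bool" where
  "interval_system l r \<longleftrightarrow>
     (\<forall>i\<ge>1. l i < r i) \<and> (\<forall>i\<ge>1. l (Suc i) < l i) \<and>
     disjoint_family_on (branch l r) {1..} \<and> branches l r \<subseteq> {0<..<1}"

definition min_expansion :: "(nat \<Rightarrow> real) \<Rightarrow> (nat \<Rightarrow> real) \<Rightarrow> (real \<Rightarrow> real) \<Rightarrow> nat \<Rightarrow> nat \<Rightarrow> real" where
  "min_expansion l r G i k =
     (INF x \<in> branch l r i \<inter> iterate_domain (branches l r) G k. \<bar>deriv (G ^^ k) x\<bar>)"

definition first_fixpoint :: "(nat \<Rightarrow> real) \<Rightarrow> (nat \<Rightarrow> real) \<Rightarrow> (real \<Rightarrow> real) \<Rightarrow> real" where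
  "first_fixpoint l r G = (THE x. x \<in> branch l r 1 \<and> G x = x)"

definition delta :: "(nat \<Rightarrow> real) \<Rightarrow> (nat \<Rightarrow> real) \<Rightarrow> (real \<Rightarrow> real) \<Rightarrow> nat \<Rightarrow> real" where
  "delta l r G N =
     branch_inv l r G N (first_fixpoint l r G) - branch_inv l r G (Suc N) (first_fixpoint l r G)"

definition G1 :: "(nat \<Rightarrow> real) \<Rightarrow> (nat \<Rightarrow> real) \<Rightarrow> (real \<Rightarrow> real) \<Rightarrow> bool" where
  "G1 l r G \<longleftrightarrow> (\<forall>i\<ge>1. G ` branch l r i = {s0 l r <..< s1 l r})"

definition G2 :: "(nat \<Rightarrow> real) \<Rightarrow> (nat \<Rightarrow> real) \<Rightarrow> (real \<Rightarrow> real) \<Rightarrow> bool" where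
  "G2 l r G \<longleftrightarrow>
     (\<forall>x\<in>branches l r. 1 < \<bar>deriv G x\<bar>) \<and>
     (\<exists>\<tau>>1. \<exists>\<sigma>>1. \<exists>\<kappa>\<ge>1. \<forall>i\<ge>1.
        1 / min_expansion l r G i 1 < l i * \<sigma> \<and>
        1 / min_expansion l r G i \<kappa> < l i / \<tau>)"

definition G3 :: "(nat \<Rightarrow> real) \<Rightarrow> (nat \<Rightarrow> real) \<Rightarrow> (real \<Rightarrow> real) \<Rightarrow> bool" where
  "G3 l r G \<longleftrightarrow> strict_antimono_on (branch l r 1) G"

definition G4 :: "(nat \<Rightarrow> real) \<Rightarrow> (nat \<Rightarrow> real) \<Rightarrow> (real \<Rightarrow> real) \<Rightarrow> bool" where
  "G4 l r G \<longleftrightarrow>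
     (\<forall>N\<ge>1. 0 < delta l r G N) \<and>
     (\<exists>D>0. \<forall>N\<ge>1. r (Suc N) / l (Suc N) * ((r N - l (Suc N)) / delta l r G N) < D)"

definition G5 :: "(nat \<Rightarrow> real) \<Rightarrow> (nat \<Rightarrow> real) \<Rightarrow> bool" where
  "G5 l r \<longleftrightarrow> (\<exists>D>0. \<forall>i\<ge>1. (r i - l i) / (l i)\<^sup>2 < D)"

definition G6 :: "(nat \<Rightarrow> real) \<Rightarrow> (nat \<Rightarrow> real) \<Rightarrow> (real \<Rightarrow> real) \<Rightarrow> bool" where
  "G6 l r G \<longleftrightarrow> computable_on G (branches l r)"

definition G7 :: "(nat \<Rightarrow> real) \<Rightarrow> (nat \<Rightarrow> real) \<Rightarrow> bool" where
  "G7 l r \<longleftrightarrow> (\<lambda>i. r i / l (Suc i) - 1) \<longlonglongrightarrow> 0"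

definition G_conditions :: "(nat \<Rightarrow> real) \<Rightarrow> (nat \<Rightarrow> real) \<Rightarrow> (real \<Rightarrow> real) \<Rightarrow> bool" where
  "G_conditions l r G \<longleftrightarrow>
     interval_system l r \<and> G ` branches l r \<subseteq> {0<..<1} \<and> C1_on (branches l r) G \<and>
     G1 l r G \<and> G2 l r G \<and> G3 l r G \<and> G4 l r G \<and> G5 l r \<and> G6 l r G \<and> G7 l r"


section \<open>The conditions on \<open>u\<close>\<close>

definition symbols :: "(nat \<Rightarrow> real) \<Rightarrow> (nat \<Rightarrow> real) \<Rightarrow> (real \<Rightarrow> real) \<Rightarrow> real \<Rightarrow> (nat \<Rightarrow> nat) \<Rightarrow> bool" where
  "symbols l r G x a \<longleftrightarrow> (\<forall>j\<ge>1. 1 \<le> a j \<and> (G ^^ (j - 1)) x \<in> branch l r (a j))"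

definition U1 :: "(nat \<Rightarrow> real) \<Rightarrow> (nat \<Rightarrow> real) \<Rightarrow> (real \<Rightarrow> real) \<Rightarrow> bool" where
  "U1 l r u \<longleftrightarrow> filterlim u at_top (at_right (s0 l r))"

definition U2 :: "(nat \<Rightarrow> real) \<Rightarrow> (nat \<Rightarrow> real) \<Rightarrow> (real \<Rightarrow> real) \<Rightarrow> (real \<Rightarrow> real) \<Rightarrow> bool" where
  "U2 l r G u \<longleftrightarrow>
     (s1 l r = 1 \<longrightarrow>
        liminf (\<lambda>N. INF z\<in>{s0 l r <..< s1 l r}. INF w\<in>{s0 l r <..< s1 l r}.
            ereal (u (branch_inv l r G 1 (branch_inv l r G N z)) /
                   u (branch_inv l r G 1 (branch_inv l r G N w)))) > 0)"

definition U3 :: "(nat \<Rightarrow> real) \<Rightarrow> (nat \<Rightarrow> real) \<Rightarrow> (real \<Rightarrow> real) \<Rightarrow> bool" where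
  "U3 l r u \<longleftrightarrow> (\<exists>C>0. \<forall>x\<in>{s0 l r <..< s1 l r}. \<bar>deriv u x\<bar> < C / (x - s0 l r)\<^sup>2)"

definition U4 :: "(nat \<Rightarrow> real) \<Rightarrow> (nat \<Rightarrow> real) \<Rightarrow> (real \<Rightarrow> real) \<Rightarrow> (real \<Rightarrow> real) \<Rightarrow> bool" where
  "U4 l r G u \<longleftrightarrow>
     computable_on u {x \<in> Lambda (branches l r) G. \<exists>a l0. symbols l r G x a \<and> (\<forall>k>l0. a k = 1)}"

definition U5 :: "(nat \<Rightarrow> real) \<Rightarrow> (nat \<Rightarrow> real) \<Rightarrow> (real \<Rightarrow> real) \<Rightarrow> (real \<Rightarrow> real) \<Rightarrow> bool" where
  "U5 l r G u \<longleftrightarrow> left_computable_on u (Lambda (branches l r) G)"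

definition U_conditions :: "(nat \<Rightarrow> real) \<Rightarrow> (nat \<Rightarrow> real) \<Rightarrow> (real \<Rightarrow> real) \<Rightarrow> (real \<Rightarrow> real) \<Rightarrow> bool" where
  "U_conditions l r G u \<longleftrightarrow>
     (\<forall>x\<in>{s0 l r <..< s1 l r}. 0 < u x) \<and> C1_on {s0 l r <..< s1 l r} u \<and>
     U1 l r u \<and> U2 l r G u \<and> U3 l r u \<and> U4 l r G u \<and> U5 l r G u"


section \<open>Generalized Brjuno functions\<close>

definition eta :: "(real \<Rightarrow> real) \<Rightarrow> nat \<Rightarrow> real \<Rightarrow> real" where
  "eta G j x = (if j = 0 then 1 else (G ^^ (j - 1)) x)"

text \<open>
  The series may diverge to infinity, so its value is an extended nonnegative real. Here and below
  the summation index starts at 0, so the term with index \<open>i\<close> is the one usually numbered \<open>i + 1\<close>.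
\<close>

definition Phi :: "(real \<Rightarrow> real) \<Rightarrow> (real \<Rightarrow> real) \<Rightarrow> real \<Rightarrow> real \<Rightarrow> ennreal" where
  "Phi G u \<nu> x = (\<Sum>i. ennreal ((\<Prod>j\<le>i. eta G j x) powr \<nu> * u (eta G (Suc i) x)))"

definition generalized_brjuno_on :: "real set \<Rightarrow> (real \<Rightarrow> ennreal) \<Rightarrow> bool" where
  "generalized_brjuno_on X F \<longleftrightarrow>
     (\<exists>l r G u. \<exists>\<nu>>0. G_conditions l r G \<and> U_conditions l r G u \<and>
        X = Lambda (branches l r) G \<and> (\<forall>x\<in>X. F x = Phi G u \<nu> x))"


section \<open>\<open>\<alpha>\<close>-continued fractions\<close>

definition alpha_map :: "real \<Rightarrow> real \<Rightarrow> real" where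
  "alpha_map \<alpha> x = (if x = 0 then 0 else \<bar>1 / x - of_int \<lfloor>1 / x - \<alpha> + 1\<rfloor>\<bar>)"

lemma alpha_map_1: "alpha_map 1 x = frac (1 / x)"
  by (simp add: alpha_map_def frac_def)

definition alpha_bound :: "real \<Rightarrow> real" where
  "alpha_bound \<alpha> = (if \<alpha> = 1 then 1 else 1 / of_int \<lceil>1 / (1 - \<alpha>)\<rceil>)"

definition alpha_domain :: "real \<Rightarrow> real set" where
  "alpha_domain \<alpha> =
     {x \<in> {0 <..< alpha_bound \<alpha>}. alpha_map \<alpha> x \<in> {0 <..< alpha_bound \<alpha>}}"

definition alpha_Lambda :: "real \<Rightarrow> real set" where
  "alpha_Lambda \<alpha> = Lambda (alpha_domain \<alpha>) (alpha_map \<alpha>)"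

text \<open>
  The components of the domain, listed from right to left; this determines \<open>l i\<close> and \<open>r i\<close> for
  \<open>i \<ge> 1\<close> uniquely.
\<close>

definition alpha_branches :: "real \<Rightarrow> (nat \<Rightarrow> real) \<Rightarrow> (nat \<Rightarrow> real) \<Rightarrow> bool" where
  "alpha_branches \<alpha> l r \<longleftrightarrow>
     bij_betw (branch l r) {1..} (components (alpha_domain \<alpha>)) \<and> (\<forall>i\<ge>1. l (Suc i) < l i)"

definition yoccoz_brjuno :: "real \<Rightarrow> ennreal" where
  "yoccoz_brjuno x =
     (\<Sum>i. ennreal ((\<Prod>j\<le>i. eta (alpha_map 1) j x) * (- ln (eta (alpha_map 1) (Suc i) x))))"

definition wilton1 :: "real \<Rightarrow> ennreal" where
  "wilton1 x =
     (\<Sum>i. ennreal ((\<Prod>j\<le>i. eta (alpha_map 1) j x) * (ln (eta (alpha_map 1) (Suc i) x))\<^sup>2))"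

definition brjuno_alpha :: "real \<Rightarrow> (real \<Rightarrow> real) \<Rightarrow> nat \<Rightarrow> real \<Rightarrow> ennreal" where
  "brjuno_alpha \<alpha> u \<nu> x =
     (\<Sum>i. ennreal ((\<Prod>j\<le>i. eta (alpha_map \<alpha>) j x) ^ \<nu> * u (eta (alpha_map \<alpha>) (Suc i) x)))"

end

theory Submission
  imports Defs
begin

text \<open>
  There are two independent reasons why the theorem holds, one geometric and one computational.

  The geometry is simple in the coordinate \<open>1/x\<close>, where every branch of \<open>A\<^sub>\<alpha>\<close> over its domain \<open>S\<close> is affine of slope \<open>1\<close>
  or \<open>-1\<close>: there is an integer \<open>M\<close> (\<open>1\<close> for \<open>\<alpha> = 1\<close>, and \<open>\<lceil>1/(1-\<alpha>)\<rceil>\<close> otherwise) such that the \<open>i\<close>-th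
  branch is the set where \<open>1/x\<close> lies in an interval \<open>(a\<^sub>i, a\<^sub>i + 1/M)\<close>, and there the map is \<open>1/x - a\<^sub>i\<close> or
  \<open>a\<^sub>i + 1/M - 1/x\<close>. The intervals begin at \<open>M\<close>, are disjoint and ordered, and \<open>a\<^sub>i\<^sub>+\<^sub>1 \<le> a\<^sub>i + 1\<close>. These facts
  are the locale \<open>reciprocal_branches\<close>; from them (G1)-(G5) and (G7) are inequalities between endpoints.
  Only the second half of (G2) looks at an iterate: the derivative of \<open>G\<^sup>3\<close> at \<open>x\<close> has absolute value
  \<open>(x G(x) G\<^sup>2(x))\<^sup>-\<^sup>2\<close>, and the product of two successive points of an orbit is below \<open>1/2\<close> (lemma
  \<open>contraction\<close>), so \<open>\<kappa> = 3\<close> works. The weights are treated in the same coordinates.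

  Conditions (G6), (U4), (U5) ask for Turing machines. A while language on tapes is
  compiled to oracle machines (\<open>outputs_compile\<close>). Unary counters, kept as head positions, run
  every function built by primitive recursion (\<open>reg_computable_rec\<close>). One fixed program then asks
  for \<open>\<phi>(1), \<phi>(2), \<dots>\<close> until a register-computable test succeeds and prints a register-computable dyadic
  number (\<open>search_machine_exists\<close>). Consequently a real function is computable as soon as it has
  rational enclosures that shrink as the precision of the argument grows; and if the printed
  number is the lower end of the enclosure minus \<open>2\<^sup>-\<^sup>n\<^sup>-\<^sup>1\<close>, the same machine also shows
  left-computability (\<open>approximable_machine\<close>).

  It remains to find enclosures. For \<open>1/x\<close> they come from integer division. The map \<open>A\<^sub>\<alpha>\<close> on \<open>S\<close> is the
  fractional part of \<open>1/x\<close> for \<open>\<alpha> = 1\<close>, and the distance of \<open>1/x\<close> to the nearest integer for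
  \<open>\<alpha> < 1\<close>, because values in \<open>S\<close> are below \<open>1/M \<le> 1/2\<close>; so the machine does not have to know \<open>\<alpha>\<close>,
  which may be an uncomputable real. As \<open>1/x\<close> is never an integer on \<open>S\<close>, its integer part is decided
  at some finite precision. Finally \<open>ln (N/X)\<close> differs from the harmonic sum of \<open>1/i\<close> over
  \<open>X \<le> i < N\<close> by at most \<open>1/X\<close>, which encloses \<open>ln (1/x)\<close> and its powers.

  For arbitrary weights in part (c) the endpoints \<open>l\<close>, \<open>r\<close> are given only as an enumeration of the
  components of \<open>S\<close> from right to left; such an enumeration is unique
  (\<open>decreasing_enumeration_unique\<close>), so the explicit intervals above are the given ones.
\<close>

section \<open>Tape programs and their compilation to oracle machines\<close>

text \<open>
  Machines are obtained by compiling structured programs. \<open>While i S p\<close> repeats \<open>p\<close> as long as the symbol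
  under head \<open>i\<close> lies in \<open>S\<close>; this is the only form of branching.
\<close>

datatype prog = Move nat move | Write nat nat | Query | Seq prog prog (infixr ";;" 60)
  | While nat "nat set" prog

definition answer :: "(nat \<Rightarrow> float) \<Rightarrow> (int \<Rightarrow> nat) \<Rightarrow> int \<Rightarrow> nat" where
  "answer \<phi> w = (let d = \<phi> (query_number w) in write_word (encode_dyadic (mantissa d) (exponent d)))"

text \<open>
  A big-step semantics relates terminating runs only, which suffices because a machine has to halt
  to produce an output.
\<close>

inductive exec :: "(nat \<Rightarrow> float) \<Rightarrow> prog \<Rightarrow> (nat \<Rightarrow> int \<Rightarrow> nat) \<Rightarrow> (nat \<Rightarrow> int) \<Rightarrow>
    (nat \<Rightarrow> int \<Rightarrow> nat) \<Rightarrow> (nat \<Rightarrow> int) \<Rightarrow> bool" for \<phi> where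
  exec_Move: "exec \<phi> (Move i m) t h t (h(i := h i + shift m))"
| exec_Write: "exec \<phi> (Write i x) t h (t(i := (t i)(h i := x))) h"
| exec_Query: "exec \<phi> Query t h (t(1 := answer \<phi> (t 1))) (h(1 := 0))"
| exec_Seq: "exec \<phi> p t h t' h' \<Longrightarrow> exec \<phi> q t' h' t'' h'' \<Longrightarrow> exec \<phi> (p ;; q) t h t'' h''"
| exec_While_False: "t i (h i) \<notin> S \<Longrightarrow> exec \<phi> (While i S p) t h t h"
| exec_While_True: "t i (h i) \<in> S \<Longrightarrow> exec \<phi> p t h t' h' \<Longrightarrow> exec \<phi> (While i S p) t' h' t'' h'' \<Longrightarrow>
    exec \<phi> (While i S p) t h t'' h''"

primrec wf_prog :: "nat \<Rightarrow> prog \<Rightarrow> bool" where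
  "wf_prog K (Move i m) \<longleftrightarrow> i < K"
| "wf_prog K (Write i x) \<longleftrightarrow> i < K \<and> x < 4"
| "wf_prog K Query \<longleftrightarrow> 1 < K"
| "wf_prog K (p ;; q) \<longleftrightarrow> wf_prog K p \<and> wf_prog K q"
| "wf_prog K (While i S p) \<longleftrightarrow> i < K \<and> wf_prog K p"

lemma wf_prog_mono: "wf_prog K p \<Longrightarrow> K \<le> K' \<Longrightarrow> wf_prog K' p"
  by (induction p) auto

primrec len :: "prog \<Rightarrow> nat" where
  "len (Move i m) = 1"
| "len (Write i x) = 1"
| "len Query = 1"
| "len (p ;; q) = len p + len q"
| "len (While i S p) = Suc (len p)"

lemma len_pos: "0 < len p"
  by (induction p) auto

definition idle :: "nat list \<Rightarrow> (nat \<times> move) list" where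
  "idle ss = map (\<lambda>s. (s, Stay)) ss"

text \<open>
  \<open>code p K a c\<close> is the transition table of \<open>p\<close> placed in the \<open>len p\<close> states from \<open>a\<close> on, leaving to state
  \<open>c\<close>. Every answer arrives in the one state \<open>answer_state\<close>, whichever query was asked. A query
  therefore first writes its continuation \<open>c\<close> as a symbol on the extra tape \<open>K\<close>, and the answer state jumps
  to the state that it reads there. This is why a compiled machine has as many symbols as states.
\<close>

primrec code :: "prog \<Rightarrow> nat \<Rightarrow> nat \<Rightarrow> nat \<Rightarrow> nat \<Rightarrow> nat list \<Rightarrow> nat \<times> (nat \<times> move) list" where
  "code (Move i m) K a c q ss = (c, (idle ss)[i := (ss ! i, m)])"
| "code (Write i x) K a c q ss = (c, (idle ss)[i := (x, Stay)])"
| "code Query K a c q ss = (query_state, (idle ss)[K := (c, Stay)])"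
| "code (p ;; p') K a c q ss =
     (if q < a + len p then code p K a (a + len p) q ss else code p' K (a + len p) c q ss)"
| "code (While i S p) K a c q ss =
     (if q = a then (if ss ! i \<in> S then Suc a else c, idle ss) else code p K (Suc a) a q ss)"

definition compile :: "nat \<Rightarrow> prog \<Rightarrow> machine" where
  "compile K p = \<lparr> num_tapes = Suc K, num_states = 4 + len p, num_symbols = 4 + len p,
     trans = (\<lambda>q ss. if q = start_state then (4, idle ss)
        else if q = answer_state then (ss ! K, idle ss)
        else code p K 4 halt_state q ss) \<rparr>"

lemma trans_compile:
  "trans (compile K p) q ss = (if q = start_state then (4, idle ss)
     else if q = answer_state then (ss ! K, idle ss) else code p K 4 halt_state q ss)"
  by (simp add: compile_def)

lemma num_tapes_compile: "num_tapes (compile K p) = Suc K"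
  by (simp add: compile_def)

lemma idle_bounds:
  assumes "set ss \<subseteq> {..<N}"
  shows "length (idle ss) = length ss" "fst ` set (idle ss) \<subseteq> {..<N}"
  using assms by (simp_all add: idle_def image_image)

lemma idle_update_bounds:
  assumes "set ss \<subseteq> {..<N}" "x < N"
  shows "length ((idle ss)[i := (x, m)]) = length ss"
    "fst ` set ((idle ss)[i := (x, m)]) \<subseteq> {..<N}"
proof -
  have "fst ` set ((idle ss)[i := (x, m)]) \<subseteq> insert x (fst ` set (idle ss))"
    using set_update_subset_insert[of "idle ss" i "(x, m)"] by force
  then show "fst ` set ((idle ss)[i := (x, m)]) \<subseteq> {..<N}"
    using idle_bounds(2)[OF assms(1)] assms(2) by blast
qed (simp add: idle_def)

lemma code_bounds:
  assumes "wf_prog K p" "a + len p \<le> N" "c < N" "4 \<le> N" "length ss = Suc K" "set ss \<subseteq> {..<N}"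
  shows "fst (code p K a c q ss) < N \<and> length (snd (code p K a c q ss)) = Suc K \<and>
    fst ` set (snd (code p K a c q ss)) \<subseteq> {..<N}"
  using assms
proof (induction p arbitrary: a c)
  case (Move i m)
  have "ss ! i \<in> set ss" using Move(1,5) by (intro nth_mem) simp
  then have "ss ! i < N" using Move(6) by blast
  then show ?case using idle_update_bounds[OF Move(6)] Move(3,5) by simp
next
  case (Write i x)
  then have "x < N" by simp
  then show ?case using idle_update_bounds[OF Write(6)] Write(3,5) by simp
next
  case Query
  then show ?case using idle_update_bounds[OF Query(6)] by simp
next
  case (Seq p1 p2)
  have "a + len p1 < N" using Seq.prems(2) len_pos[of p2] by simp
  then show ?case
    using Seq.IH(1)[of a "a + len p1"] Seq.IH(2)[of "a + len p1" c] Seq.prems by simp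
next
  case (While i S p)
  have "Suc a < N" "a < N" using While.prems(2) len_pos[of p] by simp_all
  then show ?case
    using While.IH[of "Suc a" a] While.prems idle_bounds[OF While.prems(6)] by simp
qed

lemma oracle_machine_compile:
  assumes "wf_prog K p" "2 \<le> K"
  shows "oracle_machine (compile K p)"
proof -
  let ?N = "4 + len p" and ?M = "compile K p"
  have code: "fst (code p K 4 1 q ss) < ?N \<and> length (snd (code p K 4 1 q ss)) = Suc K \<and>
    fst ` set (snd (code p K 4 1 q ss)) \<subseteq> {..<?N}"
    if "length ss = Suc K" "set ss \<subseteq> {..<?N}" for q ss
    using code_bounds[of K p 4 ?N 1 ss q] assms that by simp
  have read: "ss ! K < ?N" if "length ss = Suc K" "set ss \<subseteq> {..<?N}" for ss
  proof -
    have "ss ! K \<in> set ss" using that(1) by (intro nth_mem) simp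
    then show ?thesis using that(2) by blast
  qed
  have "fst (trans ?M q ss) < ?N \<and> length (snd (trans ?M q ss)) = Suc K \<and>
        fst ` set (snd (trans ?M q ss)) \<subseteq> {..<?N}"
    if "length ss = Suc K" "set ss \<subseteq> {..<?N}" for q ss
    using code[OF that, of q] read[OF that] idle_bounds[OF that(2)] that(1) len_pos[of p]
    by (simp add: trans_compile)
  moreover have "num_tapes ?M = Suc K" "num_states ?M = ?N" "num_symbols ?M = ?N"
    by (simp_all add: compile_def)
  ultimately show ?thesis
    using assms(2) unfolding oracle_machine_def by auto
qed

definition reaches :: "machine \<Rightarrow> (nat \<Rightarrow> float) \<Rightarrow> config \<Rightarrow> config \<Rightarrow> bool" where
  "reaches M \<phi> c c' \<longleftrightarrow> (\<exists>T. (step M \<phi> ^^ T) c = c')"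

lemma reaches_trans: "reaches M \<phi> c c' \<Longrightarrow> reaches M \<phi> c' c'' \<Longrightarrow> reaches M \<phi> c c''"
  unfolding reaches_def
proof safe
  fix T T'
  show "\<exists>U. (step M \<phi> ^^ U) c = (step M \<phi> ^^ T') ((step M \<phi> ^^ T) c)"
    by (rule exI[of _ "T' + T"]) (simp add: funpow_add)
qed

lemma reaches_step: "step M \<phi> c = c' \<Longrightarrow> reaches M \<phi> c c'"
  unfolding reaches_def by (rule exI[of _ 1]) simp

text \<open>
  The contents \<open>v\<close> of the return-address tape are separated from the store \<open>t\<close>, \<open>h\<close> that the program
  sees; the head of that tape never moves.
\<close>

definition conf :: "nat \<Rightarrow> nat \<Rightarrow> (int \<Rightarrow> nat) \<Rightarrow> (nat \<Rightarrow> int \<Rightarrow> nat) \<Rightarrow> (nat \<Rightarrow> int) \<Rightarrow> config" where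
  "conf K q v t h = \<lparr>state = q, tape = t(K := v), head = h(K := 0)\<rparr>"

lemma step_conf:
  assumes "num_tapes M = Suc K" "q \<noteq> halt_state" "q \<noteq> query_state"
    and "trans M q (map (\<lambda>i. (t(K := v)) i ((h(K := 0)) i)) [0..<Suc K]) =
       (q', (idle (map (\<lambda>i. (t(K := v)) i ((h(K := 0)) i)) [0..<Suc K]))[i := (x, m)])"
    and "i < K"
  shows "step M \<phi> (conf K q v t h) =
    conf K q' v (t(i := (t i)(h i := x))) (h(i := h i + shift m))"
  using assms
  by (auto simp: step_def conf_def fun_eq_iff idle_def nth_list_update simp del: upt_Suc)

lemma step_idle:
  assumes "num_tapes M = Suc K" "q \<noteq> halt_state" "q \<noteq> query_state"
    and "trans M q (map (\<lambda>i. (t(K := v)) i ((h(K := 0)) i)) [0..<Suc K]) =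
       (q', idle (map (\<lambda>i. (t(K := v)) i ((h(K := 0)) i)) [0..<Suc K]))"
  shows "step M \<phi> (conf K q v t h) = conf K q' v t h"
  using assms
  by (auto simp: step_def conf_def fun_eq_iff idle_def simp del: upt_Suc)

lemma step_save:
  assumes "num_tapes M = Suc K" "q \<noteq> halt_state" "q \<noteq> query_state"
    and "trans M q (map (\<lambda>i. (t(K := v)) i ((h(K := 0)) i)) [0..<Suc K]) =
       (q', (idle (map (\<lambda>i. (t(K := v)) i ((h(K := 0)) i)) [0..<Suc K]))[K := (x, Stay)])"
  shows "step M \<phi> (conf K q v t h) = conf K q' (v(0 := x)) t h"
  using assms
  by (auto simp: step_def conf_def fun_eq_iff idle_def nth_list_update simp del: upt_Suc)

text \<open>
  Compilation is correct wherever the code is placed and whatever is on tape \<open>K\<close>: both have to be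
  arbitrary for the induction, since subprograms are placed elsewhere and queries overwrite the
  saved address.
\<close>

lemma exec_reaches:
  assumes "exec \<phi> p t h t' h'" "wf_prog K p" "4 \<le> a" "2 \<le> K" "num_tapes M = Suc K"
    and "\<And>ss. trans M answer_state ss = (ss ! K, idle ss)"
    and "\<And>q ss. a \<le> q \<Longrightarrow> q < a + len p \<Longrightarrow> trans M q ss = code p K a c q ss"
  shows "\<exists>v'. reaches M \<phi> (conf K a v t h) (conf K c v' t' h')"
  using assms
proof (induction arbitrary: a c v rule: exec.induct)
  case (exec_Move i m t h)
  have "step M \<phi> (conf K a v t h) = conf K c v (t(i := (t i)(h i := t i (h i)))) (h(i := h i + shift m))"
    by (rule step_conf) (use exec_Move in \<open>auto simp del: upt_Suc\<close>)
  from reaches_step[OF this] show ?case by (simp only: fun_upd_triv) blast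
next
  case (exec_Write i x t h)
  have "step M \<phi> (conf K a v t h) = conf K c v (t(i := (t i)(h i := x))) (h(i := h i + shift Stay))"
    by (rule step_conf) (use exec_Write in \<open>auto simp del: upt_Suc\<close>)
  from reaches_step[OF this] show ?case by (simp only: fun_upd_triv shift.simps add_0_right) blast
next
  case (exec_Query t h)
  have 1: "step M \<phi> (conf K a v t h) = conf K query_state (v(0 := c)) t h"
    by (rule step_save) (use exec_Query in \<open>auto simp del: upt_Suc\<close>)
  have 2: "step M \<phi> (conf K query_state (v(0 := c)) t h) =
      conf K answer_state (v(0 := c)) (t(1 := answer \<phi> (t 1))) (h(1 := 0))"
    using exec_Query(3) by (auto simp: step_def conf_def answer_def Let_def fun_eq_iff)
  have 3: "step M \<phi> (conf K answer_state (v(0 := c)) t' h') = conf K c (v(0 := c)) t' h'" for t' h'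
    by (rule step_idle) (use exec_Query in \<open>auto simp del: upt_Suc\<close>)
  show ?case
    using reaches_trans[OF reaches_step[OF 1] reaches_trans[OF reaches_step[OF 2] reaches_step[OF 3]]]
    by blast
next
  case (exec_Seq p t h t' h' q t'' h'')
  have "\<exists>v'. reaches M \<phi> (conf K a v t h) (conf K (a + len p) v' t' h')"
    by (rule exec_Seq.IH(1)) (use exec_Seq.prems in auto)
  moreover have "\<exists>v''. reaches M \<phi> (conf K (a + len p) v' t' h') (conf K c v'' t'' h'')" for v'
    by (rule exec_Seq.IH(2)) (use exec_Seq.prems in auto)
  ultimately show ?case using reaches_trans by blast
next
  case (exec_While_False t i h S p)
  have "step M \<phi> (conf K a v t h) = conf K c v t h"
    by (rule step_idle) (use exec_While_False in \<open>auto simp del: upt_Suc\<close>)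
  from reaches_step[OF this] show ?case by blast
next
  case (exec_While_True t i h S p t' h' t'' h'')
  have "step M \<phi> (conf K a v t h) = conf K (Suc a) v t h"
    by (rule step_idle) (use exec_While_True in \<open>auto simp del: upt_Suc\<close>)
  then have 1: "reaches M \<phi> (conf K a v t h) (conf K (Suc a) v t h)" by (rule reaches_step)
  have 2: "\<exists>v'. reaches M \<phi> (conf K (Suc a) v t h) (conf K a v' t' h')"
    by (rule exec_While_True.IH(1)) (use exec_While_True.prems in auto)
  have 3: "\<exists>v''. reaches M \<phi> (conf K a v' t' h') (conf K c v'' t'' h'')" for v'
    by (rule exec_While_True.IH(2)) (use exec_While_True.prems in auto)
  from 1 2 3 show ?case using reaches_trans by blast
qed

lemma outputs_compile:
  assumes "exec \<phi> p (tape (initial_config n)) (\<lambda>_. 0) t' h'" "wf_prog K p" "2 \<le> K"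
    and "holds_word (t' 0) (encode_dyadic P Q)"
  shows "outputs (compile K p) \<phi> n (Float P Q)"
proof -
  let ?M = "compile K p" and ?t = "tape (initial_config n)" and ?h = "\<lambda>_::nat. 0::int"
  have init: "initial_config n = conf K 0 (?t K) ?t ?h"
    by (auto simp: initial_config_def conf_def fun_eq_iff)
  have first: "step ?M \<phi> (conf K 0 (?t K) ?t ?h) = conf K 4 (?t K) ?t ?h"
    by (rule step_idle) (simp_all add: trans_compile num_tapes_compile del: upt_Suc)
  have "\<exists>v'. reaches ?M \<phi> (conf K 4 (?t K) ?t ?h) (conf K 1 v' t' h')"
    by (rule exec_reaches) (use assms in \<open>simp_all add: trans_compile num_tapes_compile\<close>)
  then obtain v' where "reaches ?M \<phi> (conf K 4 (?t K) ?t ?h) (conf K 1 v' t' h')" ..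
  from reaches_trans[OF reaches_step[OF first] this]
  have "reaches ?M \<phi> (initial_config n) (conf K 1 v' t' h')"
    by (subst init)
  then obtain T where "(step ?M \<phi> ^^ T) (initial_config n) = conf K 1 v' t' h'"
    by (auto simp: reaches_def)
  then show ?thesis
    using assms(3,4) unfolding outputs_def
    by (intro exI[of _ T] exI[of _ P] exI[of _ Q]) (simp add: conf_def)
qed

section \<open>Arithmetic on registers\<close>

text \<open>
  Register \<open>j\<close> is the position of the head on tape \<open>j + 2\<close>. Each such tape carries a single mark at
  position \<open>0\<close>, so that a register is zero exactly when its head reads the mark. The tape contents never change
  during arithmetic, and the state is just the function from registers to numbers.
\<close>

definition marked :: "nat \<Rightarrow> (nat \<Rightarrow> int \<Rightarrow> nat) \<Rightarrow> bool" where
  "marked K t \<longleftrightarrow> (\<forall>i\<in>{2..<K}. t i = (\<lambda>k. if k = 0 then sym_plus else sym_blank))"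

definition heads :: "int \<Rightarrow> int \<Rightarrow> (nat \<Rightarrow> nat) \<Rightarrow> nat \<Rightarrow> int" where
  "heads x y s i = (if i = 0 then x else if i = 1 then y else int (s (i - 2)))"

text \<open>
  Quantifying over the oracle and over the tapes and heads \<open>0\<close>, \<open>1\<close> expresses that register programs neither
  query nor use the input, output and query tapes.
\<close>

definition rexec :: "nat \<Rightarrow> prog \<Rightarrow> (nat \<Rightarrow> nat) \<Rightarrow> (nat \<Rightarrow> nat) \<Rightarrow> bool" where
  "rexec K p s s' \<longleftrightarrow>
     (\<forall>\<phi> t x y. marked K t \<longrightarrow> exec \<phi> p t (heads x y s) t (heads x y s'))"

lemma rexecD: "rexec K p s s' \<Longrightarrow> marked K t \<Longrightarrow> exec \<phi> p t (heads x y s) t (heads x y s')"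
  by (simp add: rexec_def)

lemma rexec_mono: "rexec K p s s' \<Longrightarrow> K \<le> K' \<Longrightarrow> rexec K' p s s'"
  by (auto simp: rexec_def marked_def)

definition Inc :: "nat \<Rightarrow> prog" where "Inc j = Move (j + 2) Move_Right"
definition Dec :: "nat \<Rightarrow> prog" where "Dec j = Move (j + 2) Move_Left"
definition Loop :: "nat \<Rightarrow> prog \<Rightarrow> prog" where "Loop j p = While (j + 2) {sym_blank} p"
definition Clear :: "nat \<Rightarrow> prog" where "Clear j = Loop j (Dec j)"
definition Transfer :: "nat \<Rightarrow> nat \<Rightarrow> prog" where "Transfer j k = Loop j (Dec j ;; Inc k)"

lemma wf_register_progs [simp]:
  "wf_prog K (Inc j) \<longleftrightarrow> j + 2 < K"
  "wf_prog K (Dec j) \<longleftrightarrow> j + 2 < K"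
  "wf_prog K (Loop j p) \<longleftrightarrow> j + 2 < K \<and> wf_prog K p"
  "wf_prog K (Clear j) \<longleftrightarrow> j + 2 < K"
  "wf_prog K (Transfer j k) \<longleftrightarrow> j + 2 < K \<and> k + 2 < K"
  by (auto simp: Inc_def Dec_def Loop_def Clear_def Transfer_def)

lemma rexec_Seq: "rexec K p s s' \<Longrightarrow> rexec K q s' s'' \<Longrightarrow> rexec K (p ;; q) s s''"
  unfolding rexec_def by (blast intro: exec_Seq)

lemma rexec_Inc: "s' = s(j := Suc (s j)) \<Longrightarrow> rexec K (Inc j) s s'"
proof -
  assume s': "s' = s(j := Suc (s j))"
  have "heads x y s' = (heads x y s)(j + 2 := heads x y s (j + 2) + shift Move_Right)" for x y
    by (auto simp: heads_def s' fun_eq_iff)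
  then show ?thesis
    unfolding rexec_def Inc_def by (metis exec_Move)
qed

lemma rexec_Dec: "s j \<noteq> 0 \<Longrightarrow> s' = s(j := s j - 1) \<Longrightarrow> rexec K (Dec j) s s'"
proof -
  assume s': "s j \<noteq> 0" "s' = s(j := s j - 1)"
  have "heads x y s' = (heads x y s)(j + 2 := heads x y s (j + 2) + shift Move_Left)" for x y
    using s'(1) by (auto simp: heads_def s'(2) fun_eq_iff)
  then show ?thesis
    unfolding rexec_def Dec_def by (metis exec_Move)
qed

lemma register_symbol:
  "marked K t \<Longrightarrow> j + 2 < K \<Longrightarrow> t (j + 2) (heads x y s (j + 2)) = (if s j = 0 then sym_plus else sym_blank)"
  by (auto simp: marked_def heads_def)

lemma rexec_Loop_zero:
  assumes "s j = 0" "j + 2 < K"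
  shows "rexec K (Loop j p) s s"
  unfolding rexec_def
proof (intro allI impI)
  fix \<phi> t x y assume "marked K t"
  from register_symbol[OF this assms(2), of x y s]
  have "t (j + 2) (heads x y s (j + 2)) \<notin> {sym_blank}" using assms(1) by simp
  then show "exec \<phi> (Loop j p) t (heads x y s) t (heads x y s)"
    unfolding Loop_def by (rule exec_While_False)
qed

lemma rexec_Loop_Suc:
  assumes "s j \<noteq> 0" "j + 2 < K" "rexec K p s s'" "rexec K (Loop j p) s' s''"
  shows "rexec K (Loop j p) s s''"
  unfolding rexec_def
proof (intro allI impI)
  fix \<phi> t x y assume K: "marked K t"
  from register_symbol[OF this assms(2), of x y s]
  have "t (j + 2) (heads x y s (j + 2)) \<in> {sym_blank}" using assms(1) by simp
  then show "exec \<phi> (Loop j p) t (heads x y s) t (heads x y s'')"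
    using rexecD[OF assms(3) K] rexecD[OF assms(4) K] unfolding Loop_def by (rule exec_While_True)
qed

text \<open>
  Loops are verified by exhibiting the whole sequence \<open>\<sigma>\<close> of register states; register \<open>j\<close> counts down
  to zero along it.
\<close>

lemma rexec_repeat:
  assumes "\<And>i. i \<le> n \<Longrightarrow> \<sigma> i j = n - i" "j + 2 < K" "\<And>i. i < n \<Longrightarrow> rexec K p (\<sigma> i) (\<sigma> (Suc i))"
  shows "rexec K (Loop j p) (\<sigma> 0) (\<sigma> n)"
proof -
  have "rexec K (Loop j p) (\<sigma> (n - i)) (\<sigma> n)" if "i \<le> n" for i
    using that
  proof (induction i)
    case 0
    then show ?case using assms(1)[of n] assms(2) by (simp add: rexec_Loop_zero)
  next
    case (Suc i)
    then have "Suc (n - Suc i) = n - i" by simp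
    then have "rexec K p (\<sigma> (n - Suc i)) (\<sigma> (n - i))"
      using assms(3)[of "n - Suc i"] Suc.prems by simp
    moreover have "\<sigma> (n - Suc i) j \<noteq> 0" using assms(1)[of "n - Suc i"] Suc.prems by simp
    ultimately show ?case using Suc assms(2) by (auto intro: rexec_Loop_Suc)
  qed
  from this[of n] show ?thesis by simp
qed

lemma rexec_Clear: "j + 2 < K \<Longrightarrow> rexec K (Clear j) s (s(j := 0))"
  unfolding Clear_def
  using rexec_repeat[of "s j" "\<lambda>i. s(j := s j - i)" j K "Dec j"]
  by (simp add: rexec_Dec)

lemma rexec_Transfer:
  assumes "j + 2 < K" "j \<noteq> k"
  shows "rexec K (Transfer j k) s (s(j := 0, k := s k + s j))"
proof -
  have "rexec K (Dec j ;; Inc k) (s(j := s j - i, k := s k + i)) (s(j := s j - Suc i, k := s k + Suc i))"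
    if "i < s j" for i
  proof (rule rexec_Seq)
    show "rexec K (Dec j) (s(j := s j - i, k := s k + i)) (s(j := s j - Suc i, k := s k + i))"
      using that assms(2) by (intro rexec_Dec) (auto simp: fun_eq_iff)
    show "rexec K (Inc k) (s(j := s j - Suc i, k := s k + i)) (s(j := s j - Suc i, k := s k + Suc i))"
      using assms(2) by (intro rexec_Inc) (auto simp: fun_eq_iff)
  qed
  then have "rexec K (Loop j (Dec j ;; Inc k)) (s(j := s j - 0, k := s k + 0)) (s(j := s j - s j, k := s k + s j))"
    using assms rexec_repeat[of "s j" "\<lambda>i. s(j := s j - i, k := s k + i)" j K "Dec j ;; Inc k"] by simp
  then show ?thesis by (simp add: Transfer_def)
qed

text \<open>
  The source is emptied into the target and into one auxiliary register, from which it is then restored.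
\<close>

lemma rexec_copy:
  assumes "j + 2 < K" "d + 3 < K" "j < d" "s d = 0" "s (Suc d) = 0"
  shows "rexec K (Loop j (Dec j ;; Inc d ;; Inc (Suc d)) ;; Transfer (Suc d) j) s (s(d := s j))"
proof (rule rexec_Seq)
  let ?\<sigma> = "\<lambda>i. s(j := s j - i, d := i, Suc d := i)"
  have "rexec K (Dec j ;; Inc d ;; Inc (Suc d)) (?\<sigma> i) (?\<sigma> (Suc i))" if "i < s j" for i
  proof (intro rexec_Seq)
    show "rexec K (Dec j) (?\<sigma> i) (s(j := s j - Suc i, d := i, Suc d := i))"
      using that assms by (intro rexec_Dec) (auto simp: fun_eq_iff)
    show "rexec K (Inc d) (s(j := s j - Suc i, d := i, Suc d := i)) (s(j := s j - Suc i, d := Suc i, Suc d := i))"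
      using assms by (intro rexec_Inc) (auto simp: fun_eq_iff)
    show "rexec K (Inc (Suc d)) (s(j := s j - Suc i, d := Suc i, Suc d := i)) (?\<sigma> (Suc i))"
      using assms by (intro rexec_Inc) (auto simp: fun_eq_iff)
  qed
  moreover have "?\<sigma> i j = s j - i" for i using assms by auto
  ultimately have "rexec K (Loop j (Dec j ;; Inc d ;; Inc (Suc d))) (?\<sigma> 0) (?\<sigma> (s j))"
    using assms(1) by (intro rexec_repeat[where \<sigma> = ?\<sigma>])
  moreover have "?\<sigma> 0 = s" using assms by (auto simp: fun_eq_iff)
  ultimately show "rexec K (Loop j (Dec j ;; Inc d ;; Inc (Suc d))) s (?\<sigma> (s j))" by simp
  have "(?\<sigma> (s j))(Suc d := 0, j := ?\<sigma> (s j) j + ?\<sigma> (s j) (Suc d)) = s(d := s j)"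
    using assms by (auto simp: fun_eq_iff)
  then show "rexec K (Transfer (Suc d) j) (?\<sigma> (s j)) (s(d := s j))"
    using rexec_Transfer[of "Suc d" K j "?\<sigma> (s j)"] assms by simp
qed

text \<open>
  The stack discipline: all registers from \<open>d\<close> on are zero on entry and are zero again on exit, except for
  the result in \<open>d\<close>. Programs can then be sequenced without recording which registers they use.
\<close>

definition computes :: "nat \<Rightarrow> prog \<Rightarrow> nat \<Rightarrow> ((nat \<Rightarrow> nat) \<Rightarrow> nat) \<Rightarrow> bool" where
  "computes K P d f \<longleftrightarrow>
     d + 2 < K \<and> wf_prog K P \<and> (\<forall>s. (\<forall>i\<ge>d. s i = 0) \<longrightarrow> rexec K P s (s(d := f s)))"

lemma computes_mono: "computes K P d f \<Longrightarrow> K \<le> K' \<Longrightarrow> computes K' P d f"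
  by (auto simp: computes_def intro: wf_prog_mono rexec_mono)

text \<open>
  The result register may be any \<open>d \<ge> m\<close>, so that a computation can be nested in the workspace of another one;
  and \<open>f\<close> depends on the first \<open>m\<close> registers only, so that its value is not affected by intermediate
  results stored above them.
\<close>

definition reg_computable :: "nat \<Rightarrow> ((nat \<Rightarrow> nat) \<Rightarrow> nat) \<Rightarrow> bool" where
  "reg_computable m f \<longleftrightarrow>
     (\<forall>s s'. (\<forall>i<m. s i = s' i) \<longrightarrow> f s = f s') \<and> (\<forall>d\<ge>m. \<exists>P K. computes K P d f)"

lemma reg_computable_cong:
  "reg_computable m f \<Longrightarrow> (\<And>i. i < m \<Longrightarrow> s i = s' i) \<Longrightarrow> f s = f s'"
  by (auto simp: reg_computable_def)

lemma reg_computableD: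
  assumes "reg_computable m f" "m \<le> d"
  shows "\<exists>P K. \<forall>K'\<ge>K. computes K' P d f"
  using assms unfolding reg_computable_def by (meson computes_mono)

lemma reg_computable_mono:
  "reg_computable m f \<Longrightarrow> m \<le> m' \<Longrightarrow> reg_computable m' f"
  unfolding reg_computable_def by (meson le_trans less_le_trans)

lemma computes_rexec:
  "computes K P d f \<Longrightarrow> (\<And>i. d \<le> i \<Longrightarrow> s i = 0) \<Longrightarrow> v = f s \<Longrightarrow> rexec K P s (s(d := v))"
  by (auto simp: computes_def)

named_theorems computable_intros

lemma reg_computable_var [computable_intros]:
  assumes "j < m"
  shows "reg_computable m (\<lambda>s. s j)"
proof -
  have "computes (d + 4) (Loop j (Dec j ;; Inc d ;; Inc (Suc d)) ;; Transfer (Suc d) j) d (\<lambda>s. s j)"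
    if "m \<le> d" for d
    unfolding computes_def using assms that by (auto intro!: rexec_copy)
  then show ?thesis
    using assms unfolding reg_computable_def by blast
qed

lemma reg_computable_zero: "reg_computable m (\<lambda>s. 0)"
proof -
  have "computes (d + 3) (Clear d) d (\<lambda>s. 0)" for d
    unfolding computes_def by (auto intro!: rexec_Clear)
  then show ?thesis unfolding reg_computable_def by blast
qed

lemma reg_computable_Suc [computable_intros]:
  assumes "reg_computable m f"
  shows "reg_computable m (\<lambda>s. Suc (f s))"
  unfolding reg_computable_def
proof (intro conjI allI impI)
  fix d assume "m \<le> d"
  then obtain P K where P: "\<And>K'. K \<le> K' \<Longrightarrow> computes K' P d f"
    using reg_computableD[OF assms] by meson
  have "computes K (P ;; Inc d) d (\<lambda>s. Suc (f s))"
    using P[of K] unfolding computes_def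
    by (auto intro!: rexec_Seq rexec_Inc)
  then show "\<exists>P K. computes K P d (\<lambda>s. Suc (f s))" by blast
qed (metis assms reg_computable_cong)

lemma reg_computable_const [computable_intros]: "reg_computable m (\<lambda>s. n)"
  by (induction n) (auto intro: reg_computable_zero reg_computable_Suc)

text \<open>
  Counter and accumulator of the loop sit in registers that are known only once the result register
  is chosen, and they lie above the inputs. The step function is therefore assumed to be computable for
  arbitrary computable counter and accumulator arguments over any larger set of inputs.
\<close>

lemma reg_computable_rec:
  assumes n: "reg_computable m n" and a: "reg_computable m a"
    and g: "\<And>e i acc. m \<le> e \<Longrightarrow> reg_computable e i \<Longrightarrow> reg_computable e acc \<Longrightarrow>
      reg_computable e (\<lambda>s. g s (i s) (acc s))"
  shows "reg_computable m (\<lambda>s. rec_nat (a s) (g s) (n s))"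
proof -
  have cong: "g s = g s'" if "\<And>i. i < m \<Longrightarrow> s i = s' i" for s s'
  proof (intro ext)
    fix i acc
    show "g s i acc = g s' i acc"
      using reg_computable_cong[OF g[OF order_refl, of "\<lambda>_. i" "\<lambda>_. acc"], of s s'] that
      by (simp add: reg_computable_const)
  qed
  have "rec_nat (a s) (g s) (n s) = rec_nat (a s') (g s') (n s')" if "\<forall>i<m. s i = s' i" for s s'
    using that cong[of s s'] reg_computable_cong[OF a, of s s'] reg_computable_cong[OF n, of s s'] by auto
  moreover have "\<exists>P K. computes K P d (\<lambda>s. rec_nat (a s) (g s) (n s))" if d: "m \<le> d" for d
  proof -
    obtain Pa Ka where Pa: "\<And>K'. Ka \<le> K' \<Longrightarrow> computes K' Pa d a"
      using reg_computableD[OF a d] by meson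
    have "m \<le> d + 1" using d by simp
    then obtain Pn Kn where Pn: "\<And>K'. Kn \<le> K' \<Longrightarrow> computes K' Pn (d + 1) n"
      using reg_computableD[OF n] by meson
    have "reg_computable (d + 3) (\<lambda>s. g s (s (d + 2)) (s d))"
      using d by (intro g reg_computable_var) auto
    then obtain Pg Kg where Pg: "\<And>K'. Kg \<le> K' \<Longrightarrow> computes K' Pg (d + 3) (\<lambda>s. g s (s (d + 2)) (s d))"
      using reg_computableD[OF _ order_refl] by meson
    \<comment> \<open>Register \<open>d\<close> holds the accumulator, \<open>d + 1\<close> the remaining rounds, \<open>d + 2\<close> the index of the
      current round, and \<open>d + 3\<close> the new accumulator.\<close>
    define K where "K = Ka + Kn + Kg + d + 6"
    have Pa': "computes K Pa d a" and Pn': "computes K Pn (d + 1) n"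
      and Pg': "computes K Pg (d + 3) (\<lambda>s. g s (s (d + 2)) (s d))"
      by (intro Pa Pn Pg; simp add: K_def)+
    have K: "d + 5 < K" by (simp add: K_def)
    define body where "body = Dec (d + 1) ;; Pg ;; Clear d ;; Transfer (d + 3) d ;; Inc (d + 2)"
    define prog where "prog = Pa ;; Pn ;; Loop (d + 1) body ;; Clear (d + 2)"
    have "rexec K prog s (s(d := rec_nat (a s) (g s) (n s)))" if s: "\<forall>i\<ge>d. s i = 0" for s
    proof -
      let ?v = "\<lambda>i. rec_nat (a s) (g s) i"
      let ?\<sigma> = "\<lambda>i. s(d := ?v i, d + 1 := n s - i, d + 2 := i)"
      have 1: "rexec K Pa s (s(d := a s))"
        using s by (intro computes_rexec[OF Pa']) auto
      have "n (s(d := a s)) = n s" by (rule reg_computable_cong[OF n]) (use d in auto)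
      then have 2: "rexec K Pn (s(d := a s)) (s(d := a s, d + 1 := n s))"
        using s by (intro computes_rexec[OF Pn']) auto
      have 3: "rexec K body (?\<sigma> i) (?\<sigma> (Suc i))" if i: "i < n s" for i
        unfolding body_def
      proof (intro rexec_Seq)
        let ?\<tau> = "s(d := ?v i, d + 1 := n s - Suc i, d + 2 := i)"
        show "rexec K (Dec (d + 1)) (?\<sigma> i) ?\<tau>"
          using i by (intro rexec_Dec) (auto simp: fun_eq_iff)
        have "g ?\<tau> = g s" by (rule cong) (use d in auto)
        then show "rexec K Pg ?\<tau> (?\<tau>(d + 3 := ?v (Suc i)))"
          using s by (intro computes_rexec[OF Pg']) auto
        show "rexec K (Clear d) (?\<tau>(d + 3 := ?v (Suc i))) (?\<tau>(d + 3 := ?v (Suc i), d := 0))"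
          using K by (intro rexec_Clear) simp
        have "?\<tau>(d + 3 := ?v (Suc i), d := 0, d + 3 := 0, d := (?\<tau>(d + 3 := ?v (Suc i), d := 0)) d + (?\<tau>(d + 3 := ?v (Suc i), d := 0)) (d + 3)) = ?\<tau>(d := ?v (Suc i))"
          using s by (auto simp: fun_eq_iff)
        then show "rexec K (Transfer (d + 3) d) (?\<tau>(d + 3 := ?v (Suc i), d := 0)) (?\<tau>(d := ?v (Suc i)))"
          using rexec_Transfer[of "d + 3" K d "?\<tau>(d + 3 := ?v (Suc i), d := 0)"] K by simp
        show "rexec K (Inc (d + 2)) (?\<tau>(d := ?v (Suc i))) (?\<sigma> (Suc i))"
          by (intro rexec_Inc) (auto simp: fun_eq_iff)
      qed
      have "?\<sigma> i (d + 1) = n s - i" for i by simp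
      moreover have "d + 1 + 2 < K" using K by simp
      ultimately have "rexec K (Loop (d + 1) body) (?\<sigma> 0) (?\<sigma> (n s))"
        using 3 by (intro rexec_repeat[where \<sigma> = ?\<sigma>])
      moreover have "?\<sigma> 0 = s(d := a s, d + 1 := n s)" using s by (auto simp: fun_eq_iff)
      ultimately have 4: "rexec K (Loop (d + 1) body) (s(d := a s, d + 1 := n s)) (?\<sigma> (n s))" by simp
      have "(?\<sigma> (n s))(d + 2 := 0) = s(d := ?v (n s))" using s by (auto simp: fun_eq_iff)
      then have "rexec K (Clear (d + 2)) (?\<sigma> (n s)) (s(d := ?v (n s)))"
        using rexec_Clear[of "d + 2" K "?\<sigma> (n s)"] K by simp
      with 1 2 4 show ?thesis unfolding prog_def by (blast intro: rexec_Seq)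
    qed
    then have "computes K prog d (\<lambda>s. rec_nat (a s) (g s) (n s))"
      using K Pa' Pn' Pg' unfolding computes_def prog_def body_def by auto
    then show ?thesis by blast
  qed
  ultimately show ?thesis unfolding reg_computable_def by blast
qed

lemma reg_computable_add [computable_intros]:
  assumes "reg_computable m a" "reg_computable m b"
  shows "reg_computable m (\<lambda>s. a s + b s)"
proof -
  have "rec_nat x (\<lambda>i acc. Suc acc) y = x + y" for x y :: nat by (induction y) auto
  then show ?thesis
    using reg_computable_rec[of m b a "\<lambda>s i acc. Suc acc"] assms
    by (simp add: reg_computable_Suc)
qed

lemma reg_computable_pred:
  assumes "reg_computable m a"
  shows "reg_computable m (\<lambda>s. a s - 1)"
proof -
  have "rec_nat 0 (\<lambda>i acc. i) y = y - 1" for y :: nat by (induction y) auto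
  then show ?thesis
    using reg_computable_rec[of m a "\<lambda>s. 0" "\<lambda>s i acc. i"] assms
    by (simp add: reg_computable_const)
qed

lemma reg_computable_diff [computable_intros]:
  assumes "reg_computable m a" "reg_computable m b"
  shows "reg_computable m (\<lambda>s. a s - b s)"
proof -
  have "rec_nat x (\<lambda>i acc. acc - 1) y = x - y" for x y :: nat by (induction y) auto
  then show ?thesis
    using reg_computable_rec[of m b a "\<lambda>s i acc. acc - 1"] assms reg_computable_pred
    by simp
qed

lemma reg_computable_mult [computable_intros]:
  assumes "reg_computable m a" "reg_computable m b"
  shows "reg_computable m (\<lambda>s. a s * b s)"
proof -
  have "rec_nat 0 (\<lambda>i acc. acc + x) y = x * y" for x y :: nat by (induction y) auto
  moreover have "reg_computable m (\<lambda>s. rec_nat 0 (\<lambda>i acc. acc + a s) (b s))"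
    by (rule reg_computable_rec[OF assms(2) reg_computable_const])
      (blast intro: reg_computable_add reg_computable_mono[OF assms(1)])
  ultimately show ?thesis by simp
qed

lemma reg_computable_power [computable_intros]:
  assumes "reg_computable m a" "reg_computable m b"
  shows "reg_computable m (\<lambda>s. a s ^ b s)"
proof -
  have "rec_nat 1 (\<lambda>i acc. acc * x) y = x ^ y" for x y :: nat by (induction y) auto
  moreover have "reg_computable m (\<lambda>s. rec_nat 1 (\<lambda>i acc. acc * a s) (b s))"
    by (rule reg_computable_rec[OF assms(2) reg_computable_const])
      (blast intro: reg_computable_mult reg_computable_mono[OF assms(1)])
  ultimately show ?thesis by simp
qed

lemma reg_computable_if_zero [computable_intros]:
  assumes "reg_computable m c" "reg_computable m a" "reg_computable m b"
  shows "reg_computable m (\<lambda>s. if c s = 0 then a s else b s)"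
proof -
  have "rec_nat x (\<lambda>i acc. z) y = (if y = 0 then x else z)" for x y z :: nat by (cases y) auto
  moreover have "reg_computable m (\<lambda>s. rec_nat (a s) (\<lambda>i acc. b s) (c s))"
    by (rule reg_computable_rec[OF assms(1,2)])
      (blast intro: reg_computable_mono[OF assms(3)])
  ultimately show ?thesis by simp
qed

lemma reg_computable_if_le [computable_intros]:
  assumes "reg_computable m x" "reg_computable m y" "reg_computable m a" "reg_computable m b"
  shows "reg_computable m (\<lambda>s. if x s \<le> y s then a s else b s)"
  using reg_computable_if_zero[OF reg_computable_diff[OF assms(1,2)] assms(3,4)] by simp

lemma reg_computable_if_eq [computable_intros]:
  assumes "reg_computable m x" "reg_computable m y" "reg_computable m a" "reg_computable m b"
  shows "reg_computable m (\<lambda>s. if x s = y s then a s else b s)"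
proof -
  have "reg_computable m (\<lambda>s. if x s \<le> y s then if y s \<le> x s then a s else b s else b s)"
    by (intro computable_intros assms)
  moreover have "(\<lambda>s. if x s \<le> y s then if y s \<le> x s then a s else b s else b s) = (\<lambda>s. if x s = y s then a s else b s)"
    by (auto simp: fun_eq_iff)
  ultimately show ?thesis by simp
qed

lemma reg_computable_min [computable_intros]:
  assumes "reg_computable m x" "reg_computable m y"
  shows "reg_computable m (\<lambda>s. min (x s) (y s))"
  unfolding min_def by (intro computable_intros assms)

lemma reg_computable_sum:
  assumes n: "reg_computable m n"
    and g: "\<And>e i. m \<le> e \<Longrightarrow> reg_computable e i \<Longrightarrow> reg_computable e (\<lambda>s. g s (i s))"
  shows "reg_computable m (\<lambda>s. \<Sum>i<n s. g s i)"
proof -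
  have "rec_nat 0 (\<lambda>i acc. acc + h i) y = (\<Sum>i<y. h i)" for y and h :: "nat \<Rightarrow> nat" by (induction y) auto
  moreover have "reg_computable m (\<lambda>s. rec_nat 0 (\<lambda>i acc. acc + g s i) (n s))"
    by (rule reg_computable_rec[OF n reg_computable_const])
      (rule reg_computable_add, assumption, rule g)
  ultimately show ?thesis by simp
qed

text \<open>
  Bounded sums are a form of recursion, and counting the multiples of the divisor turns division into one.
\<close>

lemma div_eq_sum: "a div b = (if b = 0 then 0 else \<Sum>i<a. if Suc i * b \<le> a then 1 else 0)" for a b :: nat
proof (cases "b = 0")
  case False
  have "Suc i * b \<le> a \<longleftrightarrow> i < a div b" for i
    using False by (metis Suc_le_eq less_eq_div_iff_mult_less_eq neq0_conv)
  then have "(\<Sum>i<a. if Suc i * b \<le> a then 1 else 0) = card {i\<in>{..<a}. i < a div b}"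
    by (simp add: sum.If_cases Int_def)
  also have "{i\<in>{..<a}. i < a div b} = {..<a div b}"
    using less_le_trans[OF _ div_le_dividend[of a b]] by auto
  finally show ?thesis using False by simp
qed simp

lemma reg_computable_div [computable_intros]:
  assumes "reg_computable m a" "reg_computable m b"
  shows "reg_computable m (\<lambda>s. a s div b s)"
proof -
  have "reg_computable m (\<lambda>s. \<Sum>i<a s. if Suc i * b s \<le> a s then 1 else 0)"
  proof (rule reg_computable_sum[OF assms(1)])
    fix e i assume "m \<le> e" "reg_computable e i"
    then show "reg_computable e (\<lambda>s. if Suc (i s) * b s \<le> a s then 1 else 0)"
      by (intro computable_intros) (auto intro: reg_computable_mono assms)
  qed
  then have "reg_computable m (\<lambda>s. if b s = 0 then 0 else \<Sum>i<a s. if Suc i * b s \<le> a s then 1 else 0)"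
    by (intro reg_computable_if_zero assms reg_computable_const)
  then show ?thesis by (simp only: div_eq_sum)
qed

lemma reg_computable_mod [computable_intros]:
  assumes "reg_computable m a" "reg_computable m b"
  shows "reg_computable m (\<lambda>s. a s mod b s)"
proof -
  have "reg_computable m (\<lambda>s. a s - a s div b s * b s)"
    by (intro computable_intros assms)
  then show ?thesis by (simp add: minus_div_mult_eq_mod)
qed

section \<open>Reading, querying and printing\<close>

lemma heads_simps [simp]:
  "heads x y s 0 = x" "heads x y s (Suc 0) = y" "(heads x y s)(0 := z) = heads z y s"
  "(heads x y s)(Suc 0 := z) = heads x z s"
  by (auto simp: heads_def fun_eq_iff)

text \<open>
  Words in unary become register values by \<open>Sweep\<close>, which counts ones to the right, and register values
  become words by \<open>Print\<close>. \<open>Rewind\<close> starts on the cell after the word and uses that all negative cells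
  are blank. \<open>Sign\<close> replaces a minus sign by a one: this ends its loop after a single round, and the
  cell stays nonblank for the later \<open>Rewind\<close>.
\<close>

definition Sweep :: "nat \<Rightarrow> nat \<Rightarrow> prog" where
  "Sweep i j = While i {sym_one} (Move i Move_Right ;; Inc j)"

definition Rewind :: "nat \<Rightarrow> prog" where
  "Rewind i = Move i Move_Left ;; While i {sym_one, sym_plus, sym_minus} (Move i Move_Left) ;; Move i Move_Right"

definition Print :: "nat \<Rightarrow> nat \<Rightarrow> prog" where
  "Print i j = Loop j (Dec j ;; Write i sym_one ;; Move i Move_Right)"

definition Sign :: "nat \<Rightarrow> prog" where
  "Sign j = While 1 {sym_minus} (Write 1 sym_one ;; Inc j) ;; Move 1 Move_Right"

lemma wf_tape_progs [simp]:
  "wf_prog K (Sweep i j) \<longleftrightarrow> i < K \<and> j + 2 < K"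
  "wf_prog K (Rewind i) \<longleftrightarrow> i < K"
  "wf_prog K (Print i j) \<longleftrightarrow> i < K \<and> j + 2 < K"
  "wf_prog K (Sign j) \<longleftrightarrow> j + 2 < K"
  by (auto simp: Sweep_def Rewind_def Print_def Sign_def)

lemma exec_Sweep:
  assumes "\<And>k. k < n \<Longrightarrow> t i (h i + int k) = sym_one" "t i (h i + int n) \<noteq> sym_one" "i \<noteq> j + 2"
  shows "exec \<phi> (Sweep i j) t h t (h(i := h i + int n, j + 2 := h (j + 2) + int n))"
  using assms
proof (induction n arbitrary: h)
  case 0
  then show ?case unfolding Sweep_def by (auto intro!: exec_While_False)
next
  case (Suc n)
  let ?h = "h(i := h i + shift Move_Right)"
  let ?h' = "?h(j + 2 := ?h (j + 2) + shift Move_Right)"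
  have 1: "exec \<phi> (Move i Move_Right ;; Inc j) t h t ?h'"
    unfolding Inc_def by (rule exec_Seq[OF exec_Move exec_Move])
  have "exec \<phi> (Sweep i j) t ?h' t (?h'(i := ?h' i + int n, j + 2 := ?h' (j + 2) + int n))"
  proof (rule Suc.IH)
    show "t i (?h' i + int k) = sym_one" if "k < n" for k
      using Suc.prems(1)[of "Suc k"] Suc.prems(3) that by (simp add: ac_simps)
  qed (use Suc.prems in \<open>simp_all add: ac_simps\<close>)
  moreover have "?h'(i := ?h' i + int n, j + 2 := ?h' (j + 2) + int n) =
      h(i := h i + int (Suc n), j + 2 := h (j + 2) + int (Suc n))"
    using Suc.prems(3) by (auto simp: fun_eq_iff)
  moreover have "t i (h i) \<in> {sym_one}" using Suc.prems(1)[of 0] by simp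
  ultimately show ?case
    using exec_While_True[OF _ 1] unfolding Sweep_def by metis
qed

lemma exec_Rewind:
  assumes "\<And>k. k < n \<Longrightarrow> t i (int k) \<in> {sym_one, sym_plus, sym_minus}" "t i (-1) = sym_blank" "h i = int n"
  shows "exec \<phi> (Rewind i) t h t (h(i := 0))"
proof -
  let ?W = "While i {sym_one, sym_plus, sym_minus} (Move i Move_Left)"
  have W: "exec \<phi> ?W t (h(i := int n - 1)) t (h(i := -1))"
    using assms(1)
  proof (induction n)
    case 0
    show ?case using assms(2) by (auto intro!: exec_While_False)
  next
    case (Suc n)
    have a: "exec \<phi> ?W t (h(i := int n - 1)) t (h(i := -1))" by (rule Suc.IH, rule Suc.prems) simp
    have b: "exec \<phi> (Move i Move_Left) t (h(i := int (Suc n) - 1)) t (h(i := int n - 1))"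
      using exec_Move[of \<phi> i Move_Left t "h(i := int (Suc n) - 1)"] by simp
    have c: "t i ((h(i := int (Suc n) - 1)) i) \<in> {sym_one, sym_plus, sym_minus}"
      using Suc.prems[of n] by simp
    show ?case by (rule exec_While_True[OF c b a])
  qed
  have "exec \<phi> (Move i Move_Left) t h t (h(i := int n - 1))"
    using exec_Move[of \<phi> i Move_Left t h] assms(3) by simp
  moreover have "exec \<phi> (Move i Move_Right) t (h(i := -1)) t (h(i := 0))"
    using exec_Move[of \<phi> i Move_Right t "h(i := -1)"] by simp
  ultimately show ?thesis using W unfolding Rewind_def by (blast intro: exec_Seq)
qed

definition ones :: "int \<Rightarrow> nat \<Rightarrow> (int \<Rightarrow> nat) \<Rightarrow> int \<Rightarrow> nat" where
  "ones a n w k = (if a \<le> k \<and> k < a + int n then sym_one else w k)"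

lemma marked_upd: "marked K t \<Longrightarrow> i < 2 \<Longrightarrow> marked K (t(i := w))"
  by (auto simp: marked_def)

lemma exec_Print:
  assumes "marked K t" "j + 2 < K" "i < 2" "h (j + 2) = int n"
  shows "exec \<phi> (Print i j) t h (t(i := ones (h i) n (t i))) (h(i := h i + int n, j + 2 := 0))"
  using assms
proof (induction n arbitrary: t h)
  case 0
  have "t (j + 2) (h (j + 2)) \<notin> {sym_blank}" using 0 by (auto simp: marked_def)
  then have "exec \<phi> (Print i j) t h t h" unfolding Print_def Loop_def by (rule exec_While_False)
  moreover have "t(i := ones (h i) 0 (t i)) = t" by (auto simp: fun_eq_iff ones_def)
  moreover have "h(i := h i + int 0, j + 2 := 0) = h" using 0 by (auto simp: fun_eq_iff)
  ultimately show ?case by simp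
next
  case (Suc n)
  let ?h1 = "h(j + 2 := h (j + 2) + shift Move_Left)"
  let ?t = "t(i := (t i)(?h1 i := sym_one))"
  let ?h = "?h1(i := ?h1 i + shift Move_Right)"
  have 1: "exec \<phi> (Dec j ;; Write i sym_one ;; Move i Move_Right) t h ?t ?h"
    unfolding Dec_def by (rule exec_Seq[OF exec_Move exec_Seq[OF exec_Write exec_Move]])
  have 2: "t (j + 2) (h (j + 2)) \<in> {sym_blank}" using Suc.prems by (auto simp: marked_def)
  have "exec \<phi> (Print i j) ?t ?h (?t(i := ones (?h i) n (?t i))) (?h(i := ?h i + int n, j + 2 := 0))"
    using Suc.prems by (intro Suc.IH marked_upd) auto
  moreover have "?t(i := ones (?h i) n (?t i)) = t(i := ones (h i) (Suc n) (t i))"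
    using Suc.prems(3) by (auto simp: fun_eq_iff ones_def)
  moreover have "?h(i := ?h i + int n, j + 2 := 0) = h(i := h i + int (Suc n), j + 2 := 0)"
    using Suc.prems(3) by (auto simp: fun_eq_iff)
  ultimately show ?case
    using exec_While_True[OF 2 1] unfolding Print_def Loop_def by metis
qed

lemma exec_Sign:
  assumes "t 1 (h 1) = (if neg then sym_minus else sym_plus)" "w = (if neg then (t 1)(h 1 := sym_one) else t 1)"
  shows "exec \<phi> (Sign j) t h (t(1 := w)) (h(1 := h 1 + 1, j + 2 := h (j + 2) + of_bool neg))"
proof -
  let ?S = "While 1 {sym_minus} (Write 1 sym_one ;; Inc j)"
  have "exec \<phi> ?S t h (t(1 := w)) (h(j + 2 := h (j + 2) + of_bool neg))"
  proof (cases neg)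
    case True
    let ?t = "t(1 := (t 1)(h 1 := sym_one))" and ?h = "h(j + 2 := h (j + 2) + shift Move_Right)"
    have "t 1 (h 1) \<in> {sym_minus}" using assms True by simp
    moreover have "exec \<phi> (Write 1 sym_one ;; Inc j) t h ?t ?h"
      unfolding Inc_def by (rule exec_Seq[OF exec_Write exec_Move])
    moreover have "exec \<phi> ?S ?t ?h ?t ?h" by (rule exec_While_False) simp
    ultimately have "exec \<phi> ?S t h ?t ?h" by (rule exec_While_True)
    then show ?thesis using assms True by simp
  next
    case False
    have "exec \<phi> ?S t h t h" by (rule exec_While_False) (use assms False in simp)
    then show ?thesis using assms False by simp
  qed
  moreover have "exec \<phi> (Move 1 Move_Right) (t(1 := w)) (h(j + 2 := h (j + 2) + of_bool neg)) (t(1 := w))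
      (h(1 := h 1 + 1, j + 2 := h (j + 2) + of_bool neg))"
    using exec_Move[of \<phi> 1 Move_Right "t(1 := w)" "h(j + 2 := h (j + 2) + of_bool neg)"]
    by (simp add: fun_upd_twist)
  ultimately show ?thesis unfolding Sign_def by (rule exec_Seq)
qed

definition ReadInput :: prog where "ReadInput = Sweep 0 0 ;; Rewind 0"

lemma exec_ReadInput:
  assumes "t 0 = write_word (replicate n sym_one)"
  shows "exec \<phi> ReadInput t (heads 0 0 (\<lambda>_. 0)) t (heads 0 0 ((\<lambda>_. 0)(0 := n)))"
proof -
  let ?h = "heads 0 0 (\<lambda>_. 0)"
  have "exec \<phi> (Sweep 0 0) t ?h t (?h(0 := ?h 0 + int n, 0 + 2 := ?h (0 + 2) + int n))"
    by (rule exec_Sweep) (auto simp: assms write_word_def heads_def)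
  moreover have "exec \<phi> (Rewind 0) t (?h(0 := ?h 0 + int n, 0 + 2 := ?h (0 + 2) + int n)) t
      (?h(0 := ?h 0 + int n, 0 + 2 := ?h (0 + 2) + int n, 0 := 0))"
    by (rule exec_Rewind[where n = n]) (auto simp: assms write_word_def heads_def)
  moreover have "?h(0 := ?h 0 + int n, 0 + 2 := ?h (0 + 2) + int n, 0 := 0) = heads 0 0 ((\<lambda>_. 0)(0 := n))"
    by (auto simp: heads_def fun_eq_iff)
  ultimately show ?thesis unfolding ReadInput_def by (metis exec_Seq)
qed

primrec MarkTapes :: "nat \<Rightarrow> prog" where
  "MarkTapes 0 = Move 0 Stay"
| "MarkTapes (Suc k) = MarkTapes k ;; Write (k + 2) sym_plus"

lemma wf_MarkTapes: "k + 2 \<le> K \<Longrightarrow> wf_prog K (MarkTapes k)"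
  by (induction k) auto

lemma exec_MarkTapes:
  assumes "\<And>i. i \<noteq> 0 \<Longrightarrow> t i = (\<lambda>_. sym_blank)" "\<And>i. h i = 0"
  shows "\<exists>t'. exec \<phi> (MarkTapes k) t h t' h \<and> marked (k + 2) t' \<and> t' 0 = t 0 \<and>
    (\<forall>i\<ge>k + 2. t' i = (\<lambda>_. sym_blank))"
proof (induction k)
  case 0
  have "exec \<phi> (MarkTapes 0) t h t h" using exec_Move[of \<phi> 0 Stay t h] by simp
  then show ?case using assms(1) by (auto simp: marked_def)
next
  case (Suc k)
  then obtain t' where t': "exec \<phi> (MarkTapes k) t h t' h" "marked (k + 2) t'" "t' 0 = t 0"
    "\<forall>i\<ge>k + 2. t' i = (\<lambda>_. sym_blank)" by blast
  let ?t = "t'(k + 2 := (t' (k + 2))(h (k + 2) := sym_plus))"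
  have "exec \<phi> (MarkTapes (Suc k)) t h ?t h"
    using exec_Seq[OF t'(1) exec_Write] by simp
  moreover have "marked (Suc k + 2) ?t"
    using t'(2,4) assms(2) by (auto simp: marked_def less_Suc_eq fun_eq_iff)
  moreover have "?t 0 = t 0" "\<forall>i\<ge>Suc k + 2. ?t i = (\<lambda>_. sym_blank)" using t'(3,4) by auto
  ultimately show ?case by blast
qed

definition ReadAnswer :: prog where
  "ReadAnswer = Sign 2 ;; Sweep 1 3 ;; Sign 4 ;; Sweep 1 5 ;; Rewind 1"

text \<open>
  The registers after an answer \<open>d\<close> to the query \<open>k\<close> on input \<open>n\<close>: mantissa and exponent are each given by a
  sign flag and an absolute value.
\<close>

definition inputs :: "nat \<Rightarrow> nat \<Rightarrow> float \<Rightarrow> nat \<Rightarrow> nat" where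
  "inputs n k d i = [n, k, of_bool (mantissa d < 0), nat \<bar>mantissa d\<bar>,
     of_bool (exponent d < 0), nat \<bar>exponent d\<bar>, 0] ! min i 6"

lemma inputs_simps [simp]:
  "inputs n k d 0 = n" "inputs n k d (Suc 0) = k" "inputs n k d 2 = of_bool (mantissa d < 0)"
  "inputs n k d 3 = nat \<bar>mantissa d\<bar>" "inputs n k d 4 = of_bool (exponent d < 0)"
  "inputs n k d 5 = nat \<bar>exponent d\<bar>" "6 \<le> i \<Longrightarrow> inputs n k d i = 0"
  by (auto simp: inputs_def min_def)

lemma exec_ReadAnswer:
  assumes "t 1 = write_word (encode_dyadic (mantissa d) (exponent d))" "\<And>i. 2 \<le> i \<Longrightarrow> s i = 0"
  shows "\<exists>w. exec \<phi> ReadAnswer t (heads 0 0 s) (t(1 := w)) (heads 0 0 (inputs (s 0) (s 1) d))"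
proof -
  define p where "p = nat \<bar>mantissa d\<bar>"
  define q where "q = nat \<bar>exponent d\<bar>"
  define a where "a = (mantissa d < 0)"
  define b where "b = (exponent d < 0)"
  let ?e = "\<lambda>neg. if neg then sym_minus else sym_plus"
  have t1: "t 1 = write_word (?e a # replicate p sym_one @ ?e b # replicate q sym_one)"
    unfolding assms(1) encode_dyadic_def encode_int_def p_def q_def a_def b_def by simp
  have t1': "t 1 k = (if k < 0 then sym_blank else if k = 0 then ?e a else if k \<le> int p then sym_one
      else if k = int p + 1 then ?e b else if k \<le> int p + 1 + int q then sym_one else sym_blank)" for k
    unfolding t1 write_word_def by (auto simp: nth_Cons nth_append split: nat.splits)
  note t1'' = t1'[unfolded One_nat_def]
  define w1 where "w1 = (if a then (t 1)(0 := sym_one) else t 1)"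
  define w2 where "w2 = (if b then w1(int p + 1 := sym_one) else w1)"
  define s1 where "s1 = s(2 := of_bool a)"
  define s2 where "s2 = s1(3 := p)"
  define s3 where "s3 = s2(4 := of_bool b)"
  define s4 where "s4 = s3(5 := q)"
  note sdefs = s1_def s2_def s3_def s4_def
  have h1: "(heads 0 0 s)(1 := heads 0 0 s 1 + 1, 2 + 2 := heads 0 0 s (2 + 2) + of_bool a) = heads 0 1 s1"
    using assms(2)[of 2] by (auto simp: fun_eq_iff heads_def sdefs)
  have 1: "exec \<phi> (Sign 2) t (heads 0 0 s) (t(1 := w1)) (heads 0 1 s1)"
    unfolding h1[symmetric] by (rule exec_Sign) (auto simp: heads_def t1'' w1_def)
  have h2: "(heads 0 1 s1)(1 := heads 0 1 s1 1 + int p, 3 + 2 := heads 0 1 s1 (3 + 2) + int p) = heads 0 (int p + 1) s2"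
    using assms(2)[of 3] by (auto simp: fun_eq_iff heads_def sdefs)
  have 2: "exec \<phi> (Sweep 1 3) (t(1 := w1)) (heads 0 1 s1) (t(1 := w1)) (heads 0 (int p + 1) s2)"
    unfolding h2[symmetric] by (rule exec_Sweep) (auto simp: heads_def t1'' w1_def)
  have h3: "(heads 0 (int p + 1) s2)(1 := heads 0 (int p + 1) s2 1 + 1, 4 + 2 := heads 0 (int p + 1) s2 (4 + 2) + of_bool b)
      = heads 0 (int p + 2) s3"
    using assms(2)[of 4] by (auto simp: fun_eq_iff heads_def sdefs)
  have "exec \<phi> (Sign 4) (t(1 := w1)) (heads 0 (int p + 1) s2) ((t(1 := w1))(1 := w2)) (heads 0 (int p + 2) s3)"
    unfolding h3[symmetric] by (rule exec_Sign) (auto simp: heads_def t1'' w1_def w2_def)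
  then have 3: "exec \<phi> (Sign 4) (t(1 := w1)) (heads 0 (int p + 1) s2) (t(1 := w2)) (heads 0 (int p + 2) s3)"
    by simp
  let ?m = "int p + 2 + int q"
  have h4: "(heads 0 (int p + 2) s3)(1 := heads 0 (int p + 2) s3 1 + int q, 5 + 2 := heads 0 (int p + 2) s3 (5 + 2) + int q)
      = heads 0 ?m s4"
    using assms(2)[of 5] by (auto simp: fun_eq_iff heads_def sdefs)
  have 4: "exec \<phi> (Sweep 1 5) (t(1 := w2)) (heads 0 (int p + 2) s3) (t(1 := w2)) (heads 0 ?m s4)"
    unfolding h4[symmetric] by (rule exec_Sweep) (auto simp: heads_def t1'' w1_def w2_def)
  have h5: "(heads 0 ?m s4)(1 := 0) = heads 0 0 (inputs (s 0) (s 1) d)"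
  proof -
    have "s4 i = inputs (s 0) (s 1) d i" for i
    proof (cases "i < 6")
      case True
      then have "i \<in> {0, 1, 2, 3, 4, 5}" by auto
      then show ?thesis by (auto simp: sdefs p_def q_def a_def b_def)
    qed (use assms(2)[of i] in \<open>simp add: sdefs\<close>)
    then show ?thesis by (auto simp: fun_eq_iff heads_def)
  qed
  have 5: "exec \<phi> (Rewind 1) (t(1 := w2)) (heads 0 ?m s4) (t(1 := w2)) (heads 0 0 (inputs (s 0) (s 1) d))"
    unfolding h5[symmetric]
    by (rule exec_Rewind[where n = "p + 2 + q"]) (auto simp: heads_def t1'' w1_def w2_def)
  from 1 2 3 4 5 show ?thesis unfolding ReadAnswer_def by (blast intro: exec_Seq)
qed

text \<open>
  The blank behind the ones is needed because the remains of the previous answer are still on the query tape.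
\<close>

definition Ask :: prog where "Ask = Print 1 7 ;; Write 1 sym_blank ;; Query"

lemma exec_Ask:
  assumes "marked K t" "9 < K"
  shows "exec \<phi> Ask t (heads 0 0 s) (t(1 := write_word (encode_dyadic (mantissa (\<phi> (s 7))) (exponent (\<phi> (s 7))))))
     (heads 0 0 (s(7 := 0)))"
proof -
  let ?k = "s 7" and ?h = "heads 0 0 s"
  let ?t1 = "t(1 := ones (?h 1) ?k (t 1))"
  let ?h1 = "?h(1 := ?h 1 + int ?k, 7 + 2 := 0)"
  let ?t2 = "?t1(1 := (?t1 1)(?h1 1 := sym_blank))"
  have "exec \<phi> (Print 1 7) t ?h ?t1 ?h1"
    by (rule exec_Print[OF assms(1)]) (use assms(2) in \<open>auto simp: heads_def\<close>)
  then have 1: "exec \<phi> Ask t ?h (?t2(1 := answer \<phi> (?t2 1))) (?h1(1 := 0))"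
    unfolding Ask_def by (blast intro: exec_Seq exec_Write exec_Query)
  have "query_number (?t2 1) = ?k"
    unfolding query_number_def by (rule Least_equality) (auto simp: heads_def ones_def split: if_splits)
  then have "?t2(1 := answer \<phi> (?t2 1)) =
      t(1 := write_word (encode_dyadic (mantissa (\<phi> (s 7))) (exponent (\<phi> (s 7)))))"
    by (simp add: answer_def Let_def)
  moreover have "?h1(1 := 0) = heads 0 0 (s(7 := 0))" by (auto simp: heads_def fun_eq_iff)
  ultimately show ?thesis using 1 by simp
qed

text \<open>
  Register \<open>7\<close> is the sign flag of the mantissa, \<open>8\<close> its absolute value and \<open>9\<close> the absolute value of the
  exponent. The final blank cuts off the remains of the input word.
\<close>

definition PrintOutput :: prog where
  "PrintOutput = Write 0 sym_plus ;; Loop 7 (Clear 7 ;; Write 0 sym_minus) ;; Move 0 Move_Right ;; Print 0 8 ;;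
     Write 0 sym_minus ;; Move 0 Move_Right ;; Print 0 9 ;; Write 0 sym_blank"

lemma exec_PrintOutput:
  assumes "marked K t" "11 < K"
  shows "\<exists>t' h'. exec \<phi> PrintOutput t (heads 0 0 s) t' h' \<and>
    holds_word (t' 0) ((if s 7 = 0 then sym_plus else sym_minus) # replicate (s 8) sym_one @
      sym_minus # replicate (s 9) sym_one)"
proof -
  let ?e = "if s 7 = 0 then sym_plus else sym_minus"
  have M: "marked K (t(0 := w))" for w using assms(1) by (rule marked_upd) simp
  define w1 where "w1 = (t 0)(0 := sym_plus)"
  have 1: "exec \<phi> (Write 0 sym_plus) t (heads 0 0 s) (t(0 := w1)) (heads 0 0 s)"
    using exec_Write[of \<phi> 0 sym_plus t "heads 0 0 s"] by (simp add: w1_def)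
  define w2 where "w2 = (t 0)(0 := ?e)"
  define s2 where "s2 = s(7 := 0)"
  let ?b = "Clear 7 ;; Write 0 sym_minus"
  have 2: "exec \<phi> (Loop 7 ?b) (t(0 := w1)) (heads 0 0 s) (t(0 := w2)) (heads 0 0 s2)"
  proof (cases "s 7 = 0")
    case True
    then have "s2 = s" "w1 = w2" by (auto simp: s2_def w1_def w2_def)
    then show ?thesis
      using rexec_Loop_zero[of s 7 K ?b, OF True] assms(2) rexecD[OF _ M] by simp
  next
    case False
    have "exec \<phi> (Clear 7) (t(0 := w1)) (heads 0 0 s) (t(0 := w1)) (heads 0 0 s2)"
      unfolding s2_def by (rule rexecD[OF rexec_Clear M]) (use assms(2) in simp)
    moreover have "exec \<phi> (Write 0 sym_minus) (t(0 := w1)) (heads 0 0 s2) (t(0 := w2)) (heads 0 0 s2)"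
      using exec_Write[of \<phi> 0 sym_minus "t(0 := w1)" "heads 0 0 s2"] False
      by (simp add: w1_def w2_def)
    ultimately have "exec \<phi> ?b (t(0 := w1)) (heads 0 0 s) (t(0 := w2)) (heads 0 0 s2)" by (rule exec_Seq)
    moreover have "(t(0 := w1)) (7 + 2) (heads 0 0 s (7 + 2)) \<in> {sym_blank}"
      using register_symbol[OF M, where j = 7 and s = s] assms(2) False by simp
    moreover have "exec \<phi> (Loop 7 ?b) (t(0 := w2)) (heads 0 0 s2) (t(0 := w2)) (heads 0 0 s2)"
      by (rule rexecD[OF rexec_Loop_zero M]) (use assms(2) in \<open>simp_all add: s2_def\<close>)
    ultimately show ?thesis unfolding Loop_def by (blast intro: exec_While_True)
  qed
  have 3: "exec \<phi> (Move 0 Move_Right) (t(0 := w2)) (heads 0 0 s2) (t(0 := w2)) (heads 1 0 s2)"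
    using exec_Move[of \<phi> 0 Move_Right "t(0 := w2)" "heads 0 0 s2"] by simp
  define w3 where "w3 = ones 1 (s 8) w2"
  define a where "a = int (s 8) + 1"
  define s3 where "s3 = s2(8 := 0)"
  have h4: "(heads 1 0 s2)(0 := heads 1 0 s2 0 + int (s 8), 8 + 2 := 0) = heads a 0 s3"
    by (auto simp: fun_eq_iff heads_def a_def s3_def)
  have "exec \<phi> (Print 0 8) (t(0 := w2)) (heads 1 0 s2) ((t(0 := w2))(0 := ones (heads 1 0 s2 0) (s 8) ((t(0 := w2)) 0)))
     ((heads 1 0 s2)(0 := heads 1 0 s2 0 + int (s 8), 8 + 2 := 0))"
    by (rule exec_Print[OF M]) (use assms(2) in \<open>auto simp: heads_def s2_def\<close>)
  then have 4: "exec \<phi> (Print 0 8) (t(0 := w2)) (heads 1 0 s2) (t(0 := w3)) (heads a 0 s3)"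
    unfolding h4 by (simp add: w3_def)
  define w4 where "w4 = w3(a := sym_minus)"
  have 5: "exec \<phi> (Write 0 sym_minus) (t(0 := w3)) (heads a 0 s3) (t(0 := w4)) (heads a 0 s3)"
    using exec_Write[of \<phi> 0 sym_minus "t(0 := w3)" "heads a 0 s3"] by (simp add: w4_def)
  have 6: "exec \<phi> (Move 0 Move_Right) (t(0 := w4)) (heads a 0 s3) (t(0 := w4)) (heads (a + 1) 0 s3)"
    using exec_Move[of \<phi> 0 Move_Right "t(0 := w4)" "heads a 0 s3"] by simp
  define w5 where "w5 = ones (a + 1) (s 9) w4"
  define b where "b = a + 1 + int (s 9)"
  have h7: "(heads (a + 1) 0 s3)(0 := heads (a + 1) 0 s3 0 + int (s 9), 9 + 2 := 0) = heads b 0 (s3(9 := 0))"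
    by (auto simp: fun_eq_iff heads_def b_def s3_def)
  have "exec \<phi> (Print 0 9) (t(0 := w4)) (heads (a + 1) 0 s3)
     ((t(0 := w4))(0 := ones (heads (a + 1) 0 s3 0) (s 9) ((t(0 := w4)) 0)))
     ((heads (a + 1) 0 s3)(0 := heads (a + 1) 0 s3 0 + int (s 9), 9 + 2 := 0))"
    by (rule exec_Print[OF M]) (use assms(2) in \<open>auto simp: heads_def s2_def s3_def\<close>)
  then have 7: "exec \<phi> (Print 0 9) (t(0 := w4)) (heads (a + 1) 0 s3) (t(0 := w5)) (heads b 0 (s3(9 := 0)))"
    unfolding h7 by (simp add: w5_def)
  define w6 where "w6 = w5(b := sym_blank)"
  have 8: "exec \<phi> (Write 0 sym_blank) (t(0 := w5)) (heads b 0 (s3(9 := 0))) (t(0 := w6)) (heads b 0 (s3(9 := 0)))"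
    using exec_Write[of \<phi> 0 sym_blank "t(0 := w5)" "heads b 0 (s3(9 := 0))"] by (simp add: w6_def)
  have "exec \<phi> PrintOutput t (heads 0 0 s) (t(0 := w6)) (heads b 0 (s3(9 := 0)))"
    using 1 2 3 4 5 6 7 8 unfolding PrintOutput_def by (blast intro: exec_Seq)
  moreover have "holds_word w6 (?e # replicate (s 8) sym_one @ sym_minus # replicate (s 9) sym_one)"
    unfolding holds_word_def w6_def w5_def w4_def w3_def w2_def a_def b_def ones_def
    by (auto simp: nth_Cons nth_append split: nat.splits)
  ultimately show ?thesis by (intro exI[of _ "t(0 := w6)"] exI) simp
qed

text \<open>
  The machine asks for \<open>\<phi>(1)\<close>, \<open>\<phi>(2)\<close>, and so on until the test \<open>F\<close> succeeds, and then prints a dyadic number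
  with sign flag \<open>S\<close>, absolute mantissa \<open>A\<close> and exponent \<open>-(E + 1)\<close>. Exponents are always printed with a
  minus sign, and the code of \<open>0\<close> carries a plus sign; hence the successor, and hence
  the assumption relating \<open>S\<close> to \<open>A\<close>.
\<close>

theorem search_machine_exists:
  assumes F: "reg_computable 6 F" and S: "reg_computable 6 S"
    and A: "reg_computable 6 A" and E: "reg_computable 6 E"
    and sign: "\<And>s. S s \<noteq> 0 \<Longrightarrow> A s \<noteq> 0"
  shows "\<exists>M. oracle_machine M \<and> (\<forall>\<phi> n. (\<exists>k\<ge>1. F (inputs n k (\<phi> k)) \<noteq> 0) \<longrightarrow>
     (\<exists>k\<ge>1. let s = inputs n k (\<phi> k) in F s \<noteq> 0 \<and>
        outputs M \<phi> n (Float (if S s = 0 then int (A s) else - int (A s)) (- int (Suc (E s))))))"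
proof -
  have "\<exists>P K. \<forall>K'\<ge>K. computes K' P 7 (\<lambda>s. s 1)"
    by (rule reg_computableD[of 6]) (simp_all add: reg_computable_var)
  then obtain PK K1 where PK: "\<And>K'. K1 \<le> K' \<Longrightarrow> computes K' PK 7 (\<lambda>s. s 1)" by blast
  obtain PF K2 where PF: "\<And>K'. K2 \<le> K' \<Longrightarrow> computes K' PF 6 F"
    using reg_computableD[OF F, of 6] by auto
  obtain PS K3 where PS: "\<And>K'. K3 \<le> K' \<Longrightarrow> computes K' PS 7 S"
    using reg_computableD[OF S, of 7] by auto
  obtain PA K4 where PA: "\<And>K'. K4 \<le> K' \<Longrightarrow> computes K' PA 8 A"
    using reg_computableD[OF A, of 8] by auto
  obtain PE K5 where PE: "\<And>K'. K5 \<le> K' \<Longrightarrow> computes K' PE 9 (\<lambda>s. Suc (E s))"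
    using reg_computableD[OF reg_computable_Suc[OF E], of 9] by auto
  define K where "K = K1 + K2 + K3 + K4 + K5 + 12"
  have K: "12 \<le> K" by (simp add: K_def)
  have PK: "computes K PK 7 (\<lambda>s. s 1)" and PF: "computes K PF 6 F" and PS: "computes K PS 7 S"
    and PA: "computes K PA 8 A" and PE: "computes K PE 9 (\<lambda>s. Suc (E s))"
    by (intro PK PF PS PA PE; simp add: K_def)+
  define Body where "Body = (Inc 1 ;; Clear 2 ;; Clear 3 ;; Clear 4 ;; Clear 5) ;; PK ;; Ask ;; ReadAnswer ;; PF"
  \<comment> \<open>Register \<open>6\<close> holds the value of the test, and its tape shows the mark while that is zero.\<close>
  define Search where "Search = While (6 + 2) {sym_plus} Body"
  define Main where "Main = MarkTapes (K - 2) ;; ReadInput ;; Search ;; PS ;; PA ;; PE ;; PrintOutput"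
  have wf: "wf_prog K Main"
    using PK PF PS PA PE K
    by (simp add: Main_def Search_def Body_def ReadInput_def ReadAnswer_def Ask_def PrintOutput_def
        wf_MarkTapes computes_def)
  have "\<exists>k\<ge>1. let s = inputs n k (\<phi> k) in F s \<noteq> 0 \<and>
        outputs (compile K Main) \<phi> n (Float (if S s = 0 then int (A s) else - int (A s)) (- int (Suc (E s))))"
    if "\<exists>k\<ge>1. F (inputs n k (\<phi> k)) \<noteq> 0" for \<phi> n
  proof -
    define I where "I k = inputs n k (\<phi> k)" for k
    \<comment> \<open>The search stops at the first success, whichever success the hypothesis provides.\<close>
    define m where "m = (LEAST k. k \<ge> 1 \<and> F (I k) \<noteq> 0)"
    have m: "m \<ge> 1" "F (I m) \<noteq> 0" using LeastI_ex[OF that] unfolding m_def I_def by auto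
    have below: "F (I k) = 0" if "1 \<le> k" "k < m" for k
      using not_less_Least[of k "\<lambda>k. k \<ge> 1 \<and> F (I k) \<noteq> 0"] that unfolding m_def by auto
    have body: "\<exists>w. exec \<phi> Body t (heads 0 0 s) (t(1 := w)) (heads 0 0 ((I (Suc k))(6 := F (I (Suc k)))))"
      if t: "marked K t" and s: "s 0 = n" "s 1 = k" "\<And>i. 6 \<le> i \<Longrightarrow> s i = 0" for t s k
    proof -
      define s' where "s' = (\<lambda>i::nat. if i = 0 then n else if i = 1 then Suc k else 0 :: nat)"
      have "rexec K (Inc 1 ;; Clear 2 ;; Clear 3 ;; Clear 4 ;; Clear 5) s
          (s(1 := Suc (s 1), 2 := 0, 3 := 0, 4 := 0, 5 := 0))"
        by (rule rexec_Seq[OF rexec_Inc[OF refl] rexec_Seq[OF rexec_Clear rexec_Seq[OF rexec_Clear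
            rexec_Seq[OF rexec_Clear rexec_Clear]]]]) (use K in simp_all)
      moreover have "s(1 := Suc (s 1), 2 := 0, 3 := 0, 4 := 0, 5 := 0) = s'"
      proof
        fix i :: nat
        consider "i < 6" | "6 \<le> i" by linarith
        then show "(s(1 := Suc (s 1), 2 := 0, 3 := 0, 4 := 0, 5 := 0)) i = s' i"
        proof cases
          case 1
          then have "i \<in> {0, 1, 2, 3, 4, 5}" by auto
          then show ?thesis using s by (auto simp: s'_def)
        qed (use s in \<open>auto simp: s'_def\<close>)
      qed
      ultimately have 1: "exec \<phi> (Inc 1 ;; Clear 2 ;; Clear 3 ;; Clear 4 ;; Clear 5) t (heads 0 0 s) t (heads 0 0 s')"
        using rexecD[OF _ t] by simp
      have 2: "exec \<phi> PK t (heads 0 0 s') t (heads 0 0 (s'(7 := Suc k)))"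
        by (rule rexecD[OF computes_rexec[OF PK] t]) (auto simp: s'_def)
      let ?t = "t(1 := write_word (encode_dyadic (mantissa (\<phi> (Suc k))) (exponent (\<phi> (Suc k)))))"
      have "s'(7 := Suc k, 7 := 0) = s'" by (auto simp: s'_def)
      then have 3: "exec \<phi> Ask t (heads 0 0 (s'(7 := Suc k))) ?t (heads 0 0 s')"
        using exec_Ask[OF t, of \<phi> "s'(7 := Suc k)"] K by simp
      have "\<exists>w. exec \<phi> ReadAnswer ?t (heads 0 0 s') (?t(1 := w)) (heads 0 0 (inputs (s' 0) (s' 1) (\<phi> (Suc k))))"
        by (rule exec_ReadAnswer) (auto simp: s'_def)
      then obtain w where 4: "exec \<phi> ReadAnswer ?t (heads 0 0 s') (t(1 := w)) (heads 0 0 (I (Suc k)))"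
        by (auto simp: s'_def I_def)
      have 5: "exec \<phi> PF (t(1 := w)) (heads 0 0 (I (Suc k))) (t(1 := w)) (heads 0 0 ((I (Suc k))(6 := F (I (Suc k)))))"
        by (rule rexecD[OF computes_rexec[OF PF] marked_upd[OF t]]) (auto simp: I_def)
      have "exec \<phi> Body t (heads 0 0 s) (t(1 := w)) (heads 0 0 ((I (Suc k))(6 := F (I (Suc k)))))"
        unfolding Body_def
        by (rule exec_Seq[OF 1], rule exec_Seq[OF 2], rule exec_Seq[OF 3], rule exec_Seq[OF 4 5])
      then show ?thesis by blast
    qed
    have search: "\<exists>w. exec \<phi> Search t (heads 0 0 s) (t(1 := w)) (heads 0 0 ((I m)(6 := F (I m))))"
      if "marked K t" "s 0 = n" "s 1 = k" "\<And>i. 6 \<le> i \<Longrightarrow> s i = 0" "k + Suc j = m" for t s k j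
      using that
    proof (induction j arbitrary: t s k)
      case 0
      then have k: "Suc k = m" by simp
      obtain w where w: "exec \<phi> Body t (heads 0 0 s) (t(1 := w)) (heads 0 0 ((I m)(6 := F (I m))))"
        using body[OF 0(1-4)] unfolding k by blast
      have "t (6 + 2) (heads 0 0 s (6 + 2)) \<in> {sym_plus}"
        using register_symbol[OF 0(1), where j = 6 and s = s] K 0(4)[of 6] by simp
      moreover have "(t(1 := w)) (6 + 2) (heads 0 0 ((I m)(6 := F (I m))) (6 + 2)) \<notin> {sym_plus}"
        using register_symbol[OF marked_upd[OF 0(1), of 1 w], where j = 6 and s = "(I m)(6 := F (I m))"] K m(2)
        by simp
      ultimately have "exec \<phi> Search t (heads 0 0 s) (t(1 := w)) (heads 0 0 ((I m)(6 := F (I m))))"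
        unfolding Search_def by (rule exec_While_True[OF _ w exec_While_False])
      then show ?case by blast
    next
      case (Suc j)
      then have k: "Suc k < m" "Suc k + Suc j = m" by simp_all
      have "(I (Suc k))(6 := F (I (Suc k))) = I (Suc k)"
        using below[of "Suc k"] k(1) by (auto simp: I_def fun_eq_iff)
      then obtain w where w: "exec \<phi> Body t (heads 0 0 s) (t(1 := w)) (heads 0 0 (I (Suc k)))"
        using body[OF Suc.prems(1-4)] by auto
      have "\<exists>w'. exec \<phi> Search (t(1 := w)) (heads 0 0 (I (Suc k))) ((t(1 := w))(1 := w')) (heads 0 0 ((I m)(6 := F (I m))))"
        by (rule Suc.IH[OF marked_upd[OF Suc.prems(1)] _ _ _ k(2)]) (auto simp: I_def)
      then obtain w' where w': "exec \<phi> Search (t(1 := w)) (heads 0 0 (I (Suc k))) (t(1 := w')) (heads 0 0 ((I m)(6 := F (I m))))"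
        by auto
      have "t (6 + 2) (heads 0 0 s (6 + 2)) \<in> {sym_plus}"
        using register_symbol[OF Suc.prems(1), where j = 6 and s = s] K Suc.prems(4)[of 6] by simp
      then have "exec \<phi> Search t (heads 0 0 s) (t(1 := w')) (heads 0 0 ((I m)(6 := F (I m))))"
        using w w' unfolding Search_def by (rule exec_While_True)
      then show ?case by blast
    qed
    let ?t = "tape (initial_config n)"
    have h0: "(\<lambda>_. 0) = heads 0 0 (\<lambda>_. 0)" by (auto simp: heads_def fun_eq_iff)
    have "K - 2 + 2 = K" using K by simp
    then have "\<exists>t'. exec \<phi> (MarkTapes (K - 2)) ?t (\<lambda>_. 0) t' (\<lambda>_. 0) \<and> marked K t' \<and> t' 0 = ?t 0"
      using exec_MarkTapes[of ?t "\<lambda>_. 0" \<phi> "K - 2"] by (auto simp: initial_config_def)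
    then obtain t1 where t1: "exec \<phi> (MarkTapes (K - 2)) ?t (\<lambda>_. 0) t1 (heads 0 0 (\<lambda>_. 0))" "marked K t1" "t1 0 = ?t 0"
      unfolding h0 by blast
    have t2: "exec \<phi> ReadInput t1 (heads 0 0 (\<lambda>_. 0)) t1 (heads 0 0 ((\<lambda>_. 0)(0 := n)))"
      by (rule exec_ReadInput) (simp add: t1(3) initial_config_def)
    have "\<exists>w. exec \<phi> Search t1 (heads 0 0 ((\<lambda>_. 0)(0 := n))) (t1(1 := w)) (heads 0 0 ((I m)(6 := F (I m))))"
      by (rule search[OF t1(2), where k = 0 and j = "m - 1"]) (use m(1) in auto)
    then obtain w where t3: "exec \<phi> Search t1 (heads 0 0 ((\<lambda>_. 0)(0 := n))) (t1(1 := w)) (heads 0 0 ((I m)(6 := F (I m))))" ..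
    let ?s = "(I m)(6 := F (I m))"
    have agree: "G (?s(7 := a)) = G (I m)" "G (?s(7 := a, 8 := b)) = G (I m)" "G ?s = G (I m)"
      if "reg_computable 6 G" for G a b
      by (rule reg_computable_cong[OF that], simp)+
    have M: "marked K (t1(1 := w))" by (rule marked_upd[OF t1(2)]) simp
    have t4: "exec \<phi> PS (t1(1 := w)) (heads 0 0 ?s) (t1(1 := w)) (heads 0 0 (?s(7 := S (I m))))"
      by (rule rexecD[OF computes_rexec[OF PS] M]) (auto simp: I_def agree[OF S, unfolded I_def])
    have t5: "exec \<phi> PA (t1(1 := w)) (heads 0 0 (?s(7 := S (I m)))) (t1(1 := w)) (heads 0 0 (?s(7 := S (I m), 8 := A (I m))))"
      by (rule rexecD[OF computes_rexec[OF PA] M]) (auto simp: I_def agree[OF A, unfolded I_def])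
    have t6: "exec \<phi> PE (t1(1 := w)) (heads 0 0 (?s(7 := S (I m), 8 := A (I m)))) (t1(1 := w))
        (heads 0 0 (?s(7 := S (I m), 8 := A (I m), 9 := Suc (E (I m)))))"
      by (rule rexecD[OF computes_rexec[OF PE] M]) (auto simp: I_def agree[OF E, unfolded I_def])
    let ?s' = "?s(7 := S (I m), 8 := A (I m), 9 := Suc (E (I m)))"
    have "11 < K" using K by simp
    from exec_PrintOutput[OF M this, of \<phi> ?s'] obtain t' h'
      where t7: "exec \<phi> PrintOutput (t1(1 := w)) (heads 0 0 ?s') t' h'"
      and "holds_word (t' 0) ((if ?s' 7 = 0 then sym_plus else sym_minus) # replicate (?s' 8) sym_one @
          sym_minus # replicate (?s' 9) sym_one)"
      by blast
    then have out: "holds_word (t' 0) ((if S (I m) = 0 then sym_plus else sym_minus) # replicate (A (I m)) sym_one @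
          sym_minus # replicate (Suc (E (I m))) sym_one)"
      by simp
    have run: "exec \<phi> Main ?t (\<lambda>_. 0) t' h'"
      unfolding Main_def
      by (rule exec_Seq[OF t1(1)], rule exec_Seq[OF t2], rule exec_Seq[OF t3], rule exec_Seq[OF t4],
          rule exec_Seq[OF t5], rule exec_Seq[OF t6 t7])
    have "holds_word (t' 0) (encode_dyadic (if S (I m) = 0 then int (A (I m)) else - int (A (I m))) (- int (Suc (E (I m)))))"
      using out sign[of "I m"] by (cases "S (I m) = 0") (simp_all add: encode_dyadic_def encode_int_def del: replicate_Suc of_nat_Suc)
    then have "outputs (compile K Main) \<phi> n
        (Float (if S (I m) = 0 then int (A (I m)) else - int (A (I m))) (- int (Suc (E (I m)))))"
      using outputs_compile[OF run wf] K by simp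
    then show ?thesis using m unfolding I_def Let_def by blast
  qed
  moreover have "oracle_machine (compile K Main)"
    using wf K by (intro oracle_machine_compile) auto
  ultimately show ?thesis by blast
qed

section \<open>Computing real functions from rational enclosures\<close>

text \<open>
  The answer to query \<open>k\<close> (register \<open>1\<close>), multiplied by \<open>2\<^sup>k\<close>, cut off at zero and rounded down. For
  \<open>x \<ge> 0\<close> it misses \<open>2\<^sup>k x\<close> by less than \<open>2\<close>, where one unit is the error of the oracle and one that of rounding.
\<close>

definition scaled :: "(nat \<Rightarrow> nat) \<Rightarrow> nat" where
  "scaled s = (if s 2 = 0 then if s 4 = 0 then s 3 * 2 ^ s 5 * 2 ^ s 1 else s 3 * 2 ^ s 1 div 2 ^ s 5 else 0)"

lemma reg_computable_scaled: "reg_computable 6 scaled"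
  unfolding scaled_def by (intro computable_intros) auto

definition close :: "nat \<Rightarrow> nat \<Rightarrow> real \<Rightarrow> bool" where
  "close k X x \<longleftrightarrow> \<bar>real X - x * 2 ^ k\<bar> < 2"

lemma close_scaled:
  assumes "oracle_for \<phi> x" "0 \<le> x"
  shows "close k (scaled (inputs n k (\<phi> k))) x"
proof -
  let ?d = "\<phi> k" and ?X = "scaled (inputs n k (\<phi> k))"
  define p where "p = mantissa ?d"
  define q where "q = exponent ?d"
  have d: "real_of_float ?d = of_int p * 2 powr of_int q"
    unfolding p_def q_def by (rule mantissa_exponent)
  have "\<bar>real_of_float ?d - x\<bar> * 2 ^ k < 1 / 2 ^ k * 2 ^ k"
    using assms(1) unfolding oracle_for_def by (intro mult_strict_right_mono) auto
  then have close: "\<bar>real_of_float ?d * 2 ^ k - x * 2 ^ k\<bar> < 1"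
    by (simp add: left_diff_distrib[symmetric] abs_mult)
  have X: "?X = (if p < 0 then 0 else if q < 0 then nat p * 2 ^ k div 2 ^ nat (- q)
      else nat p * 2 ^ nat q * 2 ^ k)"
    by (simp add: scaled_def p_def q_def)
  consider "p < 0" | "0 \<le> p" "0 \<le> q" | "0 \<le> p" "q < 0" by linarith
  then show ?thesis
  proof cases
    case 1
    then have "real_of_float ?d * 2 ^ k \<le> 0"
      unfolding d by (auto simp: mult_le_0_iff)
    moreover have "0 \<le> x * 2 ^ k" using assms(2) by simp
    ultimately show ?thesis using close 1 X by (simp add: close_def)
  next
    case 2
    then have "real_of_float ?d * 2 ^ k = real ?X"
      unfolding d X by (simp add: powr_real_of_int)
    then show ?thesis using close by (simp add: close_def)
  next
    case 3
    then have dX: "real_of_float ?d * 2 ^ k = real (nat p * 2 ^ k) / real (2 ^ nat (- q))"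
      unfolding d by (simp add: powr_real_of_int field_simps)
    have "?X = nat p * 2 ^ k div 2 ^ nat (- q)" using 3 X by simp
    then have "real ?X = of_int \<lfloor>real_of_float ?d * 2 ^ k\<rfloor>"
      unfolding dX floor_divide_of_nat_eq by simp
    then have "real ?X \<le> real_of_float ?d * 2 ^ k" "real_of_float ?d * 2 ^ k < real ?X + 1"
      by linarith+
    then show ?thesis using close unfolding close_def by linarith
  qed
qed

definition computable2 :: "(nat \<Rightarrow> nat \<Rightarrow> nat) \<Rightarrow> bool" where
  "computable2 g \<longleftrightarrow> (\<forall>m a b. reg_computable m a \<longrightarrow> reg_computable m b \<longrightarrow>
     reg_computable m (\<lambda>s. g (a s) (b s)))"

lemma computable2D:
  "computable2 g \<Longrightarrow> reg_computable m a \<Longrightarrow> reg_computable m b \<Longrightarrow>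
   reg_computable m (\<lambda>s. g (a s) (b s))"
  by (simp add: computable2_def)

text \<open>
  What a machine can know about \<open>y\<close> at a point \<open>x\<close> when all it has is a natural number \<open>X\<close> close to \<open>2\<^sup>k x\<close>: the
  bounds \<open>lo\<close> and \<open>hi\<close>, in units of \<open>2\<^sup>-\<^sup>e\<close>, are valid if the guard \<open>g\<close> is on. For large \<open>k\<close> the guard is
  on and the bounds are tight uniformly in \<open>X\<close>, so a search succeeds for every oracle.
\<close>

definition encloses :: "(nat \<Rightarrow> nat \<Rightarrow> nat) \<Rightarrow> (nat \<Rightarrow> nat \<Rightarrow> nat) \<Rightarrow> (nat \<Rightarrow> nat \<Rightarrow> nat) \<Rightarrow> (nat \<Rightarrow> nat \<Rightarrow> nat)
    \<Rightarrow> real \<Rightarrow> real \<Rightarrow> bool" where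
  "encloses g lo hi e x y \<longleftrightarrow>
     (\<forall>k X. close k X x \<longrightarrow> g k X \<noteq> 0 \<longrightarrow>
        real (lo k X) \<le> y * 2 ^ e k X \<and> y * 2 ^ e k X \<le> real (hi k X)) \<and>
     (\<forall>\<epsilon>>0. \<forall>\<^sub>F k in sequentially. \<forall>X. close k X x \<longrightarrow>
        g k X \<noteq> 0 \<and> real (hi k X) - real (lo k X) < \<epsilon> * 2 ^ e k X)"

definition approximable_on :: "(real \<Rightarrow> real) \<Rightarrow> real set \<Rightarrow> bool" where
  "approximable_on f A \<longleftrightarrow> (\<exists>g lo hi e. computable2 g \<and> computable2 lo \<and> computable2 hi \<and> computable2 e \<and>
     (\<forall>x\<in>A. encloses g lo hi e x (f x)))"

lemma enclosesD:
  assumes "encloses g lo hi e x y" "close k X x" "g k X \<noteq> 0"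
  shows "real (lo k X) \<le> y * 2 ^ e k X" "y * 2 ^ e k X \<le> real (hi k X)"
  using assms by (auto simp: encloses_def)

lemma encloses_eventually:
  assumes "encloses g lo hi e x y" "0 < \<epsilon>"
  shows "\<forall>\<^sub>F k in sequentially. \<forall>X. close k X x \<longrightarrow>
    g k X \<noteq> 0 \<and> real (hi k X) - real (lo k X) < \<epsilon> * 2 ^ e k X"
  using assms by (auto simp: encloses_def)

text \<open>
  One machine serves computability and left-computability. With an enclosure \<open>[L, H]\<close> of width at most
  \<open>2\<^sup>-\<^sup>n\<^sup>-\<^sup>4\<close> it prints \<open>L - 2\<^sup>-\<^sup>n\<^sup>-\<^sup>1\<close>, so the error lies between \<open>2\<^sup>-\<^sup>n\<^sup>-\<^sup>1\<close> and \<open>2\<^sup>-\<^sup>n\<^sup>-\<^sup>1 + 2\<^sup>-\<^sup>n\<^sup>-\<^sup>4\<close>. These ranges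
  are disjoint for successive \<open>n\<close>, hence the outputs increase strictly, although the enclosures for
  different \<open>n\<close> are computed independently.
\<close>

theorem approximable_machine:
  assumes "approximable_on f A" "A \<subseteq> {0..}"
  shows "\<exists>M. oracle_machine M \<and> (\<forall>x\<in>A. \<forall>\<phi>. oracle_for \<phi> x \<longrightarrow>
    (\<exists>d. (\<forall>n. outputs M \<phi> n (d n)) \<and> strict_mono (\<lambda>n. real_of_float (d n)) \<and>
         (\<forall>n. \<bar>f x - real_of_float (d n)\<bar> < 1 / 2 ^ n)))"
proof -
  obtain g lo hi e where comp: "computable2 g" "computable2 lo" "computable2 hi" "computable2 e"
    and enc: "\<And>x. x \<in> A \<Longrightarrow> encloses g lo hi e x (f x)"
    using assms(1) unfolding approximable_on_def by blast
  have v: "reg_computable 6 (\<lambda>s. s 0)" "reg_computable 6 (\<lambda>s. s 1)"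
    by (auto intro: computable_intros)
  note intros = computable_intros v comp[THEN computable2D, OF v(2) reg_computable_scaled]
  define F where "F = (\<lambda>s. if g (s 1) (scaled s) = 0 then 0 else
     if hi (s 1) (scaled s) * 2 ^ (s 0 + 4) \<le> 2 ^ e (s 1) (scaled s) + lo (s 1) (scaled s) * 2 ^ (s 0 + 4)
     then 1 else (0::nat))"
  define P where "P = (\<lambda>s. lo (s 1) (scaled s) * 2 ^ Suc (s 0))"
  define Q where "Q = (\<lambda>s. (2::nat) ^ e (s 1) (scaled s))"
  define S where "S = (\<lambda>s. Q s - P s)"
  define B where "B = (\<lambda>s. (P s - Q s) + (Q s - P s))"
  define E where "E = (\<lambda>s. e (s 1) (scaled s) + s 0)"
  have "reg_computable 6 F" unfolding F_def by (intro intros)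
  moreover have "reg_computable 6 S" unfolding S_def P_def Q_def by (intro intros)
  moreover have "reg_computable 6 B" unfolding B_def P_def Q_def by (intro intros)
  moreover have "reg_computable 6 E" unfolding E_def by (intro intros)
  moreover have "B s \<noteq> 0" if "S s \<noteq> 0" for s using that by (simp add: S_def B_def)
  ultimately obtain M where M: "oracle_machine M" and
    search: "\<And>\<phi> n. \<exists>k\<ge>1. F (inputs n k (\<phi> k)) \<noteq> 0 \<Longrightarrow>
     \<exists>k\<ge>1. let s = inputs n k (\<phi> k) in F s \<noteq> 0 \<and>
        outputs M \<phi> n (Float (if S s = 0 then int (B s) else - int (B s)) (- int (Suc (E s))))"
    using search_machine_exists[of F S B E] by blast
  have "\<exists>d. (\<forall>n. outputs M \<phi> n (d n)) \<and> strict_mono (\<lambda>n. real_of_float (d n)) \<and>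
         (\<forall>n. \<bar>f x - real_of_float (d n)\<bar> < 1 / 2 ^ n)"
    if x: "x \<in> A" and \<phi>: "oracle_for \<phi> x" for x \<phi>
  proof -
    have close: "close k (scaled (inputs n k (\<phi> k))) x" for n k
      using close_scaled[OF \<phi>] x assms(2) by auto
    have "\<exists>d. outputs M \<phi> n d \<and> 1 / 2 ^ (n + 1) \<le> f x - real_of_float d \<and>
        f x - real_of_float d \<le> 1 / 2 ^ (n + 1) + 1 / 2 ^ (n + 4)" for n
    proof -
      have "\<forall>\<^sub>F k in sequentially. (\<forall>X. close k X x \<longrightarrow>
          g k X \<noteq> 0 \<and> real (hi k X) - real (lo k X) < 1 / 2 ^ (n + 4) * 2 ^ e k X) \<and> 1 \<le> k"
        using encloses_eventually[OF enc[OF x], of "1 / 2 ^ (n + 4)"] eventually_ge_at_top[of 1]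
        by (intro eventually_conj) auto
      from eventually_happens'[OF sequentially_bot this] obtain k where k: "1 \<le> k" and kX: "\<And>X. close k X x \<Longrightarrow>
          g k X \<noteq> 0 \<and> real (hi k X) - real (lo k X) < 1 / 2 ^ (n + 4) * 2 ^ e k X"
        by blast
      let ?X = "scaled (inputs n k (\<phi> k))"
      have "(real (hi k ?X) - real (lo k ?X)) * 2 ^ (n + 4) < 1 / 2 ^ (n + 4) * 2 ^ e k ?X * 2 ^ (n + 4)"
        using kX[OF close] by (intro mult_strict_right_mono) auto
      then have "real (hi k ?X * 2 ^ (n + 4)) \<le> real (2 ^ e k ?X + lo k ?X * 2 ^ (n + 4))"
        by (simp add: algebra_simps)
      then have "hi k ?X * 2 ^ (n + 4) \<le> 2 ^ e k ?X + lo k ?X * 2 ^ (n + 4)"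
        by (simp only: of_nat_le_iff)
      then have "F (inputs n k (\<phi> k)) \<noteq> 0"
        using kX[OF close[of k n]] by (simp add: F_def)
      with k have "\<exists>k\<ge>1. F (inputs n k (\<phi> k)) \<noteq> 0" by blast
      from search[OF this] obtain k where
        k: "F (inputs n k (\<phi> k)) \<noteq> 0" and
        out: "outputs M \<phi> n (Float (if S (inputs n k (\<phi> k)) = 0 then int (B (inputs n k (\<phi> k)))
           else - int (B (inputs n k (\<phi> k)))) (- int (Suc (E (inputs n k (\<phi> k))))))"
        unfolding Let_def by blast
      define s where "s = inputs n k (\<phi> k)"
      define d where "d = Float (if S s = 0 then int (B s) else - int (B s)) (- int (Suc (E s)))"
      define X where "X = scaled s"
      have s: "s 0 = n" "s 1 = k" by (simp_all add: s_def)
      have cX: "close k X x" using close by (simp add: X_def s_def)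
      have guard: "g k X \<noteq> 0" and "hi k X * 2 ^ (n + 4) \<le> 2 ^ e k X + lo k X * 2 ^ (n + 4)"
        using k unfolding s_def[symmetric] F_def s X_def by (auto split: if_splits)
      then have "real (hi k X * 2 ^ (n + 4)) \<le> real (2 ^ e k X + lo k X * 2 ^ (n + 4))"
        by (simp only: of_nat_le_iff)
      then have width: "real (hi k X) \<le> 2 ^ e k X / 2 ^ (n + 4) + real (lo k X)"
        by (simp add: field_simps)
      have "(if S s = 0 then int (B s) else - int (B s)) = int (P s) - int (Q s)"
        by (auto simp: S_def B_def)
      then have "d = Float (int (P s) - int (Q s)) (- int (Suc (E s)))" by (simp only: d_def)
      then have "real_of_float d = real_of_int (int (P s) - int (Q s)) * 2 powr real_of_int (- int (Suc (E s)))"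
        by simp
      also have "\<dots> = (real (P s) - real (Q s)) / 2 ^ Suc (E s)"
        by (simp only: of_int_minus of_int_of_nat_eq powr_minus of_int_diff powr_realpow zero_less_numeral divide_inverse)
      also have "(real (P s) - real (Q s)) / 2 ^ Suc (E s) = real (lo k X) / 2 ^ e k X - 1 / 2 ^ (n + 1)"
        unfolding P_def Q_def E_def s X_def[symmetric] by (simp add: power_add field_simps)
      finally have d: "real_of_float d = real (lo k X) / 2 ^ e k X - 1 / 2 ^ (n + 1)" .
      have "real (lo k X) / 2 ^ e k X \<le> f x"
        using enclosesD(1)[OF enc[OF x] cX guard] by (simp add: field_simps)
      moreover have "f x * 2 ^ e k X \<le> 2 ^ e k X / 2 ^ (n + 4) + real (lo k X)"
        using enclosesD(2)[OF enc[OF x] cX guard] width by linarith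
      then have "f x \<le> (2 ^ e k X / 2 ^ (n + 4) + real (lo k X)) / 2 ^ e k X"
        by (simp add: pos_le_divide_eq)
      then have "f x \<le> 1 / 2 ^ (n + 4) + real (lo k X) / 2 ^ e k X"
        by (simp add: add_divide_distrib)
      ultimately show ?thesis using out unfolding s_def[symmetric] d_def[symmetric] using d
        by (intro exI[of _ d]) auto
    qed
    then obtain d where d: "\<And>n. outputs M \<phi> n (d n)"
      "\<And>n. 1 / 2 ^ (n + 1) \<le> f x - real_of_float (d n)"
      "\<And>n. f x - real_of_float (d n) \<le> 1 / 2 ^ (n + 1) + 1 / 2 ^ (n + 4)"
      by metis
    have "real_of_float (d n) < real_of_float (d (Suc n))" for n
    proof -
      have "1 / 2 ^ (Suc n + 1) + 1 / 2 ^ (Suc n + 4) < (1 / 2 ^ (n + 1) :: real)"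
        by (simp add: power_add field_simps)
      then show ?thesis using d(2)[of n] d(3)[of "Suc n"] by linarith
    qed
    then have "strict_mono (\<lambda>n. real_of_float (d n))" by (rule strict_mono_Suc_iff[THEN iffD2, OF allI])
    moreover have "\<bar>f x - real_of_float (d n)\<bar> < 1 / 2 ^ n" for n
    proof -
      have "1 / 2 ^ (n + 1) + 1 / 2 ^ (n + 4) < (1 / 2 ^ n :: real)" "(0::real) < 1 / 2 ^ (n + 1)"
        by (simp_all add: power_add field_simps)
      then show ?thesis using d(2,3)[of n] by linarith
    qed
    ultimately show ?thesis using d(1) by blast
  qed
  then show ?thesis using M by blast
qed

lemma computable_on_approximable:
  assumes "approximable_on f A" "A \<subseteq> {0..}"
  shows "computable_on f A"
  using approximable_machine[OF assms] unfolding computable_on_def by meson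

lemma left_computable_on_approximable:
  assumes "approximable_on f A" "A \<subseteq> {0..}"
  shows "left_computable_on f A"
proof -
  have "(\<lambda>n. real_of_float (d n)) \<longlonglongrightarrow> f x" if "\<forall>n. \<bar>f x - real_of_float (d n)\<bar> < 1 / 2 ^ n" for x d
  proof -
    have "(\<lambda>n. (1 / 2) ^ n :: real) \<longlonglongrightarrow> 0" by (intro LIMSEQ_realpow_zero) auto
    then have "(\<lambda>n. real_of_float (d n) - f x) \<longlonglongrightarrow> 0"
      by (rule Lim_null_comparison[rotated])
        (use that in \<open>auto simp: power_divide abs_minus_commute intro!: always_eventually less_imp_le\<close>)
    then show ?thesis by (simp only: LIM_zero_iff)
  qed
  moreover obtain M where "oracle_machine M" "\<And>x \<phi>. x \<in> A \<Longrightarrow> oracle_for \<phi> x \<Longrightarrow>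
    \<exists>d. (\<forall>n. outputs M \<phi> n (d n)) \<and> strict_mono (\<lambda>n. real_of_float (d n)) \<and>
        (\<forall>n. \<bar>f x - real_of_float (d n)\<bar> < 1 / 2 ^ n)"
    using approximable_machine[OF assms] by blast
  ultimately show ?thesis unfolding left_computable_on_def by blast
qed

lemma approximable_on_subset: "approximable_on f A \<Longrightarrow> B \<subseteq> A \<Longrightarrow> approximable_on f B"
  unfolding approximable_on_def by blast

lemma approximable_on_cong: "approximable_on f A \<Longrightarrow> (\<And>x. x \<in> A \<Longrightarrow> f x = h x) \<Longrightarrow> approximable_on h A"
  unfolding approximable_on_def by auto

lemma eventually_less_pow2: "\<forall>\<^sub>F k in sequentially. (C::real) < 2 ^ k"
proof -
  obtain n where "C < 2 ^ n" using real_arch_pow[of 2 C] by auto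
  then have "C < 2 ^ k" if "n \<le> k" for k
    using less_le_trans[OF \<open>C < 2 ^ n\<close> power_increasing[OF that]] by simp
  then show ?thesis by (auto simp: eventually_sequentially)
qed

lemma closeD:
  assumes "close k X x"
  shows "real X - 2 < x * 2 ^ k" "x * 2 ^ k < real X + 2"
  using assms by (auto simp: close_def abs_if split: if_splits)

text \<open>
  For \<open>x > 0\<close> the numbers \<open>X\<close> eventually grow like \<open>2\<^sup>k x\<close>. Bounds with \<open>X - 2\<close> in the denominator,
  such as those for \<open>1/x\<close> and \<open>ln (1/x)\<close>, are then tight.
\<close>

lemma eventually_close_large:
  assumes "0 < x"
  shows "\<forall>\<^sub>F k in sequentially. \<forall>X. close k X x \<longrightarrow> 3 \<le> X \<and> x * 2 ^ k / 2 \<le> real X - 2"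
  using eventually_less_pow2[of "12 / x"]
proof eventually_elim
  case (elim k)
  then have "12 < x * 2 ^ k" using assms by (simp add: field_simps)
  then show ?case using closeD by fastforce
qed

lemma real_div_bounds:
  "real (a div b) \<le> real a / real b" "real a / real b < real (a div b) + 1"
  using floor_divide_of_nat_eq[of a b, where ?'a = real] by linarith+

lemma approximable_inverse: "approximable_on (\<lambda>x. 1 / x) {0<..}"
proof -
  define g where "g = (\<lambda>(k::nat) (X::nat). if 3 \<le> X then 1 else 0 :: nat)"
  define lo where "lo = (\<lambda>k X. 2 ^ k * 2 ^ k div (X + 2) :: nat)"
  define hi where "hi = (\<lambda>k X. Suc (2 ^ k * 2 ^ k div (X - 2)) :: nat)"
  define e where "e = (\<lambda>(k::nat) (X::nat). k)"
  have "encloses g lo hi e x (1 / x)" if "0 < x" for x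
    unfolding encloses_def
  proof (intro conjI allI impI)
    fix k X assume X: "close k X x" "g k X \<noteq> 0"
    then have X3: "3 \<le> X" by (simp add: g_def split: if_splits)
    have "real (lo k X) \<le> 2 ^ k * 2 ^ k / (real X + 2)"
      using real_div_bounds(1)[of "2 ^ k * 2 ^ k" "X + 2"] by (simp add: lo_def add.commute)
    also have "\<dots> \<le> 2 ^ k * 2 ^ k / (x * 2 ^ k)"
      using closeD(2)[OF X(1)] \<open>0 < x\<close> by (intro divide_left_mono) auto
    also have "\<dots> = 1 / x * 2 ^ k" using \<open>0 < x\<close> by simp
    finally show "real (lo k X) \<le> 1 / x * 2 ^ e k X" by (simp add: e_def)
    have "1 / x * 2 ^ k = 2 ^ k * 2 ^ k / (x * 2 ^ k)" using \<open>0 < x\<close> by simp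
    also have "\<dots> \<le> 2 ^ k * 2 ^ k / (real X - 2)"
      using closeD(1)[OF X(1)] \<open>0 < x\<close> X3 by (intro divide_left_mono) auto
    also have "\<dots> \<le> real (hi k X)"
      using real_div_bounds(2)[of "2 ^ k * 2 ^ k" "X - 2"] X3 by (simp add: hi_def)
    finally show "1 / x * 2 ^ e k X \<le> real (hi k X)" by (simp add: e_def)
  next
    fix \<epsilon> :: real assume "0 < \<epsilon>"
    show "\<forall>\<^sub>F k in sequentially. \<forall>X. close k X x \<longrightarrow> g k X \<noteq> 0 \<and> real (hi k X) - real (lo k X) < \<epsilon> * 2 ^ e k X"
      using eventually_close_large[OF \<open>0 < x\<close>] eventually_less_pow2[of "(8 / x\<^sup>2 + 2) / \<epsilon>"]
    proof eventually_elim
      case (elim k)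
      show ?case
      proof (intro allI impI conjI)
        fix X assume X: "close k X x"
        then have X3: "3 \<le> X" and large: "x * 2 ^ k / 2 \<le> real X - 2" using elim(1) by auto
        show "g k X \<noteq> 0" using X3 by (simp add: g_def)
        define N :: real where "N = 2 ^ k"
        have "N > 0" by (simp add: N_def)
        have X2: "0 < real X - 2" using X3 by simp
        have "real (hi k X) - real (lo k X) \<le> N * N / (real X - 2) + 1 - (N * N / (real X + 2) - 1)"
          using real_div_bounds(1)[of "2 ^ k * 2 ^ k" "X - 2"] real_div_bounds(2)[of "2 ^ k * 2 ^ k" "X + 2"] X3
          by (simp add: hi_def lo_def N_def add.commute)
        also have "\<dots> = 4 * N\<^sup>2 / ((real X - 2) * (real X + 2)) + 2"
        proof -
          have "N * N / (real X - 2) - N * N / (real X + 2) =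
              (N * N * (real X + 2) - N * N * (real X - 2)) / ((real X - 2) * (real X + 2))"
            using X2 by (intro diff_frac_eq) auto
          also have "N * N * (real X + 2) - N * N * (real X - 2) = 4 * N\<^sup>2"
            by (simp add: algebra_simps power2_eq_square)
          finally show ?thesis by simp
        qed
        also have "\<dots> \<le> 4 * N\<^sup>2 / ((x * N / 2) * (x * N)) + 2"
        proof -
          have "(x * N / 2) * (x * N) \<le> (real X - 2) * (real X + 2)"
            using large closeD(2)[OF X] X2 \<open>0 < x\<close> \<open>0 < N\<close> unfolding N_def
            by (intro mult_mono) auto
          then show ?thesis using \<open>0 < x\<close> \<open>0 < N\<close> X2
            by (intro add_mono divide_left_mono mult_pos_pos) auto
        qed
        also have "\<dots> = 8 / x\<^sup>2 + 2"
          using \<open>0 < x\<close> \<open>0 < N\<close> by (simp add: field_simps power2_eq_square)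
        also have "\<dots> < \<epsilon> * 2 ^ e k X"
          using elim(2) \<open>0 < \<epsilon>\<close> by (simp add: e_def field_simps)
        finally show "real (hi k X) - real (lo k X) < \<epsilon> * 2 ^ e k X" .
      qed
    qed
  qed
  moreover have "computable2 g" "computable2 lo" "computable2 hi" "computable2 e"
    unfolding computable2_def g_def lo_def hi_def e_def
    by (intro allI impI computable_intros; assumption)+
  ultimately show ?thesis
    unfolding approximable_on_def by (intro exI[of _ g] exI[of _ lo] exI[of _ hi] exI[of _ e]) auto
qed

text \<open>
  The floor of a non-integral number is known once both bounds of a sufficiently tight enclosure have the same
  floor, and the guard tests exactly this.
\<close>

lemma approximable_frac:
  assumes "approximable_on f A" and f: "\<And>x. x \<in> A \<Longrightarrow> 0 \<le> f x \<and> f x \<notin> \<int>"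
  shows "approximable_on (\<lambda>x. frac (f x)) A"
proof -
  obtain g lo hi e where comp: "computable2 g" "computable2 lo" "computable2 hi" "computable2 e"
    and enc: "\<And>x. x \<in> A \<Longrightarrow> encloses g lo hi e x (f x)"
    using assms(1) unfolding approximable_on_def by blast
  define g' where "g' = (\<lambda>k X. if g k X = 0 then 0 else
    if lo k X div 2 ^ e k X = hi k X div 2 ^ e k X then 1 else 0 :: nat)"
  define lo' where "lo' = (\<lambda>k X. lo k X mod 2 ^ e k X)"
  define hi' where "hi' = (\<lambda>k X. hi k X mod 2 ^ e k X)"
  have "encloses g' lo' hi' e x (frac (f x))" if x: "x \<in> A" for x
    unfolding encloses_def
  proof (intro conjI allI impI)
    fix k X assume X: "close k X x" "g' k X \<noteq> 0"
    define E :: nat where "E = 2 ^ e k X"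
    define q where "q = lo k X div E"
    have E: "real E > 0" and E': "2 ^ e k X = real E" by (simp_all add: E_def)
    have g: "g k X \<noteq> 0" and q: "hi k X div E = q"
      using X(2) by (auto simp: g'_def q_def E_def split: if_splits)
    have "real (lo k X) \<le> f x * real E" "f x * real E \<le> real (hi k X)"
      using enclosesD[OF enc[OF x] X(1) g] unfolding E' by auto
    moreover have "lo k X = q * E + lo' k X" unfolding lo'_def q_def E_def by (rule div_mult_mod_eq[symmetric])
    then have "real (lo k X) = real q * real E + real (lo' k X)"
      by (simp only: of_nat_add of_nat_mult)
    moreover have "hi k X = q * E + hi' k X" unfolding hi'_def q[symmetric] E_def by (rule div_mult_mod_eq[symmetric])
    then have "real (hi k X) = real q * real E + real (hi' k X)"
      by (simp only: of_nat_add of_nat_mult)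
    ultimately have b: "real (lo' k X) \<le> (f x - real q) * real E" "(f x - real q) * real E \<le> real (hi' k X)"
      by (simp_all add: algebra_simps)
    have "0 \<le> (f x - real q) * real E" using b(1) by (rule order_trans[rotated]) simp
    then have "real q \<le> f x" using E by (simp add: zero_le_mult_iff)
    moreover have "hi' k X < E" by (simp add: hi'_def E_def)
    then have "(f x - real q) * real E < 1 * real E" using b(2) by linarith
    then have "f x < real q + 1" using E by simp
    ultimately have "\<lfloor>f x\<rfloor> = int q" by (intro floor_unique) simp_all
    then have "frac (f x) = f x - real q"
      by (simp add: frac_def)
    with b show "real (lo' k X) \<le> frac (f x) * 2 ^ e k X" "frac (f x) * 2 ^ e k X \<le> real (hi' k X)"
      unfolding E' by simp_all
  next
    fix \<epsilon> :: real assume "0 < \<epsilon>"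
    \<comment> \<open>An enclosure narrower than the distance of \<open>f x\<close> to the integers contains no integer.\<close>
    define \<delta> where "\<delta> = min \<epsilon> (min (frac (f x)) (1 - frac (f x)))"
    have "0 < \<delta>" using \<open>0 < \<epsilon>\<close> f[OF x] by (simp add: \<delta>_def frac_lt_1 frac_gt_0_iff)
    from encloses_eventually[OF enc[OF x] this]
    show "\<forall>\<^sub>F k in sequentially. \<forall>X. close k X x \<longrightarrow> g' k X \<noteq> 0 \<and> real (hi' k X) - real (lo' k X) < \<epsilon> * 2 ^ e k X"
    proof eventually_elim
      case (elim k)
      show ?case
      proof (intro allI impI)
        fix X assume X: "close k X x"
        define E :: nat where "E = 2 ^ e k X"
        define q where "q = nat \<lfloor>f x\<rfloor>"
        have E: "real E > 0" and E': "2 ^ e k X = real E" by (simp_all add: E_def)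
        have g: "g k X \<noteq> 0" and width: "real (hi k X) - real (lo k X) < \<delta> * real E"
          using elim[rule_format, OF X] unfolding E' by auto
        have b: "real (lo k X) \<le> f x * real E" "f x * real E \<le> real (hi k X)"
          using enclosesD[OF enc[OF x] X g] unfolding E' by auto
        have q: "f x = real q + frac (f x)"
          using f[OF x] by (simp add: q_def frac_def)
        have \<delta>: "\<delta> * real E \<le> frac (f x) * real E" "\<delta> * real E \<le> (1 - frac (f x)) * real E" "\<delta> * real E \<le> \<epsilon> * real E"
          by (intro mult_right_mono; simp add: \<delta>_def)+
        have fE: "f x * real E = real q * real E + frac (f x) * real E"
          by (subst q) (simp add: algebra_simps)
        have "real q * real E < real (lo k X)"
          using b(2) width \<delta>(1) fE by linarith
        then have 1: "q * E \<le> lo k X" by (simp only: of_nat_mult[symmetric] of_nat_less_iff)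
        have "real (hi k X) < real q * real E + real E"
          using b(1) width \<delta>(2) fE by (simp add: algebra_simps)
        then have 2: "hi k X < q * E + E"
          by (simp only: of_nat_mult[symmetric] of_nat_add[symmetric] of_nat_less_iff)
        have 3: "lo k X \<le> hi k X" using b by simp
        have "lo k X div E = q" "hi k X div E = q"
          using 1 2 3 by (auto intro!: div_nat_eqI simp: algebra_simps)
        then have d: "lo k X div 2 ^ e k X = q" "hi k X div 2 ^ e k X = q" unfolding E_def by auto
        have "lo' k X = lo k X - q * E" "hi' k X = hi k X - q * E"
          using minus_div_mult_eq_mod[of "lo k X" E] minus_div_mult_eq_mod[of "hi k X" E] d
          by (simp_all add: lo'_def hi'_def E_def)
        then have "real (hi' k X) - real (lo' k X) = real (hi k X) - real (lo k X)"
          using 1 3 by (simp add: of_nat_diff)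
        then show "g' k X \<noteq> 0 \<and> real (hi' k X) - real (lo' k X) < \<epsilon> * 2 ^ e k X"
          using width \<delta>(3) g d unfolding E' by (simp add: g'_def)
      qed
    qed
  qed
  moreover have "computable2 g'" "computable2 lo'" "computable2 hi'"
    unfolding computable2_def g'_def lo'_def hi'_def
    by (intro allI impI computable_intros comp[THEN computable2D]; assumption)+
  ultimately show ?thesis
    using comp unfolding approximable_on_def by (intro exI[of _ g'] exI[of _ lo'] exI[of _ hi'] exI[of _ e]) auto
qed

lemma approximable_fold:
  assumes "approximable_on f A" and f: "\<And>x. x \<in> A \<Longrightarrow> f x \<le> 1"
  shows "approximable_on (\<lambda>x. min (f x) (1 - f x)) A"
proof -
  obtain g lo hi e where comp: "computable2 g" "computable2 lo" "computable2 hi" "computable2 e"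
    and enc: "\<And>x. x \<in> A \<Longrightarrow> encloses g lo hi e x (f x)"
    using assms(1) unfolding approximable_on_def by blast
  define lo' where "lo' = (\<lambda>k X. min (lo k X) (2 ^ e k X - hi k X))"
  define hi' where "hi' = (\<lambda>k X. min (hi k X) (2 ^ e k X - lo k X))"
  have "encloses g lo' hi' e x (min (f x) (1 - f x))" if x: "x \<in> A" for x
    unfolding encloses_def
  proof (intro conjI allI impI)
    fix k X assume X: "close k X x" "g k X \<noteq> 0"
    define E :: nat where "E = 2 ^ e k X"
    have E': "2 ^ e k X = real E" by (simp add: E_def)
    have b: "real (lo k X) \<le> f x * real E" "f x * real E \<le> real (hi k X)"
      using enclosesD[OF enc[OF x] X] unfolding E' by auto
    have "f x * real E \<le> 1 * real E" using f[OF x] by (intro mult_right_mono) auto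
    then have "real (E - hi k X) \<le> (1 - f x) * real E" "(1 - f x) * real E \<le> real (E - lo k X)"
      using b by (auto simp: of_nat_diff_if algebra_simps)
    moreover have "min (f x) (1 - f x) * real E = min (f x * real E) ((1 - f x) * real E)"
      by (simp add: min_mult_distrib_right)
    ultimately show "real (lo' k X) \<le> min (f x) (1 - f x) * 2 ^ e k X" "min (f x) (1 - f x) * 2 ^ e k X \<le> real (hi' k X)"
      using b unfolding lo'_def hi'_def E' E_def[symmetric] of_nat_min by linarith+
  next
    fix \<epsilon> :: real assume "0 < \<epsilon>"
    from encloses_eventually[OF enc[OF x] this]
    show "\<forall>\<^sub>F k in sequentially. \<forall>X. close k X x \<longrightarrow> g k X \<noteq> 0 \<and> real (hi' k X) - real (lo' k X) < \<epsilon> * 2 ^ e k X"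
    proof eventually_elim
      case (elim k)
      show ?case
      proof (intro allI impI conjI)
        fix X assume X: "close k X x"
        with elim show g: "g k X \<noteq> 0" by blast
        have "lo k X \<le> hi k X" using enclosesD[OF enc[OF x] X g] by linarith
        then have "real (min (hi k X) (E - lo k X)) - real (min (lo k X) (E - hi k X)) \<le> real (hi k X) - real (lo k X)"
          for E by linarith
        then have "real (hi' k X) - real (lo' k X) \<le> real (hi k X) - real (lo k X)"
          unfolding lo'_def hi'_def .
        then show "real (hi' k X) - real (lo' k X) < \<epsilon> * 2 ^ e k X" using elim X by force
      qed
    qed
  qed
  moreover have "computable2 lo'" "computable2 hi'"
    unfolding computable2_def lo'_def hi'_def
    by (intro allI impI computable_intros comp[THEN computable2D]; assumption)+
  ultimately show ?thesis
    using comp unfolding approximable_on_def by (intro exI[of _ g] exI[of _ lo'] exI[of _ hi'] exI[of _ e]) auto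
qed

lemma approximable_power:
  assumes "approximable_on f A" and f: "\<And>x. x \<in> A \<Longrightarrow> 0 \<le> f x"
  shows "approximable_on (\<lambda>x. f x ^ n) A"
proof -
  obtain g lo hi e where comp: "computable2 g" "computable2 lo" "computable2 hi" "computable2 e"
    and enc: "\<And>x. x \<in> A \<Longrightarrow> encloses g lo hi e x (f x)"
    using assms(1) unfolding approximable_on_def by blast
  define lo' where "lo' = (\<lambda>k X. lo k X ^ n)"
  define hi' where "hi' = (\<lambda>k X. hi k X ^ n)"
  define e' where "e' = (\<lambda>k X. e k X * n)"
  have "encloses g lo' hi' e' x (f x ^ n)" if x: "x \<in> A" for x
    unfolding encloses_def
  proof (intro conjI allI impI)
    fix k X assume X: "close k X x" "g k X \<noteq> 0"
    have b: "real (lo k X) \<le> f x * 2 ^ e k X" "f x * 2 ^ e k X \<le> real (hi k X)"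
      using enclosesD[OF enc[OF x] X] by auto
    have "f x ^ n * 2 ^ e' k X = (f x * 2 ^ e k X) ^ n"
      by (simp add: e'_def power_mult_distrib power_mult)
    then show "real (lo' k X) \<le> f x ^ n * 2 ^ e' k X" "f x ^ n * 2 ^ e' k X \<le> real (hi' k X)"
      using b f[OF x] by (auto simp: lo'_def hi'_def intro!: power_mono)
  next
    fix \<epsilon> :: real assume "0 < \<epsilon>"
    have "continuous (at (f x)) (\<lambda>y. y ^ n)" by (intro continuous_intros)
    then obtain \<delta> where \<delta>: "0 < \<delta>" "\<And>y. \<bar>y - f x\<bar> < \<delta> \<Longrightarrow> \<bar>y ^ n - f x ^ n\<bar> < \<epsilon> / 2"
      using \<open>0 < \<epsilon>\<close> unfolding continuous_at_eps_delta dist_real_def by (meson half_gt_zero)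
    from encloses_eventually[OF enc[OF x] \<delta>(1)]
    show "\<forall>\<^sub>F k in sequentially. \<forall>X. close k X x \<longrightarrow> g k X \<noteq> 0 \<and> real (hi' k X) - real (lo' k X) < \<epsilon> * 2 ^ e' k X"
    proof eventually_elim
      case (elim k)
      show ?case
      proof (intro allI impI conjI)
        fix X assume X: "close k X x"
        with elim show g: "g k X \<noteq> 0" by blast
        define E :: real where "E = 2 ^ e k X"
        have E: "0 < E" by (simp add: E_def)
        have "real (hi k X) - real (lo k X) < \<delta> * E" using elim X unfolding E_def by blast
        then have "real (hi k X) / E - real (lo k X) / E < \<delta>"
          using E by (simp add: field_simps)
        moreover have "real (lo k X) / E \<le> f x" "f x \<le> real (hi k X) / E"
          using enclosesD[OF enc[OF x] X g] E unfolding E_def[symmetric] by (simp_all add: field_simps)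
        ultimately have "\<bar>real (hi k X) / E - f x\<bar> < \<delta>" "\<bar>real (lo k X) / E - f x\<bar> < \<delta>" by auto
        from this[THEN \<delta>(2)] have "(real (hi k X) / E) ^ n - (real (lo k X) / E) ^ n < \<epsilon>" by linarith
        then have "real (hi k X) ^ n - real (lo k X) ^ n < \<epsilon> * E ^ n"
          using E by (simp add: power_divide field_simps)
        moreover have "E ^ n = 2 ^ e' k X" by (simp only: E_def e'_def power_mult)
        ultimately show "real (hi' k X) - real (lo' k X) < \<epsilon> * 2 ^ e' k X"
          by (simp add: hi'_def lo'_def)
      qed
    qed
  qed
  moreover have "computable2 lo'" "computable2 hi'" "computable2 e'"
    unfolding computable2_def lo'_def hi'_def e'_def
    by (intro allI impI computable_intros comp[THEN computable2D]; assumption)+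
  ultimately show ?thesis
    using comp unfolding approximable_on_def by (intro exI[of _ g] exI[of _ lo'] exI[of _ hi'] exI[of _ e']) auto
qed

text \<open>
  Telescoping \<open>1 / (i + 1) \<le> ln ((i + 1) / i) \<le> 1 / i\<close>.
\<close>

lemma ln_ratio_harmonic:
  assumes "0 < X"
  shows "ln (real (X + m) / real X) \<le> (\<Sum>i<m. 1 / real (X + i))"
    and "(\<Sum>i<m. 1 / real (X + i)) \<le> ln (real (X + m) / real X) + 1 / real X - 1 / real (X + m)"
proof (induction m)
  case (Suc m)
  define n where "n = real (X + m)"
  have n: "0 < n" "real (X + Suc m) = n + 1" using assms by (simp_all add: n_def)
  have "ln (real (X + Suc m) / real X) = ln (n / real X) + ln (1 + 1 / n)"
    using n assms by (simp add: ln_mult[symmetric] ln_div field_simps)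
  moreover have "ln (1 + 1 / n) \<le> 1 / n" using n by (intro ln_add_one_self_le_self) auto
  moreover have "1 / n - (1 / n - 1 / (n + 1)) \<le> ln (1 + 1 / n)"
  proof -
    have "ln (n / (n + 1)) \<le> n / (n + 1) - 1" using n by (intro ln_le_minus_one) auto
    moreover have "ln (n / (n + 1)) = - ln (1 + 1 / n)"
    proof -
      have "1 + 1 / n = (n + 1) / n" using n by (simp add: field_simps)
      then show ?thesis using n by (simp add: ln_div)
    qed
    moreover have "n / (n + 1) - 1 = - (1 / (n + 1))" using n by (simp add: field_simps)
    ultimately show ?thesis by linarith
  qed
  moreover have "(\<Sum>i<Suc m. 1 / real (X + i)) = (\<Sum>i<m. 1 / real (X + i)) + 1 / n"
    by (simp add: n_def)
  ultimately show "ln (real (X + Suc m) / real X) \<le> (\<Sum>i<Suc m. 1 / real (X + i))"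
    "(\<Sum>i<Suc m. 1 / real (X + i)) \<le> ln (real (X + Suc m) / real X) + 1 / real X - 1 / real (X + Suc m)"
    using Suc.IH unfolding n(2) n_def[symmetric] by linarith+
qed (use assms in simp_all)

lemma ln_close:
  assumes "close k X x" "3 \<le> X" "0 < x"
  shows "\<bar>ln (2 ^ k / real X) - ln (1 / x)\<bar> \<le> 2 / (real X - 2)"
proof -
  define y where "y = x * 2 ^ k"
  have y: "0 < y" "real X - 2 < y" "y < real X + 2"
    using closeD[OF assms(1)] assms(3) by (auto simp: y_def)
  have X: "0 < real X - 2" using assms(2) by simp
  have eq: "ln (2 ^ k / real X) - ln (1 / x) = ln y - ln (real X)"
    using assms X by (simp add: y_def ln_mult ln_div)
  have "ln (y / real X) \<le> y / real X - 1" using y X by (intro ln_le_minus_one) auto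
  also have "\<dots> = (y - real X) / real X" using X by (simp add: diff_divide_distrib)
  also have "\<dots> \<le> 2 / real X" using y X by (intro divide_right_mono) auto
  also have "\<dots> \<le> 2 / (real X - 2)" using X by (simp add: field_simps)
  finally have 1: "ln y - ln (real X) \<le> 2 / (real X - 2)" using y X by (simp add: ln_div)
  have "ln (real X / y) \<le> real X / y - 1" using y X by (intro ln_le_minus_one) auto
  also have "\<dots> = (real X - y) / y" using y by (simp add: diff_divide_distrib)
  also have "\<dots> \<le> 2 / y" using y X by (intro divide_right_mono) auto
  also have "\<dots> \<le> 2 / (real X - 2)" using y X by (simp add: frac_le)
  finally have 2: "ln (real X) - ln y \<le> 2 / (real X - 2)" using y X by (simp add: ln_div)
  show ?thesis unfolding eq using 1 2 by linarith
qed

text \<open>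
  With \<open>N = 2\<^sup>k\<close> this is \<open>N\<^sup>2\<close> times the harmonic sum from \<open>X\<close> to \<open>N - 1\<close>, each term rounded down. The factor \<open>N\<^sup>2\<close>
  keeps the total rounding error, at most one unit for each of at most \<open>N\<close> terms, below \<open>1/N\<close> after division.
\<close>

definition harmonic_floor :: "nat \<Rightarrow> nat \<Rightarrow> nat" where
  "harmonic_floor k X = (\<Sum>i<2 ^ k - X. 2 ^ k * 2 ^ k div (X + i))"

text \<open>
  Three errors add up: replacing \<open>2\<^sup>k x\<close> by \<open>X\<close> costs \<open>2 / (X - 2)\<close>, and the harmonic sum and the rounding
  at most \<open>1 / (X - 2)\<close> each. If \<open>X\<close> exceeds \<open>2\<^sup>k\<close> the sum is empty, and \<open>x\<close> is so close to \<open>1\<close> that \<open>0\<close> is a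
  good approximation of \<open>ln (1/x)\<close>.
\<close>

lemma harmonic_floor_error:
  assumes "close k X x" "3 \<le> X" "0 < x" "x < 1"
  shows "\<bar>real (harmonic_floor k X) / (2 ^ k * 2 ^ k) - ln (1 / x)\<bar> \<le> 4 / (real X - 2)"
proof (cases "X \<le> 2 ^ k")
  case True
  define m where "m = 2 ^ k - X"
  define N :: real where "N = 2 ^ k"
  define H where "H = (\<Sum>i<m. 1 / real (X + i))"
  have m: "real (X + m) = N"
  proof -
    have "X + m = 2 ^ k" using True by (simp add: m_def)
    then show ?thesis by (simp add: N_def)
  qed
  have X: "0 < real X - 2" "0 < X" "real X \<le> N" using assms(2) m by auto
  then have X: "0 < real X - 2" "0 < X" "real X \<le> N" "0 < N" by auto
  have "real (harmonic_floor k X) \<le> (\<Sum>i<m. N * N / real (X + i))"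
    unfolding harmonic_floor_def m_def[symmetric] of_nat_sum
  proof (rule sum_mono)
    show "real (2 ^ k * 2 ^ k div (X + i)) \<le> N * N / real (X + i)" for i
      using real_div_bounds(1)[of "2 ^ k * 2 ^ k" "X + i"] by (simp add: N_def)
  qed
  also have "\<dots> = N * N * H" by (simp add: H_def sum_distrib_left)
  finally have up: "real (harmonic_floor k X) / (N * N) \<le> H" using X by (simp add: field_simps)
  have "N * N * H = (\<Sum>i<m. N * N / real (X + i))" by (simp add: H_def sum_distrib_left)
  also have "\<dots> \<le> (\<Sum>i<m. real (2 ^ k * 2 ^ k div (X + i)) + 1)"
  proof (rule sum_mono)
    show "N * N / real (X + i) \<le> real (2 ^ k * 2 ^ k div (X + i)) + 1" for i
      using real_div_bounds(2)[of "2 ^ k * 2 ^ k" "X + i"] by (simp add: N_def)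
  qed
  also have "\<dots> = real (harmonic_floor k X) + real m"
    by (simp add: harmonic_floor_def m_def sum.distrib)
  also have "real m \<le> N" using m by simp
  finally have "N * N * H \<le> real (harmonic_floor k X) + N" by simp
  then have "N * N * H / (N * N) \<le> (real (harmonic_floor k X) + N) / (N * N)"
    using X by (intro divide_right_mono) auto
  then have lo: "H - 1 / N \<le> real (harmonic_floor k X) / (N * N)"
    using X by (simp add: add_divide_distrib)
  have "H \<le> ln (N / real X) + 1 / real X" "ln (N / real X) \<le> H"
    using ln_ratio_harmonic[OF X(2), of m] X(4) unfolding m H_def[symmetric]
    by (auto intro: order_trans)
  moreover have "\<bar>ln (N / real X) - ln (1 / x)\<bar> \<le> 2 / (real X - 2)"
    unfolding N_def by (rule ln_close[OF assms(1-3)])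
  moreover have "1 / real X \<le> 1 / (real X - 2)" "1 / N \<le> 1 / (real X - 2)"
    using X by (auto intro!: divide_left_mono)
  moreover have "4 / (real X - 2) = 2 / (real X - 2) + 1 / (real X - 2) + 1 / (real X - 2)"
    by (simp add: add_divide_distrib[symmetric])
  ultimately show ?thesis using up lo X(1) unfolding N_def[symmetric] abs_le_iff by linarith
next
  case False
  then have "harmonic_floor k X = 0" by (simp add: harmonic_floor_def)
  moreover have "0 \<le> ln (1 / x)" using assms by simp
  moreover have "(2::real) ^ k < real X"
    using False by (metis not_le of_nat_less_iff of_nat_numeral of_nat_power)
  then have "ln (2 ^ k / real X) \<le> 0" using assms(2) by (intro ln_le_zero_iff[THEN iffD2]) auto
  moreover have "\<bar>ln (2 ^ k / real X) - ln (1 / x)\<bar> \<le> 2 / (real X - 2)" by (rule ln_close[OF assms(1-3)])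
  moreover have "2 / (real X - 2) \<le> 4 / (real X - 2)" using assms(2) by (intro divide_right_mono) auto
  ultimately show ?thesis by simp
qed

lemma approximable_ln: "approximable_on (\<lambda>x. ln (1 / x)) {0<..<1}"
proof -
  define g where "g = (\<lambda>(k::nat) (X::nat). if 3 \<le> X then 1 else 0 :: nat)"
  define w where "w = (\<lambda>k X. Suc (4 * (2 ^ k * 2 ^ k) div (X - 2)) :: nat)"
  define lo where "lo = (\<lambda>k X. harmonic_floor k X - w k X)"
  define hi where "hi = (\<lambda>k X. harmonic_floor k X + w k X)"
  define e where "e = (\<lambda>k (X::nat). k + k :: nat)"
  have "encloses g lo hi e x (ln (1 / x))" if x: "0 < x" "x < 1" for x
    unfolding encloses_def
  proof (intro conjI allI impI)
    fix k X assume X: "close k X x" "g k X \<noteq> 0"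
    then have X3: "3 \<le> X" by (simp add: g_def split: if_splits)
    define N :: real where "N = 2 ^ k * 2 ^ k"
    have N: "0 < N" by (simp add: N_def)
    have "\<bar>real (harmonic_floor k X) / N - ln (1 / x)\<bar> * N \<le> 4 / (real X - 2) * N"
      using harmonic_floor_error[OF X(1) X3 x] N unfolding N_def[symmetric] by (intro mult_right_mono) auto
    also have "4 / (real X - 2) * N \<le> real (w k X)"
      using real_div_bounds(2)[of "4 * (2 ^ k * 2 ^ k)" "X - 2"] X3 by (simp add: w_def N_def)
    also have "\<bar>real (harmonic_floor k X) / N - ln (1 / x)\<bar> * N = \<bar>real (harmonic_floor k X) - ln (1 / x) * N\<bar>"
      using N by (simp add: abs_mult_pos left_diff_distrib)
    finally have "\<bar>real (harmonic_floor k X) - ln (1 / x) * N\<bar> \<le> real (w k X)" .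
    moreover have "0 \<le> ln (1 / x) * N" using x N by simp
    moreover have "2 ^ e k X = N" by (simp add: e_def N_def power_add)
    ultimately show "real (lo k X) \<le> ln (1 / x) * 2 ^ e k X" "ln (1 / x) * 2 ^ e k X \<le> real (hi k X)"
      by (auto simp: lo_def hi_def of_nat_diff_if)
  next
    fix \<epsilon> :: real assume "0 < \<epsilon>"
    show "\<forall>\<^sub>F k in sequentially. \<forall>X. close k X x \<longrightarrow> g k X \<noteq> 0 \<and> real (hi k X) - real (lo k X) < \<epsilon> * 2 ^ e k X"
      using eventually_close_large[OF \<open>0 < x\<close>] eventually_less_pow2[of "(16 / x + 2) / \<epsilon>"]
    proof eventually_elim
      case (elim k)
      show ?case
      proof (intro allI impI conjI)
        fix X assume X: "close k X x"
        then have X3: "3 \<le> X" and large: "x * 2 ^ k / 2 \<le> real X - 2" using elim(1) by auto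
        show "g k X \<noteq> 0" using X3 by (simp add: g_def)
        define N :: real where "N = 2 ^ k"
        have N: "1 \<le> N" by (simp add: N_def)
        have X2: "0 < real X - 2" using X3 by simp
        have "real (hi k X) - real (lo k X) \<le> 2 * real (w k X)" by (simp add: hi_def lo_def of_nat_diff_if)
        also have "\<dots> \<le> 2 * (4 * (N * N) / (real X - 2) + 1)"
          using real_div_bounds(1)[of "4 * (2 ^ k * 2 ^ k)" "X - 2"] X3 by (simp add: w_def N_def)
        also have "\<dots> \<le> 2 * (4 * (N * N) / (x * N / 2) + 1)"
          using large N x X2 unfolding N_def[symmetric]
          by (intro mult_left_mono add_right_mono divide_left_mono mult_pos_pos) auto
        also have "\<dots> = (16 / x) * N + 2 * 1" using N x by (simp add: field_simps)
        also have "\<dots> \<le> (16 / x) * N + 2 * N" using N by simp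
        also have "\<dots> = (16 / x + 2) * N" by (simp add: algebra_simps)
        also have "\<dots> < (\<epsilon> * N) * N"
          using elim(2) \<open>0 < \<epsilon>\<close> N by (intro mult_strict_right_mono) (simp_all add: N_def field_simps)
        also have "\<dots> = \<epsilon> * 2 ^ e k X" by (simp add: e_def N_def power_add)
        finally show "real (hi k X) - real (lo k X) < \<epsilon> * 2 ^ e k X" .
      qed
    qed
  qed
  moreover have H: "reg_computable m (\<lambda>s. harmonic_floor (a s) (b s))"
    if ab: "reg_computable m a" "reg_computable m b" for m a b
    unfolding harmonic_floor_def
  proof (rule reg_computable_sum)
    show "reg_computable m (\<lambda>s. 2 ^ a s - b s)" by (intro computable_intros ab)
    fix e i assume "m \<le> e" "reg_computable e i"
    moreover have "reg_computable e a" "reg_computable e b"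
      using ab \<open>m \<le> e\<close> by (auto intro: reg_computable_mono)
    ultimately show "reg_computable e (\<lambda>s. 2 ^ a s * 2 ^ a s div (b s + i s))"
      by (intro computable_intros)
  qed
  have "computable2 g" "computable2 lo" "computable2 hi" "computable2 e"
    unfolding computable2_def g_def lo_def hi_def e_def w_def
    by (intro allI impI computable_intros H; assumption)+
  ultimately show ?thesis
    unfolding approximable_on_def by (intro exI[of _ g] exI[of _ lo] exI[of _ hi] exI[of _ e]) auto
qed

section \<open>Maps whose branches are affine in the coordinate 1/x\<close>

text \<open>
  Branch \<open>i\<close> is the set where \<open>1/x\<close> lies in \<open>(a i, b i)\<close>; the predicate \<open>up\<close> singles out the branches on which
  \<open>G\<close> increases.
\<close>

locale reciprocal_branches =
  fixes M :: nat and a b :: "nat \<Rightarrow> real" and up :: "nat \<Rightarrow> bool" and l r :: "nat \<Rightarrow> real" and G :: "real \<Rightarrow> real"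
  assumes M: "1 \<le> M" and a1: "a 1 = M"
    and ab: "\<And>i. 1 \<le> i \<Longrightarrow> b i = a i + 1 / M"
    and sep: "\<And>i. 1 \<le> i \<Longrightarrow> b i \<le> a (Suc i)"
    and gap: "\<And>i. 1 \<le> i \<Longrightarrow> a (Suc i) \<le> a i + 1"
    and l: "\<And>i. 1 \<le> i \<Longrightarrow> l i = 1 / b i" and r: "\<And>i. 1 \<le> i \<Longrightarrow> r i = 1 / a i"
    and G: "\<And>i x. 1 \<le> i \<Longrightarrow> x \<in> branch l r i \<Longrightarrow> G x = (if up i then b i - 1 / x else 1 / x - a i)"
    and up1: "\<not> up 1"
begin

lemma first_branch [simp]: "a (Suc 0) = M" "\<not> up (Suc 0)"
  using a1 up1 by simp_all

lemma M_pos: "0 < 1 / real M" "1 / real M \<le> 1"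
  using M by auto

lemma a_ge_M: "1 \<le> i \<Longrightarrow> real M \<le> a i"
proof (induction i rule: nat_induct_at_least)
  case base
  then show ?case using a1 by simp
next
  case (Suc i)
  then show ?case using sep[of i] ab[of i] M_pos by linarith
qed

lemma a_ge_1: "1 \<le> i \<Longrightarrow> 1 \<le> a i"
  using a_ge_M[of i] M by simp

lemma a_lower: "1 \<le> i \<Longrightarrow> real i / real M \<le> a i"
proof (induction i rule: nat_induct_at_least)
  case base
  have "1 / real M \<le> real M" using M_pos M by linarith
  then show ?case using a1 by simp
next
  case (Suc i)
  then show ?case using sep[of i] ab[of i] by (simp add: add_divide_distrib)
qed

lemma a_less_b: "1 \<le> i \<Longrightarrow> a i < b i"
  using ab M_pos by simp

lemma b_le: "1 \<le> i \<Longrightarrow> b i \<le> 2 * a i"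
  using ab[of i] a_ge_1[of i] M_pos by linarith

lemma b_le_a:
  assumes "1 \<le> i" "i < j"
  shows "b i \<le> a j"
proof -
  have "Suc i \<le> j" using assms by simp
  then show ?thesis
  proof (induction j rule: nat_induct_at_least)
    case base
    then show ?case using sep assms by simp
  next
    case (Suc n)
    then show ?case using sep[of n] a_less_b[of n] by simp
  qed
qed

lemma mem_branch: "1 \<le> i \<Longrightarrow> x \<in> branch l r i \<longleftrightarrow> 0 < x \<and> a i < 1 / x \<and> 1 / x < b i"
proof -
  assume i: "1 \<le> i"
  then have "0 < a i" "0 < b i" using a_ge_1[of i] a_less_b[of i] by linarith+
  then have "1 / b i < x \<Longrightarrow> 0 < x" for x by (meson less_trans zero_less_divide_1_iff)
  then show ?thesis
    using \<open>0 < a i\<close> \<open>0 < b i\<close> unfolding branch_def l[OF i] r[OF i]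
    by (auto simp: field_simps)
qed

lemma branchesE:
  assumes "x \<in> branches l r"
  obtains i where "1 \<le> i" "x \<in> branch l r i"
  using assms by (auto simp: branches_def)

lemma branchesI: "1 \<le> i \<Longrightarrow> x \<in> branch l r i \<Longrightarrow> x \<in> branches l r"
  by (auto simp: branches_def)

lemma branches_bounds:
  assumes "x \<in> branches l r"
  shows "0 < x" "x < 1 / M" "x < 1"
proof -
  obtain i where i: "1 \<le> i" "x \<in> branch l r i" using assms by (rule branchesE)
  then have x: "0 < x" "real M < 1 / x" using mem_branch[of i x] a_ge_M[of i] by auto
  then show "0 < x" "x < 1 / M" using M by (auto simp: field_simps)
  with M_pos show "x < 1" by linarith
qed

lemma disjoint: "disjoint_family_on (branch l r) {1..}"
proof -
  have "branch l r i \<inter> branch l r j = {}" if "1 \<le> i" "i < j" for i j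
    using that b_le_a[OF that] mem_branch[of i] mem_branch[of j] by fastforce
  then show ?thesis unfolding disjoint_family_on_def by (metis Int_commute atLeast_iff nat_neq_iff)
qed

lemma interval_system: "interval_system l r"
  unfolding interval_system_def
proof (intro conjI allI impI disjoint)
  fix i :: nat assume i: "1 \<le> i"
  have "0 < a i" "a i < b i" "b i < b (Suc i)" "0 < b i"
    using i a_ge_1[of i] a_less_b[of i] a_less_b[of "Suc i"] sep[of i] by auto
  then show "l i < r i" "l (Suc i) < l i" using i by (auto simp: l r frac_less2)
next
  show "branches l r \<subseteq> {0<..<1}" using branches_bounds by auto
qed

definition preimage :: "nat \<Rightarrow> real \<Rightarrow> real" where
  "preimage i y = 1 / (if up i then b i - y else a i + y)"

lemma preimage:
  assumes "1 \<le> i" "y \<in> {0<..<1 / real M}"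
  shows "preimage i y \<in> branch l r i" "G (preimage i y) = y"
proof -
  let ?d = "if up i then b i - y else a i + y"
  have d: "a i < ?d" "?d < b i" using assms ab[OF assms(1)] by auto
  then have "0 < ?d" using a_ge_1[OF assms(1)] by linarith
  then show mem: "preimage i y \<in> branch l r i"
    using d unfolding mem_branch[OF assms(1)] preimage_def by simp
  show "G (preimage i y) = y" using G[OF assms(1) mem] by (simp add: preimage_def)
qed

lemma G_range: "1 \<le> i \<Longrightarrow> x \<in> branch l r i \<Longrightarrow> G x \<in> {0<..<1 / real M}"
  using mem_branch[of i x] G[of i x] ab[of i] by auto

lemma preimage_G: "1 \<le> i \<Longrightarrow> x \<in> branch l r i \<Longrightarrow> preimage i (G x) = x"
  using G[of i x] by (auto simp: preimage_def)

lemma branch_inv_eq: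
  assumes "1 \<le> i" "y \<in> {0<..<1 / real M}"
  shows "branch_inv l r G i y = preimage i y"
  unfolding branch_inv_def
proof (rule the_inv_into_f_eq)
  show "inj_on G (branch l r i)" by (rule inj_on_inverseI[where g = "preimage i"]) (rule preimage_G[OF assms(1)])
qed (use preimage[OF assms] in auto)

lemma s1_eq: "s1 l r = 1 / M"
  unfolding s1_def
proof (rule antisym)
  have ne: "branch l r 1 \<noteq> {}" "branch l r 1 \<subseteq> branches l r"
    using interval_system by (auto simp: interval_system_def branch_def branches_def)
  then show "Sup (branches l r) \<le> 1 / M"
    by (intro cSup_least) (auto dest: branches_bounds)
  have "Sup (branch l r 1) = r 1"
    using interval_system unfolding branch_def interval_system_def by (intro cSup_greaterThanLessThan) auto
  moreover have "bdd_above (branches l r)"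
    by (rule bdd_aboveI[of _ 1]) (rule less_imp_le, rule branches_bounds(3))
  then have "Sup (branch l r 1) \<le> Sup (branches l r)"
    by (rule cSup_subset_mono[OF ne(1) _ ne(2)])
  ultimately show "1 / M \<le> Sup (branches l r)" by (simp add: r a1)
qed

lemma s0_eq: "s0 l r = 0"
  unfolding s0_def
proof (rule antisym)
  have mid: "preimage i (1 / (2 * real M)) \<in> branch l r i" if "1 \<le> i" for i
    using that M by (intro preimage) (auto simp: field_simps)
  show "Inf (branches l r) \<le> 0"
  proof (rule field_le_epsilon)
    fix \<epsilon> :: real assume "0 < \<epsilon>"
    obtain n :: nat where n: "real M / \<epsilon> < real n" using reals_Archimedean2 by blast
    then have "1 \<le> n" using M \<open>0 < \<epsilon>\<close> by (cases n) (auto simp: field_simps)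
    let ?x = "preimage n (1 / (2 * real M))"
    have x: "?x \<in> branches l r" using mid[OF \<open>1 \<le> n\<close>] \<open>1 \<le> n\<close> by (rule branchesI[rotated])
    have "1 / \<epsilon> < real n / real M" using n M \<open>0 < \<epsilon>\<close> by (simp add: field_simps)
    also have "\<dots> < 1 / ?x" using a_lower[OF \<open>1 \<le> n\<close>] mid[OF \<open>1 \<le> n\<close>] mem_branch[OF \<open>1 \<le> n\<close>] by force
    finally have "?x < \<epsilon>" using \<open>0 < \<epsilon>\<close> branches_bounds(1)[OF x] by (simp add: field_simps)
    moreover have "bdd_below (branches l r)"
      by (rule bdd_belowI[of _ 0]) (rule less_imp_le, rule branches_bounds(1))
    then have "Inf (branches l r) \<le> ?x"
      by (rule cInf_lower[OF x])
    ultimately show "Inf (branches l r) \<le> 0 + \<epsilon>" by simp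
  qed
  show "0 \<le> Inf (branches l r)"
    using branchesI[OF _ mid[of 1]] branches_bounds(1) by (intro cInf_greatest) (auto intro: less_imp_le)
qed

lemma G1: "G1 l r G"
  unfolding G1_def s0_eq s1_eq
proof (intro allI impI subset_antisym subsetI)
  fix i :: nat and y :: real assume i: "1 \<le> i" and y: "y \<in> {0<..<1 / real M}"
  show "y \<in> G ` branch l r i" using preimage[OF i y] by (metis image_eqI)
qed (use G_range in auto)

lemma G_deriv:
  assumes "1 \<le> i" "x \<in> branch l r i"
  shows "(G has_real_derivative (if up i then 1 / x\<^sup>2 else - (1 / x\<^sup>2))) (at x)"
proof -
  have "x \<noteq> 0" using assms mem_branch by auto
  then have "((\<lambda>x. if up i then b i - 1 / x else 1 / x - a i) has_real_derivative
      (if up i then 1 / x\<^sup>2 else - (1 / x\<^sup>2))) (at x)"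
    by (cases "up i") (auto intro!: derivative_eq_intros simp: power2_eq_square)
  then show ?thesis
    by (rule has_field_derivative_transform_within_open[of _ _ _ "branch l r i"])
      (use assms G in \<open>auto simp: branch_def\<close>)
qed

lemma G_deriv':
  assumes "x \<in> branches l r"
  shows "(G has_real_derivative deriv G x) (at x)" "\<bar>deriv G x\<bar> = (1 / x)\<^sup>2"
proof -
  obtain i where i: "1 \<le> i" "x \<in> branch l r i" using assms by (rule branchesE)
  then show "(G has_real_derivative deriv G x) (at x)" using G_deriv[OF i] DERIV_imp_deriv by metis
  show "\<bar>deriv G x\<bar> = (1 / x)\<^sup>2"
    using DERIV_imp_deriv[OF G_deriv[OF i]] by (simp add: power_divide)
qed

lemma C1: "C1_on (branches l r) G"
  unfolding C1_on_def
proof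
  show "\<forall>x\<in>branches l r. G differentiable at x"
    using G_deriv'(1) real_differentiable_def by blast
  have "continuous_on (branch l r i) (deriv G)" if "i \<in> {1..}" for i
  proof -
    have i: "1 \<le> i" using that by simp
    have "continuous_on (branch l r i) (\<lambda>x. if up i then 1 / x\<^sup>2 else - (1 / x\<^sup>2))"
      by (cases "up i") (auto intro!: continuous_intros simp: mem_branch[OF i])
    then show ?thesis
      by (rule continuous_on_eq) (simp add: DERIV_imp_deriv[OF G_deriv[OF i]])
  qed
  then show "continuous_on (branches l r) (deriv G)"
    unfolding branches_def by (intro continuous_on_open_UN) (auto simp: branch_def)
qed

lemma G3: "G3 l r G"
  unfolding G3_def monotone_on_def
proof (intro ballI impI)
  fix x y assume "x \<in> branch l r 1" "y \<in> branch l r 1" "x < y"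
  moreover from this have "0 < x" using mem_branch[of 1 x] by simp
  ultimately show "G y < G x" using G[of 1 x] G[of 1 y] up1 by (simp add: frac_less2)
qed

definition \<phi> :: real where "\<phi> = (sqrt ((real M)\<^sup>2 + 4) - real M) / 2"

lemma \<phi>_eq: "\<phi> * (real M + \<phi>) = 1"
proof -
  have "(sqrt ((real M)\<^sup>2 + 4) - real M) * (sqrt ((real M)\<^sup>2 + 4) + real M) = (sqrt ((real M)\<^sup>2 + 4))\<^sup>2 - (real M)\<^sup>2"
    by (simp add: algebra_simps power2_eq_square)
  also have "\<dots> = 4" by simp
  finally show ?thesis by (simp add: \<phi>_def field_simps)
qed

lemma \<phi>_bounds: "\<phi> \<in> {0<..<1 / real M}"
proof -
  have "real M < sqrt ((real M)\<^sup>2 + 4)" by (rule real_less_rsqrt) simp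
  then have "0 < \<phi>" by (simp add: \<phi>_def)
  moreover from this have "\<phi> * real M < 1"
    using \<phi>_eq mult_pos_pos[of \<phi> \<phi>] unfolding distrib_left by linarith
  ultimately show ?thesis using M by (simp add: field_simps)
qed

lemma fixpoint:
  shows "\<phi> \<in> branch l r 1" "G \<phi> = \<phi>" "first_fixpoint l r G = \<phi>"
proof -
  have "preimage 1 \<phi> = \<phi>" using \<phi>_eq \<phi>_bounds up1 a1 by (simp add: preimage_def field_simps)
  then show mem: "\<phi> \<in> branch l r 1" and eq: "G \<phi> = \<phi>" using preimage[of 1 \<phi>] \<phi>_bounds by auto
  show "first_fixpoint l r G = \<phi>"
    unfolding first_fixpoint_def
  proof (rule the_equality)
    fix x assume x: "x \<in> branch l r 1 \<and> G x = x"
    show "x = \<phi>"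
    proof (rule ccontr)
      assume "x \<noteq> \<phi>"
      then consider "x < \<phi>" | "\<phi> < x" by linarith
      then show False using G3 x mem eq unfolding G3_def monotone_on_def by cases force+
    qed
  qed (use mem eq in simp)
qed

text \<open>
  For \<open>x \<le> 1/2\<close> this holds because \<open>G\<close> is below \<open>1\<close>. A point above \<open>1/2\<close> exists only if \<open>M = 1\<close>, and it lies in
  the first branch, where \<open>x G(x) = 1 - x\<close>.
\<close>

lemma contraction:
  assumes "x \<in> branches l r"
  shows "x * G x < 1 / 2"
proof (cases "x \<le> 1 / 2")
  case True
  obtain i where "1 \<le> i" "x \<in> branch l r i" using assms by (rule branchesE)
  then have "G x < 1 / real M" using G_range[of i x] by simp
  then have "G x < 1" using M_pos by linarith
  then have "x * G x < x * 1" using branches_bounds(1)[OF assms] by (intro mult_strict_left_mono)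
  then show ?thesis using True by simp
next
  case False
  obtain i where i: "1 \<le> i" "x \<in> branch l r i" using assms by (rule branchesE)
  have x: "0 < x" "1 / x < 2" using False by (auto simp: field_simps)
  have M1: "M = 1" using a_ge_M[OF i(1)] mem_branch[OF i(1)] i(2) x M by fastforce
  have "i = 1"
  proof (rule ccontr)
    assume "i \<noteq> 1"
    then have "b 1 \<le> a i" using i by (intro b_le_a) auto
    then show False using ab[of 1] a1 M1 mem_branch[OF i(1)] i(2) x by auto
  qed
  then have "G x = 1 / x - 1" using G[OF i] up1 a1 M1 by simp
  then have "x * G x = 1 - x" using x by (simp add: field_simps)
  then show ?thesis using False by simp
qed

text \<open>
  A lower bound for all derivatives bounds their infimum only if the set is nonempty; the preimage
  of the fixed point in branch \<open>i\<close> has an infinite orbit inside the branches.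
\<close>

lemma min_expansion_greater:
  assumes i: "1 \<le> i" and k: "k \<le> 3"
    and bound: "\<And>x. x \<in> branch l r i \<Longrightarrow> x \<in> iterate_domain (branches l r) G k \<Longrightarrow> c \<le> \<bar>deriv (G ^^ k) x\<bar>"
  shows "c \<le> min_expansion l r G i k"
  unfolding min_expansion_def
proof (rule cINF_greatest)
  let ?x = "preimage i \<phi>"
  have x: "?x \<in> branch l r i" "G ?x = \<phi>" using preimage[OF i \<phi>_bounds] by auto
  have "(G ^^ j) \<phi> = \<phi>" for j by (induction j) (auto simp: fixpoint)
  then have "(G ^^ Suc j) ?x = \<phi>" for j by (simp add: funpow_Suc_right x del: funpow.simps)
  then have "(G ^^ j) ?x \<in> branches l r" for j
    using x(1) i fixpoint(1) by (cases j) (auto intro: branchesI simp del: funpow.simps(2))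
  then show "branch l r i \<inter> iterate_domain (branches l r) G k \<noteq> {}"
    using x(1) by (auto simp: iterate_domain_def)
qed (use bound in auto)

lemma branch_deriv_bound:
  assumes "1 \<le> i" "x \<in> branch l r i"
  shows "(a i)\<^sup>2 \<le> \<bar>deriv G x\<bar>"
  using G_deriv'(2)[OF branchesI[OF assms]] mem_branch[OF assms(1)] assms(2) a_ge_1[OF assms(1)]
  by (auto intro!: power_mono)

text \<open>
  On branch \<open>i\<close> the derivative is at least \<open>(a i)\<^sup>2\<close>, and that of the third iterate at least \<open>4 (a i)\<^sup>2\<close> by
  \<open>contraction\<close>. As \<open>b i \<le> 2 (a i)\<^sup>2\<close>, the constants \<open>\<sigma> = 3\<close>, \<open>\<tau> = 3/2\<close> and \<open>\<kappa> = 3\<close> suffice.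
\<close>

lemma G2: "G2 l r G"
  unfolding G2_def
proof
  show "\<forall>x\<in>branches l r. 1 < \<bar>deriv G x\<bar>"
  proof
    fix x assume x: "x \<in> branches l r"
    then have "1 < 1 / x" using branches_bounds[OF x] by simp
    then show "1 < \<bar>deriv G x\<bar>" unfolding G_deriv'(2)[OF x] by (simp add: one_less_power)
  qed
  have "1 / min_expansion l r G i 1 < l i * 3 \<and> 1 / min_expansion l r G i 3 < l i / (3 / 2)" if i: "1 \<le> i" for i
  proof -
    have "(a i)\<^sup>2 \<le> min_expansion l r G i 1"
      by (rule min_expansion_greater[OF i]) (auto simp: branch_deriv_bound[OF i])
    moreover have "4 * (a i)\<^sup>2 \<le> min_expansion l r G i 3"
    proof (rule min_expansion_greater[OF i])
      fix x assume x: "x \<in> branch l r i" "x \<in> iterate_domain (branches l r) G 3"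
      have orbit: "(G ^^ j) x \<in> branches l r" if "j < 3" for j
        using x(2) that by (simp add: iterate_domain_def)
      have S: "x \<in> branches l r" "G x \<in> branches l r" "G (G x) \<in> branches l r"
        using orbit[of 0] orbit[of 1] orbit[of 2] by (simp_all add: numeral_2_eq_2)
      have "(G ^^ 3) = (\<lambda>x. G (G (G x)))" by (simp add: numeral_3_eq_3 fun_eq_iff)
      then have "((G ^^ 3) has_real_derivative deriv G (G (G x)) * (deriv G (G x) * deriv G x)) (at x)"
        using DERIV_chain2[OF G_deriv'(1)[OF S(3)] DERIV_chain2[OF G_deriv'(1)[OF S(2)] G_deriv'(1)[OF S(1)]]]
        by simp
      then have "\<bar>deriv (G ^^ 3) x\<bar> = \<bar>deriv G (G (G x))\<bar> * \<bar>deriv G (G x)\<bar> * \<bar>deriv G x\<bar>"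
        by (simp add: DERIV_imp_deriv abs_mult)
      also have "\<dots> = (1 / (G x * G (G x)))\<^sup>2 * \<bar>deriv G x\<bar>"
        unfolding G_deriv'(2)[OF S(2)] G_deriv'(2)[OF S(3)] by (simp add: power_divide power_mult_distrib)
      finally have D: "\<bar>deriv (G ^^ 3) x\<bar> = (1 / (G x * G (G x)))\<^sup>2 * \<bar>deriv G x\<bar>" .
      have "0 < G x * G (G x)" using branches_bounds(1) S by simp
      then have "2 \<le> 1 / (G x * G (G x))" using contraction[OF S(2)] by (simp add: field_simps)
      then have "2\<^sup>2 \<le> (1 / (G x * G (G x)))\<^sup>2" by (intro power_mono) auto
      then have "2\<^sup>2 * (a i)\<^sup>2 \<le> (1 / (G x * G (G x)))\<^sup>2 * \<bar>deriv G x\<bar>"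
        using branch_deriv_bound[OF i x(1)] by (intro mult_mono) auto
      then show "4 * (a i)\<^sup>2 \<le> \<bar>deriv (G ^^ 3) x\<bar>" unfolding D by simp
    qed simp
    moreover have A: "1 \<le> a i" by (rule a_ge_1[OF i])
    then have A2: "a i \<le> (a i)\<^sup>2" by (simp add: power2_eq_square)
    then have "0 < (a i)\<^sup>2" "0 < b i" using A a_less_b[OF i] by linarith+
    ultimately have "1 / min_expansion l r G i 1 \<le> 1 / (a i)\<^sup>2" "1 / min_expansion l r G i 3 \<le> 1 / (4 * (a i)\<^sup>2)"
      by (auto intro!: frac_le)
    moreover have "1 / (a i)\<^sup>2 < 3 / b i" "1 / (4 * (a i)\<^sup>2) < 1 / (b i * (3 / 2))"
      using b_le[OF i] A A2 \<open>0 < (a i)\<^sup>2\<close> \<open>0 < b i\<close> by (auto simp: field_simps)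
    ultimately show ?thesis unfolding l[OF i] by simp
  qed
  then show "\<exists>\<tau>>1. \<exists>\<sigma>>1. \<exists>\<kappa>\<ge>1. \<forall>i\<ge>1. 1 / min_expansion l r G i 1 < l i * \<sigma> \<and>
      1 / min_expansion l r G i \<kappa> < l i / \<tau>"
    by (intro exI[of _ "3 / 2"] exI[of _ 3] conjI) auto
qed

text \<open>
  The reciprocals \<open>p i\<close> of the preimages of the fixed point keep the distance \<open>\<mu>\<close> from both ends of \<open>(a i, b i)\<close>,
  so consecutive ones differ by at least \<open>2 \<mu>\<close>, whether the branches increase or decrease. All other quantities
  in the quotient are comparable to their neighbours by factors of \<open>2\<close>.
\<close>

lemma G4: "G4 l r G"
proof -
  define \<mu> where "\<mu> = min \<phi> (1 / real M - \<phi>)"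
  have \<mu>: "0 < \<mu>" using \<phi>_bounds by (simp add: \<mu>_def)
  define p where "p i = (if up i then b i - \<phi> else a i + \<phi>)" for i
  have p: "a i + \<mu> \<le> p i" "p i \<le> b i - \<mu>" "0 < p i" if "1 \<le> i" for i
  proof -
    show "a i + \<mu> \<le> p i" "p i \<le> b i - \<mu>" using ab[OF that] by (auto simp: p_def \<mu>_def)
    then show "0 < p i" using \<mu> a_ge_1[OF that] by linarith
  qed
  have \<delta>: "2 * \<mu> / (p N * p (Suc N)) \<le> delta l r G N" "0 < delta l r G N" if N: "1 \<le> N" for N
  proof -
    have eq: "delta l r G N = 1 / p N - 1 / p (Suc N)"
      using N by (simp add: delta_def fixpoint(3) branch_inv_eq \<phi>_bounds preimage_def p_def del: greaterThanLessThan_iff)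
    also have "\<dots> = (p (Suc N) - p N) / (p N * p (Suc N))"
      using p(3)[of N] p(3)[of "Suc N"] N by (simp add: field_simps)
    finally have eq: "delta l r G N = (p (Suc N) - p N) / (p N * p (Suc N))" .
    have "2 * \<mu> \<le> p (Suc N) - p N" using p(2)[OF N] p(1)[of "Suc N"] sep[OF N] N by simp
    then show "2 * \<mu> / (p N * p (Suc N)) \<le> delta l r G N"
      unfolding eq using p(3)[of N] p(3)[of "Suc N"] N by (intro divide_right_mono) auto
    moreover have "0 < 2 * \<mu> / (p N * p (Suc N))" using \<mu> p(3)[of N] p(3)[of "Suc N"] N by simp
    ultimately show "0 < delta l r G N" by linarith
  qed
  have "r (Suc N) / l (Suc N) * ((r N - l (Suc N)) / delta l r G N) < 4 / \<mu> + 1" if N: "1 \<le> N" for N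
  proof -
    let ?a = "a N" and ?a' = "a (Suc N)" and ?b' = "b (Suc N)" and ?q = "p N * p (Suc N)"
    have pos: "0 < ?a" "0 < ?a'" "0 < ?b'" "0 < ?q"
      using a_ge_1[OF N] a_ge_1[of "Suc N"] a_less_b[of "Suc N"] p(3)[of N] p(3)[of "Suc N"] N by auto
    have "?b' - ?a \<le> 2" using gap[OF N] ab[of "Suc N"] M_pos by linarith
    moreover have "r N - l (Suc N) = (?b' - ?a) / (?a * ?b')" using N pos by (simp add: l r field_simps)
    ultimately have "r N - l (Suc N) \<le> 2 / (?a * ?b')" using pos by (simp add: divide_right_mono)
    moreover have "0 < 2 * \<mu> / ?q" using \<mu> pos by simp
    moreover have "0 \<le> 2 / (?a * ?b')" using pos by simp
    ultimately have "(r N - l (Suc N)) / delta l r G N \<le> (2 / (?a * ?b')) / (2 * \<mu> / ?q)"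
      using \<delta>[OF N] by (intro frac_le) auto
    also have "\<dots> = (p N / ?a) * (p (Suc N) / ?b') / \<mu>" using pos \<mu> by (simp add: field_simps)
    also have "\<dots> \<le> 2 * 1 / \<mu>"
    proof -
      have "p N \<le> 2 * ?a" "p (Suc N) \<le> ?b'" using p(2)[OF N] p(2)[of "Suc N"] b_le[OF N] \<mu> by auto
      then show ?thesis using pos p(3)[of N] p(3)[of "Suc N"] N \<mu>
        by (intro divide_right_mono mult_mono) (auto simp: field_simps)
    qed
    finally have 1: "(r N - l (Suc N)) / delta l r G N \<le> 2 / \<mu>" by simp
    have 2: "r (Suc N) / l (Suc N) \<le> 2" "0 \<le> r (Suc N) / l (Suc N)"
      using b_le[of "Suc N"] pos by (auto simp: l r field_simps)
    have "r (Suc N) / l (Suc N) * ((r N - l (Suc N)) / delta l r G N) \<le> r (Suc N) / l (Suc N) * (2 / \<mu>)"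
      using 1 2 by (intro mult_left_mono) auto
    also have "\<dots> \<le> 2 * (2 / \<mu>)" using 2 \<mu> by (intro mult_right_mono) auto
    finally show ?thesis by simp
  qed
  moreover have "0 < 4 / \<mu> + 1" using \<mu> by (simp add: add_pos_pos)
  ultimately show ?thesis unfolding G4_def using \<delta>(2) by blast
qed

lemma G5: "G5 l r"
  unfolding G5_def
proof (intro exI[of _ 3] conjI allI impI)
  fix i :: nat assume i: "1 \<le> i"
  have pos: "0 < a i" "0 < b i" using a_ge_1[OF i] a_less_b[OF i] by linarith+
  then have "(r i - l i) / (l i)\<^sup>2 = (b i - a i) * (b i / a i)"
    unfolding l[OF i] r[OF i] by (simp add: field_simps power2_eq_square)
  also have "\<dots> \<le> 1 * 2"
  proof (rule mult_mono)
    show "b i - a i \<le> 1" using ab[OF i] M_pos by linarith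
    show "b i / a i \<le> 2" "0 \<le> b i / a i" using pos b_le[OF i] by (simp_all add: field_simps)
  qed simp
  finally show "(r i - l i) / (l i)\<^sup>2 < 3" by simp
qed simp

lemma G7: "G7 l r"
  unfolding G7_def
proof (rule Lim_null_comparison)
  show "(\<lambda>i. 2 * real M / real i) \<longlonglongrightarrow> 0"
    using lim_const_over_n[of "2 * real M"] by simp
  show "\<forall>\<^sub>F i in sequentially. norm (r i / l (Suc i) - 1) \<le> 2 * real M / real i"
    using eventually_ge_at_top[of 1]
  proof eventually_elim
    case (elim i)
    have pos: "0 < a i" "0 < b (Suc i)" using a_ge_1[OF elim] a_ge_1[of "Suc i"] a_less_b[of "Suc i"] by linarith+
    have "r i / l (Suc i) - 1 = (b (Suc i) - a i) / a i" using elim pos by (simp add: l r field_simps)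
    moreover have "0 \<le> b (Suc i) - a i" "b (Suc i) - a i \<le> 2"
      using gap[OF elim] ab[of "Suc i"] M_pos sep[OF elim] a_less_b[OF elim] a_less_b[of "Suc i"] by linarith+
    moreover have "2 / a i \<le> 2 / (real i / real M)"
      using a_lower[OF elim] elim M pos by (intro divide_left_mono) auto
    moreover have "(b (Suc i) - a i) / a i \<le> 2 / a i"
      using pos \<open>b (Suc i) - a i \<le> 2\<close> by (intro divide_right_mono) auto
    ultimately show ?case using pos by simp
  qed
qed

lemma G_conditions:
  assumes "G6 l r G"
  shows "G_conditions l r G"
proof -
  have "G ` branches l r \<subseteq> {0<..<1}"
  proof (rule image_subsetI)
    fix x assume "x \<in> branches l r"
    then obtain i where "1 \<le> i" "x \<in> branch l r i" by (rule branchesE)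
    then have "0 < G x" "G x < 1 / real M" using G_range[of i x] by simp_all
    then show "G x \<in> {0<..<1}" using M_pos unfolding greaterThanLessThan_iff by linarith
  qed
  then show ?thesis
    unfolding G_conditions_def using interval_system C1 G1 G2 G3 G4 G5 G7 assms by blast
qed

end

section \<open>Powers of the logarithm and the reciprocal as weights\<close>

lemma Lambda_subset: "Lambda X G \<subseteq> X"
  unfolding Lambda_def by (auto dest: spec[of _ 0])

context reciprocal_branches
begin

lemma Lambda_bounds: "Lambda (branches l r) G \<subseteq> {0<..<1}"
  using Lambda_subset[of "branches l r" G] branches_bounds by auto

lemma U45:
  assumes "approximable_on u {0<..<1}"
  shows "U4 l r G u" "U5 l r G u"
proof -
  show "U5 l r G u" unfolding U5_def
    using Lambda_bounds by (intro left_computable_on_approximable approximable_on_subset[OF assms]) auto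
  show "U4 l r G u" unfolding U4_def
    using Lambda_bounds by (intro computable_on_approximable approximable_on_subset[OF assms]) auto
qed

text \<open>
  If \<open>s\<^sub>1 = 1\<close> then \<open>M = 1\<close> and the inverse of the first branch is \<open>v \<mapsto> 1 / (1 + v)\<close>. Two points \<open>v\<close>, \<open>w\<close>
  of a common branch differ by a factor of at most \<open>2\<close>, which bounds the quotient from below.
\<close>

lemma U2_ratio:
  assumes "0 < c" and "\<And>v w. 0 < v \<Longrightarrow> v \<le> 1 \<Longrightarrow> 0 < w \<Longrightarrow> w \<le> 2 * v \<Longrightarrow> c \<le> u (1 / (1 + v)) / u (1 / (1 + w))"
  shows "U2 l r G u"
  unfolding U2_def
proof
  assume "s1 l r = 1"
  then have M1: "M = 1" using M by (simp add: s1_eq field_simps)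
  have "ereal c \<le> (INF z\<in>{s0 l r<..<s1 l r}. INF w\<in>{s0 l r<..<s1 l r}.
      ereal (u (branch_inv l r G 1 (branch_inv l r G N z)) / u (branch_inv l r G 1 (branch_inv l r G N w))))"
    if N: "1 \<le> N" for N
  proof (intro INF_greatest)
    fix z w assume "z \<in> {s0 l r<..<s1 l r}" "w \<in> {s0 l r<..<s1 l r}"
    then have zw: "z \<in> {0<..<1 / real M}" "w \<in> {0<..<1 / real M}" by (simp_all add: s0_eq s1_eq)
    have inv: "branch_inv l r G 1 (branch_inv l r G N z) = 1 / (1 + preimage N z) \<and> 0 < preimage N z \<and>
        a N < 1 / preimage N z \<and> 1 / preimage N z < b N" if z: "z \<in> {0<..<1 / real M}" for z
    proof -
      have p: "preimage N z \<in> branch l r N" using preimage[OF N z] by simp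
      then have "preimage N z \<in> {0<..<1 / real M}" using branches_bounds[OF branchesI[OF N p]] by simp
      then show ?thesis
        using p mem_branch[OF N] branch_inv_eq[of 1 "preimage N z"] branch_inv_eq[OF N z]
        by (simp add: preimage_def[of "Suc 0"] M1)
    qed
    let ?z = "preimage N z" and ?w = "preimage N w"
    have pos: "0 < ?z" "0 < ?w" using inv zw by auto
    have "1 / ?z < 2 * (1 / ?w)" using inv[OF zw(1)] inv[OF zw(2)] b_le[OF N] by linarith
    then have "?w \<le> 2 * ?z" using pos by (simp add: field_simps)
    moreover have "1 < 1 / ?z" using inv[OF zw(1)] a_ge_1[OF N] by linarith
    then have "?z \<le> 1" using pos by (simp add: field_simps)
    ultimately show "ereal c \<le> ereal (u (branch_inv l r G 1 (branch_inv l r G N z)) / u (branch_inv l r G 1 (branch_inv l r G N w)))"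
      using assms(2)[of ?z ?w] pos inv[OF zw(1)] inv[OF zw(2)] by simp
  qed
  then have "ereal c \<le> liminf (\<lambda>N. INF z\<in>{s0 l r<..<s1 l r}. INF w\<in>{s0 l r<..<s1 l r}.
      ereal (u (branch_inv l r G 1 (branch_inv l r G N z)) / u (branch_inv l r G 1 (branch_inv l r G N w))))"
    by (intro Liminf_bounded) (auto simp: eventually_sequentially)
  then show "0 < liminf (\<lambda>N. INF z\<in>{s0 l r<..<s1 l r}. INF w\<in>{s0 l r<..<s1 l r}.
      ereal (u (branch_inv l r G 1 (branch_inv l r G N z)) / u (branch_inv l r G 1 (branch_inv l r G N w))))"
    using assms(1) by (meson ereal_less(2) less_le_trans)
qed

lemma domain_subset: "{s0 l r<..<s1 l r} \<subseteq> {0<..<1}"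
  using M_pos unfolding s0_eq s1_eq greaterThanLessThan_subseteq_greaterThanLessThan by linarith

lemma U_conditions_deriv:
  assumes pos: "\<And>x. x \<in> {0<..<1} \<Longrightarrow> 0 < u x"
    and deriv: "\<And>x. x \<in> {0<..<1} \<Longrightarrow> (u has_real_derivative u' x) (at x)" "continuous_on {0<..<1} u'"
    and lim: "filterlim u at_top (at_right 0)"
    and U2: "U2 l r G u" and U3: "0 < C" "\<And>x. x \<in> {0<..<1} \<Longrightarrow> \<bar>u' x\<bar> < C / x\<^sup>2"
    and appr: "approximable_on u {0<..<1}"
  shows "U_conditions l r G u"
proof -
  have d: "deriv u x = u' x" if "x \<in> {s0 l r<..<s1 l r}" for x
    using DERIV_imp_deriv[OF deriv(1)] that domain_subset by blast
  have "C1_on {s0 l r<..<s1 l r} u"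
    unfolding C1_on_def
  proof
    show "\<forall>x\<in>{s0 l r<..<s1 l r}. u differentiable at x"
      using deriv(1) domain_subset real_differentiable_def by blast
    show "continuous_on {s0 l r<..<s1 l r} (deriv u)"
      by (rule continuous_on_eq[OF continuous_on_subset[OF deriv(2) domain_subset]]) (simp add: d)
  qed
  moreover have "U3 l r u"
    unfolding U3_def using U3 d domain_subset by (intro exI[of _ C]) (auto simp: s0_eq)
  ultimately show ?thesis
    unfolding U_conditions_def using pos domain_subset U2 U45[OF appr] lim by (auto simp: U1_def s0_eq)
qed

lemma U_conditions_inverse: "U_conditions l r G (\<lambda>x. 1 / x)"
proof (rule U_conditions_deriv[where u' = "\<lambda>x. - (1 / x\<^sup>2)" and C = 2])
  show "((\<lambda>x. 1 / x) has_real_derivative - (1 / x\<^sup>2)) (at x)" if "x \<in> {0<..<1}" for x :: real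
    using that by (auto intro!: derivative_eq_intros simp: power2_eq_square)
  show "continuous_on {0<..<1} (\<lambda>x::real. - (1 / x\<^sup>2))" by (auto intro!: continuous_intros)
  show "filterlim (\<lambda>x::real. 1 / x) at_top (at_right 0)"
    using filterlim_inverse_at_top_right by (simp add: inverse_eq_divide)
  show "U2 l r G (\<lambda>x. 1 / x)" by (rule U2_ratio[of "1 / 3"]) (auto simp: field_simps)
  show "\<bar>- (1 / x\<^sup>2)\<bar> < 2 / x\<^sup>2" if "x \<in> {0<..<1}" for x :: real
    using that by (simp add: divide_strict_right_mono)
  show "approximable_on (\<lambda>x. 1 / x) {0<..<1}"
    by (rule approximable_on_subset[OF approximable_inverse]) auto
qed auto

text \<open>
  With \<open>y = ln (1/x)\<close> this bounds powers of the logarithm by a multiple of \<open>1/x\<close>, as (U3) requires.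
\<close>

lemma power_le_fact_exp: "0 \<le> y \<Longrightarrow> y ^ n \<le> fact n * exp (y::real)"
proof -
  assume y: "0 \<le> y"
  have "(\<Sum>k\<in>{n}. y ^ k /\<^sub>R fact k) \<le> (\<Sum>k. y ^ k /\<^sub>R fact k)"
    using y by (intro sum_le_suminf summable_exp_generic) auto
  then have "y ^ n / fact n \<le> exp y" by (simp add: exp_def divide_inverse mult.commute)
  then show ?thesis by (simp add: field_simps)
qed

lemma ln_one_plus_ge: "0 < v \<Longrightarrow> v \<le> 1 \<Longrightarrow> v / 2 \<le> ln (1 + v :: real)"
proof -
  assume v: "0 < v" "v \<le> 1"
  have "ln (1 / (1 + v)) \<le> 1 / (1 + v) - 1" using v by (intro ln_le_minus_one) auto
  moreover have "ln (1 / (1 + v)) = - ln (1 + v)" using v by (simp add: ln_div)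
  moreover have "1 / (1 + v) - 1 = - (v / (1 + v))" using v by (simp add: field_simps)
  moreover have "v / 2 \<le> v / (1 + v)" using v by (intro divide_left_mono) auto
  ultimately show ?thesis by linarith
qed

lemma U_conditions_ln_power:
  assumes n: "1 \<le> n"
  shows "U_conditions l r G (\<lambda>x. ln (1 / x) ^ n)"
proof (rule U_conditions_deriv[where u' = "\<lambda>x. real n * ln (1 / x) ^ (n - 1) * - (1 / x)" and C = "fact n + 1"])
  have ln_pos: "0 < ln (1 / x)" if "x \<in> {0<..<1}" for x :: real using that by simp
  show "0 < ln (1 / x) ^ n" if "x \<in> {0<..<1}" for x :: real using ln_pos[OF that] by simp
  show "((\<lambda>x. ln (1 / x) ^ n) has_real_derivative real n * ln (1 / x) ^ (n - 1) * - (1 / x)) (at x)"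
    if "x \<in> {0<..<1}" for x :: real
  proof -
    have "((\<lambda>x. ln (1 / x)) has_real_derivative - (1 / x)) (at x)"
      using that by (auto intro!: derivative_eq_intros simp: power2_eq_square field_simps)
    from DERIV_power[OF this, of n] show ?thesis by (simp add: mult_ac)
  qed
  show "continuous_on {0<..<1} (\<lambda>x. real n * ln (1 / x) ^ (n - 1) * - (1 / x))"
    by (auto intro!: continuous_intros)
  have "filterlim (\<lambda>x::real. ln (inverse x)) at_top (at_right 0)"
    by (rule filterlim_compose[OF ln_at_top filterlim_inverse_at_top_right])
  then show "filterlim (\<lambda>x::real. ln (1 / x) ^ n) at_top (at_right 0)"
    using n by (intro filterlim_pow_at_top) (auto simp: inverse_eq_divide)
  show "U2 l r G (\<lambda>x. ln (1 / x) ^ n)"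
  proof (rule U2_ratio[of "(1 / 4) ^ n"])
    fix v w :: real assume v: "0 < v" "v \<le> 1" "0 < w" "w \<le> 2 * v"
    have "w \<le> 4 * ln (1 + v)" using ln_one_plus_ge[OF v(1,2)] v(4) by linarith
    moreover have "ln (1 + w) \<le> w" using v by (intro ln_add_one_self_le_self) auto
    moreover have "0 < ln (1 + w)" using v by (intro ln_gt_zero) auto
    ultimately have "1 / 4 \<le> ln (1 + v) / ln (1 + w)" by (simp add: field_simps)
    then have "(1 / 4) ^ n \<le> (ln (1 + v) / ln (1 + w)) ^ n" by (intro power_mono) auto
    then show "(1 / 4) ^ n \<le> ln (1 / (1 / (1 + v))) ^ n / ln (1 / (1 / (1 + w))) ^ n"
      by (simp add: power_divide)
  qed simp
  show "\<bar>real n * ln (1 / x) ^ (n - 1) * - (1 / x)\<bar> < (fact n + 1) / x\<^sup>2" if x: "x \<in> {0<..<1}" for x :: real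
  proof -
    have "\<bar>real n * ln (1 / x) ^ (n - 1) * - (1 / x)\<bar> = real n * ln (1 / x) ^ (n - 1) * (1 / x)"
      using x ln_pos[OF x] by (simp add: abs_mult)
    also have "\<dots> \<le> real n * (fact (n - 1) * exp (ln (1 / x))) * (1 / x)"
      using power_le_fact_exp[of "ln (1 / x)" "n - 1"] ln_pos[OF x] x
      by (intro mult_right_mono mult_left_mono) auto
    also have "\<dots> = fact n / x\<^sup>2"
      using x n fact_reduce[of n, where ?'a = real] by (simp add: power2_eq_square)
    also have "\<dots> < (fact n + 1) / x\<^sup>2" using x by (intro divide_strict_right_mono) auto
    finally show ?thesis .
  qed
  show "(0::real) < fact n + 1" by (simp add: add_pos_pos)
  show "approximable_on (\<lambda>x. ln (1 / x) ^ n) {0<..<1}"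
    by (rule approximable_power[OF approximable_ln]) auto
qed

end

section \<open>The branches of the \<alpha>-continued fraction maps\<close>

lemma components_disjoint_open_UN:
  fixes B :: "'i \<Rightarrow> 'a::topological_space set"
  assumes B: "\<And>i. i \<in> I \<Longrightarrow> open (B i)" "\<And>i. i \<in> I \<Longrightarrow> connected (B i)" "\<And>i. i \<in> I \<Longrightarrow> B i \<noteq> {}"
    and disj: "disjoint_family_on B I"
  shows "components (\<Union>i\<in>I. B i) = B ` I"
proof -
  let ?S = "\<Union>i\<in>I. B i"
  have comp: "connected_component_set ?S x = B i" if i: "i \<in> I" "x \<in> B i" for i x
  proof
    show "B i \<subseteq> connected_component_set ?S x"
      using i B(2) by (intro connected_component_maximal) auto
    let ?C = "connected_component_set ?S x" and ?V = "\<Union>j\<in>I - {i}. B j"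
    have sub: "?C \<subseteq> ?S" by (rule connected_component_subset)
    have "B i \<inter> ?V = {}" using disj i unfolding disjoint_family_on_def by blast
    then have "B i \<inter> ?V \<inter> ?C = {}" by blast
    moreover have "?C \<subseteq> B i \<union> ?V" using sub by blast
    moreover have "open ?V" using B(1) by (intro open_UN) simp
    ultimately have "B i \<inter> ?C = {} \<or> ?V \<inter> ?C = {}"
      using connectedD[OF connected_connected_component[of ?S x] B(1)[OF i(1)]] by meson
    moreover have "x \<in> ?C" using i by auto
    ultimately have "?V \<inter> ?C = {}" using i(2) by blast
    then show "?C \<subseteq> B i" using sub by blast
  qed
  show ?thesis
  proof
    show "components ?S \<subseteq> B ` I" using comp unfolding components_def by blast
    show "B ` I \<subseteq> components ?S"
    proof
      fix C assume "C \<in> B ` I"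
      then obtain i where i: "i \<in> I" "C = B i" by blast
      with B(3) obtain x where "x \<in> B i" by blast
      then show "C \<in> components ?S" using comp[of i x] i componentsI[of x ?S] by auto
    qed
  qed
qed

lemma branch_eqD:
  assumes "branch l r i = branch l' r' j" "branch l r i \<noteq> {}"
  shows "l i = l' j" "r i = r' j"
proof -
  have "l i < r i" using assms(2) unfolding branch_def greaterThanLessThan_empty_iff by simp
  moreover have "l' j < r' j"
    using assms(2)[unfolded assms(1)] unfolding branch_def greaterThanLessThan_empty_iff by simp
  ultimately
  have "Inf (branch l r i) = l i" "Sup (branch l r i) = r i" "Inf (branch l' r' j) = l' j" "Sup (branch l' r' j) = r' j"
    by (simp_all add: branch_def)
  then show "l i = l' j" "r i = r' j" using assms(1) by simp_all
qed

text \<open>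
  Every left endpoint of one enumeration occurs in the other. By induction the first \<open>i - 1\<close> endpoints of both agree,
  so the next one of either list occurs in the other at position \<open>i\<close> or later, which gives both inequalities.
\<close>

lemma decreasing_enumeration_unique:
  assumes C: "bij_betw (branch l r) {1..} C" "bij_betw (branch l' r') {1..} C" "{} \<notin> C"
    and dec: "\<And>i. 1 \<le> i \<Longrightarrow> l (Suc i) < l i" "\<And>i. 1 \<le> i \<Longrightarrow> l' (Suc i) < l' i"
    and i: "1 \<le> i"
  shows "l i = l' i \<and> r i = r' i"
proof -
  have strict: "f j < f i" if "\<And>i. 1 \<le> i \<Longrightarrow> f (Suc i) < f i" "1 \<le> i" "i < j" for f :: "nat \<Rightarrow> real" and i j
  proof -
    have "Suc i \<le> j" using that(3) by simp
    then show ?thesis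
    proof (induction j rule: nat_induct_at_least)
      case base
      then show ?case using that by simp
    next
      case (Suc n)
      then show ?case using that(1)[of n] by simp
    qed
  qed
  have match: "\<exists>j\<ge>1. l i = l' j \<and> r i = r' j" "\<exists>j\<ge>1. l' i = l j" if "1 \<le> i" for i
  proof -
    have "branch l r i \<in> C" "branch l' r' i \<in> C" using C(1,2) that by (auto dest: bij_betwE)
    moreover have "C = branch l r ` {1..}" "C = branch l' r' ` {1..}"
      using C by (simp_all add: bij_betw_imp_surj_on)
    ultimately have "branch l r i \<in> branch l' r' ` {1..}" "branch l' r' i \<in> branch l r ` {1..}" by metis+
    then obtain j k where jk: "1 \<le> j" "branch l r i = branch l' r' j" "1 \<le> k" "branch l' r' i = branch l r k"
      by auto
    moreover have "branch l r i \<noteq> {}" "branch l' r' i \<noteq> {}"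
      using \<open>branch l r i \<in> C\<close> \<open>branch l' r' i \<in> C\<close> C(3) by metis+
    ultimately show "\<exists>j\<ge>1. l i = l' j \<and> r i = r' j" "\<exists>j\<ge>1. l' i = l j"
      using branch_eqD by metis+
  qed
  have eq: "l i = l' i" if "1 \<le> i" for i
    using that
  proof (induction i rule: less_induct)
    case (less i)
    obtain j where j: "1 \<le> j" "l i = l' j" using match(1)[OF less.prems] by blast
    obtain k where k: "1 \<le> k" "l' i = l k" using match(2)[OF less.prems] by blast
    have "\<not> j < i" using less.IH[of j] j strict[of l j i, OF dec(1)] by auto
    moreover have "\<not> k < i" using less.IH[of k] k strict[of l' k i, OF dec(2)] by auto
    ultimately have "l' j \<le> l' i" "l k \<le> l i"
      using strict[of l' i j, OF dec(2) less.prems] strict[of l i k, OF dec(1) less.prems]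
      by (metis less_imp_le linorder_neqE_nat order_refl)+
    then show ?case using j k by simp
  qed
  obtain j where j: "1 \<le> j" "l i = l' j" "r i = r' j" using match(1)[OF i] by blast
  have "l' i = l' j" using eq[OF i] j by simp
  then have "i = j"
    using strict[of l' i j, OF dec(2) i] strict[of l' j i, OF dec(2) j(1)] by (metis less_irrefl linorder_neqE_nat)
  then show ?thesis using eq[OF i] j by simp
qed

context reciprocal_branches
begin

lemma branches_components: "bij_betw (branch l r) {1..} (components (branches l r))"
proof -
  have ne: "branch l r i \<noteq> {}" if "1 \<le> i" for i
    using interval_system that by (auto simp: interval_system_def branch_def)
  have "components (branches l r) = branch l r ` {1..}"
    unfolding branches_def
    by (rule components_disjoint_open_UN[OF _ _ _ disjoint]) (use ne in \<open>auto simp: branch_def\<close>)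
  moreover have "inj_on (branch l r) {1..}"
  proof (rule inj_onI)
    fix i j :: nat assume "i \<in> {1..}" "j \<in> {1..}" "branch l r i = branch l r j"
    then show "i = j" using disjoint ne[of i] unfolding disjoint_family_on_def by (metis Int_absorb atLeast_iff)
  qed
  ultimately show ?thesis by (simp add: bij_betw_def)
qed

end

text \<open>
  The estimate \<open>1/m \<le> 1 - \<alpha>\<close> makes the rounding threshold of the map invisible on its domain: numbers less than \<open>1/m\<close>
  away from an integer \<open>N\<close> are always rounded to \<open>N\<close>. For \<open>\<alpha> \<ge> 1/2\<close> also \<open>1/m \<le> 1/2\<close>.
\<close>

lemma alpha_bound_props:
  assumes "\<alpha> \<in> {1/2..<1}"
  obtains m :: nat where "2 \<le> m" "alpha_bound \<alpha> = 1 / m" "1 / m \<le> 1 - \<alpha>"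
proof -
  define m where "m = nat \<lceil>1 / (1 - \<alpha>)\<rceil>"
  have 2: "2 \<le> 1 / (1 - \<alpha>)" using assms by (simp add: field_simps)
  then have c: "2 \<le> \<lceil>1 / (1 - \<alpha>)\<rceil>" by linarith
  have m: "real m = of_int \<lceil>1 / (1 - \<alpha>)\<rceil>" "2 \<le> m" using c unfolding m_def by linarith+
  then have "1 / (1 - \<alpha>) \<le> real m" by linarith
  then have "1 / m \<le> 1 - \<alpha>" using assms m(2) by (simp add: field_simps)
  moreover have "alpha_bound \<alpha> = 1 / m" using assms m by (simp add: alpha_bound_def)
  ultimately show ?thesis using that m by blast
qed

lemma alpha_map_fold:
  assumes \<alpha>: "\<alpha> \<in> {1/2..<1}" and x: "x \<in> alpha_domain \<alpha>"
  obtains N :: int where "0 < \<bar>1 / x - N\<bar>" "\<bar>1 / x - N\<bar> < alpha_bound \<alpha>" "alpha_map \<alpha> x = \<bar>1 / x - N\<bar>"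
  using x by (intro that[of "\<lfloor>1 / x - \<alpha> + 1\<rfloor>"]) (auto simp: alpha_domain_def alpha_map_def)

text \<open>
  On its domain the map is the fractional part of \<open>1/x\<close> or the distance of \<open>1/x\<close> to the integers. The real number \<open>\<alpha>\<close>,
  which need not be computable, only decides between these two cases.
\<close>

lemma alpha_map_approximable:
  assumes "\<alpha> \<in> {1/2..1}"
  shows "approximable_on (alpha_map \<alpha>) (alpha_domain \<alpha>)"
proof (cases "\<alpha> = 1")
  case True
  have "approximable_on (\<lambda>x. frac (1 / x)) (alpha_domain \<alpha>)"
  proof (rule approximable_frac[OF approximable_on_subset[OF approximable_inverse]])
    show "0 \<le> 1 / x \<and> 1 / x \<notin> \<int>" if "x \<in> alpha_domain \<alpha>" for x
      using that frac_gt_0_iff[of "1 / x"] unfolding True by (auto simp: alpha_domain_def alpha_map_1)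
  qed (auto simp: alpha_domain_def)
  then show ?thesis by (rule approximable_on_cong) (simp add: True alpha_map_1)
next
  case False
  then have \<alpha>: "\<alpha> \<in> {1/2..<1}" using assms by simp
  obtain m :: nat where m: "2 \<le> m" "alpha_bound \<alpha> = 1 / m" using alpha_bound_props[OF \<alpha>] by blast
  have b: "alpha_bound \<alpha> \<le> 1 / 2" using m by (simp add: frac_le)
  have key: "1 / x \<notin> \<int> \<and> alpha_map \<alpha> x = min (frac (1 / x)) (1 - frac (1 / x))" if x: "x \<in> alpha_domain \<alpha>" for x
  proof -
    obtain N :: int where N: "0 < \<bar>1 / x - N\<bar>" "\<bar>1 / x - N\<bar> < 1 / 2" "alpha_map \<alpha> x = \<bar>1 / x - N\<bar>"
      using alpha_map_fold[OF \<alpha> x] b by (metis less_le_trans)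
    consider "N < 1 / x" | "1 / x < N" using N(1) by linarith
    then show ?thesis
    proof cases
      case 1
      then have "\<lfloor>1 / x\<rfloor> = N" using N(2) by (intro floor_unique) linarith+
      then have f: "frac (1 / x) = 1 / x - N" by (simp add: frac_def)
      then have "0 < frac (1 / x)" using 1 by simp
      then have "1 / x \<notin> \<int>" by (rule frac_gt_0_iff[THEN iffD1])
      moreover have "\<bar>1 / x - N\<bar> = min (1 / x - N) (1 - (1 / x - N))" using 1 N(2) by linarith
      ultimately show ?thesis unfolding f N(3) by simp
    next
      case 2
      then have "of_int (N - 1) \<le> 1 / x" "1 / x < of_int (N - 1) + 1"
        using N(2) unfolding of_int_diff of_int_1 by linarith+
      then have "\<lfloor>1 / x\<rfloor> = N - 1" by (rule floor_unique)
      then have f: "frac (1 / x) = 1 / x - N + 1" by (simp add: frac_def)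
      then have "0 < frac (1 / x)" using 2 N(2) by linarith
      then have "1 / x \<notin> \<int>" by (rule frac_gt_0_iff[THEN iffD1])
      moreover have "\<bar>1 / x - N\<bar> = min (1 / x - N + 1) (1 - (1 / x - N + 1))" using 2 N(2) by linarith
      ultimately show ?thesis unfolding f N(3) by simp
    qed
  qed
  have pos: "x \<in> {0<..}" if "x \<in> alpha_domain \<alpha>" for x using that by (simp add: alpha_domain_def)
  have "approximable_on (\<lambda>x. frac (1 / x)) (alpha_domain \<alpha>)"
    by (rule approximable_frac[OF approximable_on_subset[OF approximable_inverse]]) (use pos key in \<open>auto intro: less_imp_le\<close>)
  then have "approximable_on (\<lambda>x. min (frac (1 / x)) (1 - frac (1 / x))) (alpha_domain \<alpha>)"
    by (rule approximable_fold) (simp add: frac_lt_1 less_imp_le)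
  then show ?thesis by (rule approximable_on_cong) (simp add: key)
qed

lemma reciprocal_branches_gauss:
  "reciprocal_branches 1 real (\<lambda>i. real i + 1) (\<lambda>_. False) (\<lambda>i. 1 / (real i + 1)) (\<lambda>i. 1 / real i) (alpha_map 1)"
proof
  fix i :: nat and x :: real
  assume i: "1 \<le> i" and x: "x \<in> branch (\<lambda>i. 1 / (real i + 1)) (\<lambda>i. 1 / real i) i"
  then have "0 < x" "real i < 1 / x" "1 / x < real i + 1"
    by (auto simp: branch_def field_simps intro: less_trans[OF zero_less_divide_1_iff[THEN iffD2]])
  then have "\<lfloor>1 / x\<rfloor> = int i" by (intro floor_unique) auto
  then show "alpha_map 1 x = (if False then real i + 1 - 1 / x else 1 / x - real i)"
    by (simp add: alpha_map_1 frac_def)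
qed auto

lemma branches_gauss: "branches (\<lambda>i. 1 / (real i + 1)) (\<lambda>i. 1 / real i) = alpha_domain 1"
proof -
  note gauss = reciprocal_branches_gauss
  show ?thesis
  proof (intro subset_antisym subsetI)
    fix x assume x: "x \<in> branches (\<lambda>i. 1 / (real i + 1)) (\<lambda>i. 1 / real i)"
    obtain i where "1 \<le> i" "x \<in> branch (\<lambda>i. 1 / (real i + 1)) (\<lambda>i. 1 / real i) i"
      using x by (auto simp: branches_def)
    from reciprocal_branches.G_range[OF gauss this] reciprocal_branches.branches_bounds[OF gauss x]
    show "x \<in> alpha_domain 1" by (simp add: alpha_domain_def alpha_bound_def)
  next
    fix x :: real assume "x \<in> alpha_domain 1"
    then have x: "0 < x" "x < 1" "0 < frac (1 / x)" by (auto simp: alpha_domain_def alpha_bound_def alpha_map_1)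
    define z where "z = \<lfloor>1 / x\<rfloor>"
    define i where "i = nat z"
    have "1 < 1 / x" using x by simp
    then have "1 \<le> z" unfolding z_def by linarith
    then have "1 \<le> i" "real i = of_int z" by (simp_all add: i_def)
    then have i: "1 \<le> i" "real i = of_int \<lfloor>1 / x\<rfloor>" by (simp_all only: z_def)
    then have "real i < 1 / x" "1 / x < real i + 1" using x(3) by (simp_all add: frac_def)
    then show "x \<in> branches (\<lambda>i. 1 / (real i + 1)) (\<lambda>i. 1 / real i)"
      using reciprocal_branches.mem_branch[OF gauss i(1)] x(1)
      by (intro reciprocal_branches.branchesI[OF gauss i(1)]) simp
  qed
qed

text \<open>
  Around each integer \<open>N\<close> lie two intervals: \<open>(N, N + 1/m)\<close> with odd index, where the map decreases, and
  \<open>(N - 1/m, N)\<close> with even index, where it increases. For \<open>N = m\<close> only the first one belongs to the domain.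
\<close>

definition folded_left :: "nat \<Rightarrow> nat \<Rightarrow> real" where
  "folded_left m i = real m + real (i div 2) - (if even i then 1 / real m else 0)"

lemma reciprocal_branches_folded:
  assumes \<alpha>: "\<alpha> \<in> {1/2..<1}" and m: "2 \<le> m" "1 / real m \<le> 1 - \<alpha>"
  shows "reciprocal_branches m (folded_left m) (\<lambda>i. folded_left m i + 1 / m) even
    (\<lambda>i. 1 / (folded_left m i + 1 / m)) (\<lambda>i. 1 / folded_left m i) (alpha_map \<alpha>)"
proof
  have m2: "0 < 1 / real m" "1 / real m \<le> 1 / 2" using m(1) by (auto simp: field_simps)
  show "1 \<le> m" using m by simp
  show "folded_left m 1 = real m" by (simp add: folded_left_def)
  show "folded_left m i + 1 / m \<le> folded_left m (Suc i)" "folded_left m (Suc i) \<le> folded_left m i + 1" for i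
    using m2 by (cases "even i"; simp add: folded_left_def; linarith)+
  fix i :: nat and x :: real
  assume i: "1 \<le> i" and x: "x \<in> branch (\<lambda>i. 1 / (folded_left m i + 1 / m)) (\<lambda>i. 1 / folded_left m i) i"
  define a where "a = folded_left m i"
  define N where "N = int (m + i div 2)"
  have N: "a = (if even i then of_int N - 1 / m else of_int N)" by (simp add: a_def folded_left_def N_def)
  have "real m \<le> of_int N" by (simp add: N_def)
  moreover have "2 \<le> real m" using m(1) by simp
  ultimately have "1 / m < of_int N" "0 < real_of_int N" using m2(2) by linarith+
  then have "0 < a" unfolding N by simp
  have x': "1 / (a + 1 / m) < x" "x < 1 / a" using x by (simp_all add: branch_def a_def)
  have "0 < a + 1 / m" using \<open>0 < a\<close> m2 by linarith
  then have "0 < x" using x'(1) by (meson less_trans zero_less_divide_1_iff)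
  then have y: "a < 1 / x" "1 / x < a + 1 / m"
    using x' \<open>0 < a\<close> \<open>0 < a + 1 / m\<close> by (simp_all add: field_simps)
  have "\<lfloor>1 / x - \<alpha> + 1\<rfloor> = N"
    using y m(2) m2 \<alpha> unfolding N by (intro floor_unique) (auto split: if_splits)
  then have "alpha_map \<alpha> x = \<bar>1 / x - of_int N\<bar>" using \<open>0 < x\<close> by (simp add: alpha_map_def)
  also have "\<dots> = (if even i then a + 1 / m - 1 / x else 1 / x - a)"
    using y unfolding N by auto
  finally show "alpha_map \<alpha> x = (if even i then folded_left m i + 1 / m - 1 / x else 1 / x - folded_left m i)"
    by (simp add: a_def)
qed (use assms in auto)

lemma branches_folded:
  assumes \<alpha>: "\<alpha> \<in> {1/2..<1}" and m: "2 \<le> m" "1 / real m \<le> 1 - \<alpha>" and bound: "alpha_bound \<alpha> = 1 / real m"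
  shows "branches (\<lambda>i. 1 / (folded_left m i + 1 / m)) (\<lambda>i. 1 / folded_left m i) = alpha_domain \<alpha>"
proof -
  interpret reciprocal_branches m "folded_left m" "\<lambda>i. folded_left m i + 1 / m" even
      "\<lambda>i. 1 / (folded_left m i + 1 / m)" "\<lambda>i. 1 / folded_left m i" "alpha_map \<alpha>"
    by (rule reciprocal_branches_folded[OF \<alpha> m])
  show ?thesis
  proof (intro subset_antisym subsetI)
    fix x assume x: "x \<in> branches (\<lambda>i. 1 / (folded_left m i + 1 / m)) (\<lambda>i. 1 / folded_left m i)"
    then obtain i where "1 \<le> i" "x \<in> branch (\<lambda>i. 1 / (folded_left m i + 1 / m)) (\<lambda>i. 1 / folded_left m i) i"
      by (rule branchesE)
    then show "x \<in> alpha_domain \<alpha>"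
      using branches_bounds[OF x] G_range by (simp add: alpha_domain_def bound)
  next
    fix x :: real assume x: "x \<in> alpha_domain \<alpha>"
    obtain N :: int where N: "0 < \<bar>1 / x - N\<bar>" "\<bar>1 / x - N\<bar> < 1 / m"
      using alpha_map_fold[OF \<alpha> x] bound by metis
    have x0: "0 < x" "x < 1 / m" using x by (simp_all add: alpha_domain_def bound)
    then have y: "real m < 1 / x" using m by (simp add: field_simps)
    have m1: "1 / real m < 1" using m by simp
    have "\<exists>i\<ge>1. folded_left m i < 1 / x \<and> 1 / x < folded_left m i + 1 / m"
    proof (cases "of_int N < 1 / x")
      case True
      then have "of_int (int m) < real_of_int (N + 1)" using N y m1 by simp
      then have Nm: "int m \<le> N" by linarith
      define i where "i = 2 * nat (N - int m) + 1"
      have "folded_left m i = of_int N" using Nm by (simp add: folded_left_def i_def)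
      moreover have "1 \<le> i" by (simp add: i_def)
      ultimately show ?thesis using True N by (intro exI[of _ i]) simp
    next
      case False
      then have lt: "1 / x < of_int N" using N by linarith
      then have "of_int (int m) < real_of_int N" using y by simp
      then have Nm: "int m < N" by linarith
      define i where "i = 2 * nat (N - int m)"
      have "folded_left m i = of_int N - 1 / m" using Nm by (simp add: folded_left_def i_def)
      moreover have "1 \<le> i" using Nm by (simp add: i_def)
      ultimately show ?thesis using lt N by (intro exI[of _ i]) simp
    qed
    then obtain i where i: "1 \<le> i" "folded_left m i < 1 / x" "1 / x < folded_left m i + 1 / m" by blast
    then show "x \<in> branches (\<lambda>i. 1 / (folded_left m i + 1 / m)) (\<lambda>i. 1 / folded_left m i)"
      using mem_branch[OF i(1)] x0(1) by (intro branchesI[OF i(1)]) simp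
  qed
qed

lemma alpha_reciprocal_branches:
  assumes "\<alpha> \<in> {1/2..1}"
  shows "\<exists>M a b up l r. reciprocal_branches M a b up l r (alpha_map \<alpha>) \<and> branches l r = alpha_domain \<alpha>"
proof (cases "\<alpha> = 1")
  case True
  show ?thesis unfolding True using reciprocal_branches_gauss branches_gauss by blast
next
  case False
  then have \<alpha>: "\<alpha> \<in> {1/2..<1}" using assms by simp
  obtain m :: nat where m: "2 \<le> m" "alpha_bound \<alpha> = 1 / m" "1 / m \<le> 1 - \<alpha>"
    by (rule alpha_bound_props[OF \<alpha>])
  show ?thesis using reciprocal_branches_folded[OF \<alpha> m(1,3)] branches_folded[OF \<alpha> m(1,3,2)] by blast
qed

lemma alpha_branches_reciprocal:
  assumes \<alpha>: "\<alpha> \<in> {1/2..1}" and lr: "alpha_branches \<alpha> l r"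
  shows "\<exists>M a b up. reciprocal_branches M a b up l r (alpha_map \<alpha>)" "branches l r = alpha_domain \<alpha>"
proof -
  have "\<Union>(branch l r ` {1..}) = \<Union>(components (alpha_domain \<alpha>))"
    using lr by (simp add: alpha_branches_def bij_betw_def)
  then show "branches l r = alpha_domain \<alpha>" by (simp add: branches_def)
  obtain M a b up l' r' where R: "reciprocal_branches M a b up l' r' (alpha_map \<alpha>)"
    and dom: "branches l' r' = alpha_domain \<alpha>"
    using alpha_reciprocal_branches[OF \<alpha>] by blast
  interpret R: reciprocal_branches M a b up l' r' "alpha_map \<alpha>" by (rule R)
  have eq: "l i = l' i \<and> r i = r' i" if "1 \<le> i" for i
  proof (rule decreasing_enumeration_unique[OF _ _ _ _ _ that])
    show "bij_betw (branch l r) {1..} (components (alpha_domain \<alpha>))"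
      using lr by (simp add: alpha_branches_def)
    show "l (Suc i) < l i" if "1 \<le> i" for i
      using lr that by (simp add: alpha_branches_def)
    show "bij_betw (branch l' r') {1..} (components (alpha_domain \<alpha>))"
      using R.branches_components dom by simp
    show "l' (Suc i) < l' i" if "1 \<le> i" for i using R.interval_system that by (simp add: interval_system_def)
    show "{} \<notin> components (alpha_domain \<alpha>)" using in_components_nonempty by blast
  qed
  have "reciprocal_branches M a b up l r (alpha_map \<alpha>)"
  proof
    fix i :: nat and x :: real assume "1 \<le> i" "x \<in> branch l r i"
    then show "alpha_map \<alpha> x = (if up i then b i - 1 / x else 1 / x - a i)"
      using R.G[of i x] eq[of i] by (simp add: branch_def)
  qed (use R.M R.a1 R.ab R.sep R.gap R.l R.r R.up1 eq in auto)
  then show "\<exists>M a b up. reciprocal_branches M a b up l r (alpha_map \<alpha>)" by blast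
qed

lemma alpha_G6:
  assumes "\<alpha> \<in> {1/2..1}" "branches l r = alpha_domain \<alpha>"
  shows "G6 l r (alpha_map \<alpha>)"
  unfolding G6_def assms(2)
  by (rule computable_on_approximable[OF alpha_map_approximable[OF assms(1)]])
    (auto simp: alpha_domain_def)

lemma alpha_orbit_pos:
  assumes "x \<in> alpha_Lambda \<alpha>"
  shows "0 < eta (alpha_map \<alpha>) j x"
  using assms by (auto simp: alpha_Lambda_def Lambda_def alpha_domain_def eta_def)

lemma generalized_brjuno_alpha:
  assumes "G_conditions l r (alpha_map \<alpha>)" "U_conditions l r (alpha_map \<alpha>) u" "branches l r = alpha_domain \<alpha>"
    and \<nu>: "1 \<le> (\<nu>::nat)"
  shows "generalized_brjuno_on (alpha_Lambda \<alpha>) (brjuno_alpha \<alpha> u \<nu>)"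
  unfolding generalized_brjuno_on_def
proof (intro exI conjI ballI)
  show "0 < real \<nu>" using \<nu> by simp
  show "alpha_Lambda \<alpha> = Lambda (branches l r) (alpha_map \<alpha>)" by (simp add: alpha_Lambda_def assms(3))
  show "brjuno_alpha \<alpha> u \<nu> x = Phi (alpha_map \<alpha>) u (real \<nu>) x" if "x \<in> alpha_Lambda \<alpha>" for x
    unfolding brjuno_alpha_def Phi_def using alpha_orbit_pos[OF that] by (simp add: powr_realpow prod_pos)
qed (rule assms)+

lemma generalized_brjuno_on_cong:
  "generalized_brjuno_on X F \<Longrightarrow> (\<And>x. x \<in> X \<Longrightarrow> F' x = F x) \<Longrightarrow> generalized_brjuno_on X F'"
  unfolding generalized_brjuno_on_def by (metis (no_types, lifting))

lemma alpha_example: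
  assumes \<alpha>: "\<alpha> \<in> {1/2..1}" and u: "(\<exists>n::nat. 1 \<le> n \<and> u = (\<lambda>x. ln (1 / x) ^ n)) \<or> u = (\<lambda>x. 1 / x)"
  shows "\<exists>l r. alpha_branches \<alpha> l r \<and> G_conditions l r (alpha_map \<alpha>) \<and> U_conditions l r (alpha_map \<alpha>) u \<and>
    branches l r = alpha_domain \<alpha>"
proof -
  obtain M a b up l r where R: "reciprocal_branches M a b up l r (alpha_map \<alpha>)"
    and dom: "branches l r = alpha_domain \<alpha>"
    using alpha_reciprocal_branches[OF \<alpha>] by blast
  interpret R: reciprocal_branches M a b up l r "alpha_map \<alpha>" by (rule R)
  have "alpha_branches \<alpha> l r"
    using R.branches_components R.interval_system dom by (simp add: alpha_branches_def interval_system_def)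
  moreover have "G_conditions l r (alpha_map \<alpha>)" by (rule R.G_conditions[OF alpha_G6[OF \<alpha> dom]])
  moreover have "U_conditions l r (alpha_map \<alpha>) u"
    using u R.U_conditions_ln_power R.U_conditions_inverse by blast
  ultimately show ?thesis using dom by blast
qed

text \<open>
  Given endpoints are identified with the explicit ones, so that the conditions on \<open>G\<close> hold for them;
  the conditions on \<open>u\<close> are restrictions of the hypotheses to \<open>(0, s\<^sub>1)\<close>.
\<close>

lemma alpha_general:
  assumes \<alpha>: "\<alpha> \<in> {1/2..1}" and \<nu>: "1 \<le> (\<nu>::nat)" and lr: "alpha_branches \<alpha> l r"
    and u: "\<forall>x\<in>{0<..<1}. 0 < u x" "C1_on {0<..<1} u" "filterlim u at_top (at_right 0)"
    and U: "U2 l r (alpha_map \<alpha>) u" "U3 l r u" "U4 l r (alpha_map \<alpha>) u" "U5 l r (alpha_map \<alpha>) u"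
  shows "generalized_brjuno_on (alpha_Lambda \<alpha>) (brjuno_alpha \<alpha> u \<nu>)"
proof -
  have dom: "branches l r = alpha_domain \<alpha>" by (rule alpha_branches_reciprocal(2)[OF \<alpha> lr])
  obtain M a b up where R: "reciprocal_branches M a b up l r (alpha_map \<alpha>)"
    using alpha_branches_reciprocal(1)[OF \<alpha> lr] by blast
  interpret R: reciprocal_branches M a b up l r "alpha_map \<alpha>" by (rule R)
  have "C1_on {s0 l r<..<s1 l r} u"
    using u(2) R.domain_subset unfolding C1_on_def by (blast intro: continuous_on_subset)
  then have "U_conditions l r (alpha_map \<alpha>) u"
    using u(1,3) U R.domain_subset by (auto simp: U_conditions_def U1_def R.s0_eq)
  then show ?thesis
    using generalized_brjuno_alpha[OF R.G_conditions[OF alpha_G6[OF \<alpha> dom]] _ dom \<nu>] by blast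
qed

theorem theorem3p1:
  shows "generalized_brjuno_on (alpha_Lambda 1) yoccoz_brjuno \<and>
    generalized_brjuno_on (alpha_Lambda 1) wilton1 \<and>
    (\<forall>\<alpha>\<in>{1/2..1}. \<forall>\<nu>::nat. \<forall>u. \<forall>l r.
       1 \<le> \<nu> \<and> alpha_branches \<alpha> l r \<and>
       (\<forall>x\<in>{0<..<1}. 0 < u x) \<and> C1_on {0<..<1} u \<and> filterlim u at_top (at_right 0) \<and>
       U2 l r (alpha_map \<alpha>) u \<and> U3 l r u \<and>
       U4 l r (alpha_map \<alpha>) u \<and> U5 l r (alpha_map \<alpha>) u \<longrightarrow>
       generalized_brjuno_on (alpha_Lambda \<alpha>) (brjuno_alpha \<alpha> u \<nu>)) \<and>
    (\<forall>\<alpha>\<in>{1/2..1}. \<forall>u.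
       (\<exists>n::nat. 1 \<le> n \<and> u = (\<lambda>x. ln (1 / x) ^ n)) \<or> u = (\<lambda>x. 1 / x) \<longrightarrow>
       (\<exists>l r. alpha_branches \<alpha> l r \<and>
          G_conditions l r (alpha_map \<alpha>) \<and> U_conditions l r (alpha_map \<alpha>) u) \<and>
       (\<forall>\<nu>::nat. 1 \<le> \<nu> \<longrightarrow> generalized_brjuno_on (alpha_Lambda \<alpha>) (brjuno_alpha \<alpha> u \<nu>)))"
proof -
  have example: "generalized_brjuno_on (alpha_Lambda \<alpha>) (brjuno_alpha \<alpha> u \<nu>)"
    if "\<alpha> \<in> {1/2..1}" "(\<exists>n::nat. 1 \<le> n \<and> u = (\<lambda>x. ln (1 / x) ^ n)) \<or> u = (\<lambda>x. 1 / x)" "1 \<le> \<nu>"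
    for \<alpha> u and \<nu> :: nat
    using alpha_example[OF that(1,2)] generalized_brjuno_alpha that(3) by blast
  have ln: "ln (1 / eta (alpha_map 1) j x) = - ln (eta (alpha_map 1) j x)" if "x \<in> alpha_Lambda 1" for x j
    using alpha_orbit_pos[OF that] by (simp add: ln_div)
  have log: "generalized_brjuno_on (alpha_Lambda 1) (brjuno_alpha 1 (\<lambda>x. ln (1 / x) ^ n) 1)" if "1 \<le> n" for n
    by (rule example) (use that in auto)
  have "generalized_brjuno_on (alpha_Lambda 1) yoccoz_brjuno"
    by (rule generalized_brjuno_on_cong[OF log[of 1]]) (simp_all add: yoccoz_brjuno_def brjuno_alpha_def ln)
  moreover have "generalized_brjuno_on (alpha_Lambda 1) wilton1"
    by (rule generalized_brjuno_on_cong[OF log[of 2]]) (simp_all add: wilton1_def brjuno_alpha_def ln)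
  ultimately show ?thesis
  proof (intro conjI ballI allI impI)
    fix \<alpha> :: real and u l r and \<nu> :: nat
    assume "\<alpha> \<in> {1/2..1}"
    then show "1 \<le> \<nu> \<and> alpha_branches \<alpha> l r \<and>
       (\<forall>x\<in>{0<..<1}. 0 < u x) \<and> C1_on {0<..<1} u \<and> filterlim u at_top (at_right 0) \<and>
       U2 l r (alpha_map \<alpha>) u \<and> U3 l r u \<and>
       U4 l r (alpha_map \<alpha>) u \<and> U5 l r (alpha_map \<alpha>) u \<Longrightarrow>
       generalized_brjuno_on (alpha_Lambda \<alpha>) (brjuno_alpha \<alpha> u \<nu>)"
      by (intro alpha_general) auto
  next
    fix \<alpha> :: real and u :: "real \<Rightarrow> real"
    assume "\<alpha> \<in> {1/2..1}" "(\<exists>n::nat. 1 \<le> n \<and> u = (\<lambda>x. ln (1 / x) ^ n)) \<or> u = (\<lambda>x. 1 / x)"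
    from alpha_example[OF this]
    show "\<exists>l r. alpha_branches \<alpha> l r \<and> G_conditions l r (alpha_map \<alpha>) \<and> U_conditions l r (alpha_map \<alpha>) u"
      by blast
  qed (use example in auto)
qed

end
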